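(* Let $h$ be a (sufficiently small) step size. The implicit midpoint method $$Q_n=\tilde Q-\tfrac h2 f(\tilde Q,\tilde P),\quad Q_{n+1}=\tilde Q+\tfrac h2 f(\tilde Q,\tilde P),\qquad P_n=\tilde P-\tfrac h2 g(\tilde Q,\tilde P,\alpha),\quad P_{n+1}=\tilde P+\tfrac h2 g(\tilde Q,\tilde P,\alpha),$$ with $f(Q,P)=-M_1Q$ and $g(Q,P,\alpha)=M_1^\dagger P+2M_2^\dagger Q\alpha^\dagger$, applied to the Hamiltonian system $\dot Q=-M_1Q$, $\dot P=M_1^\dagger P+2M_2^\dagger Q\alpha^\dagger$, $\dot\alpha=0$, descends via $$W=\tfrac12(QP^\dagger-PQ^\dagger),\qquad \Theta=Q\alpha Q^\dagger$$ to a Lie--Poisson integrator $\phi_h\colon\mathfrak f^*\to\mathfrak f^*$, $(W_n,\Theta_n)\mapsto(W_{n+1},\Theta_{n+1})$, for the Lie--Poisson flow $$\dot W=[W,M_1]+[\Theta,M_2],\qquad \dot\Theta=[\Theta,M_1]$$ on the dual $\mathfrak f^*$ of $\mathfrak f=\mathfrak{su}(N)\ltimes\mathfrak{su}(N)^*$. The method is defined by the equations $$\Theta_n=\tilde\Theta-\tfrac h2[\tilde\Theta,\tilde M_1]-\tfrac{h^2}{4}\tilde M_1\tilde\Theta\tilde M_1,\qquad \Theta_{n+1}=\Theta_n+h[\tilde\Theta,\tilde M_1],$$ $$W_n=\tilde W-\tfrac h2[\tilde W,\tilde M_1]-\tfrac h2[\tilde\Theta,\tilde M_2]-\tfrac{h^2}{4}\left(\tilde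 M_1\tilde W\tilde M_1+\tilde M_2\tilde\Theta\tilde M_1+\tilde M_1\tilde\Theta\tilde M_2\right),$$ $$W_{n+1}=W_n+h[\tilde W,\tilde M_1]+h[\tilde\Theta,\tilde M_2],$$ where $\tilde M_1=\Delta_N^{-1}(\tilde W)$, $\tilde M_2=\Delta_N(\tilde\Theta)$. Furthermore, this integrator preserves the Casimirs: for all smooth $f,g\colon\mathbb R\to\mathbb R$, $$\operatorname{tr}(f(\Theta_n))=\operatorname{tr}(f(\Theta_{n+1})),\qquad \operatorname{tr}(W_ng(\Theta_n))=\operatorname{tr}(W_{n+1}g(\Theta_{n+1})).$$
   Context: $N\ge2$, $\hbar=2/\sqrt{N^2-1}$. $\mathfrak{u}(N)$ (resp. $\mathfrak{su}(N)$) denotes the skew-Hermitian (resp. trace-free skew-Hermitian) $N\times N$ matrices. Let $X_1,X_2,X_3$ be Hermitian generators of the spin-$(N-1)/2$ unitary irreducible representation of $\mathfrak{so}(3)$, scaled so that $\frac1\hbar[X_a,X_b]=\mathrm i\varepsilon_{abc}X_c$ and $X_1^2+X_2^2+X_3^2=\mathbb I$. The Hoppe--Yau Laplacian is $\Delta_N(A)=-\frac1{\hbar^2}\sum_{a=1}^3[X_a,[X_a,A]]$; it is self-adjoint for the Frobenius inner product, has eigenvalues $-l(l+1)$, $l=0,\dots,N-1$, and restricts to a bijection of $\mathfrak{su}(N)$. Its inverse on $\mathfrak{su}(N)$ is extended to $\mathfrak u(N)$ by $\Delta_N^{-1}(\mathrm iI)=0$. In the flow, $M_1=\Delta_N^{-1}W$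 and $M_2=\Delta_N\Theta$; in the canonical system $W,\Theta$ in these expressions are the functions $W=\frac12(QP^\dagger-PQ^\dagger)$, $\Theta=Q\alpha Q^\dagger$ of $(Q,P,\alpha)$, with $\alpha\in\mathfrak{su}(N)$ a constant parameter. $\mathfrak{su}(N)^*$ is identified with $\mathfrak{su}(N)$ by $\langle A,B\rangle=\operatorname{tr}(A^\dagger B)$, with $\operatorname{ad}^*_vb=[v^\dagger,b]$. The Lie bracket on $\mathfrak f$ is $[(v,a),(w,b)]=([v,w],\operatorname{ad}^*_wa-\operatorname{ad}^*_vb)$; $\mathfrak f^*$ is identified with $\mathfrak{su}(N)\times\mathfrak{su}(N)^*$ via $\langle(\xi,a),(w,b)\rangle=\langle b,\xi\rangle+\langle a,w\rangle$, and the state $(W,\Theta)$ corresponds to $J=(\Theta,W^\dagger)\in\mathfrak f^*$. $\mathfrak f^*$ carries its Lie--Poisson bracket $\{F,G\}(J)=\pm\langle J,[dF(J),dG(J)]\rangle$ (overall sign a convention). The Hamiltonian is $H(W,\Theta)=\frac12(\operatorname{tr}(W^\dagger M_1)+\operatorname{tr}(\Theta^\dagger M_2))$. A Lie--Poisson integrator for the flow is a one-step numerical method for it whose step map is a Poisson map of $\mathfrak f^*$. The method on $(Q,P)$ (with parameter $\alpha$) descends to $\phi_h$ if $(W_{n+1},\Theta_{n+1})$ computed from $(Q_{n+1},P_{n+1},\alpha)$ equals $\phi_h$ of $(W_n,\Theta_n)$ computed from $(Q_n,P_n,\alpha)$. The intermediate quantities $\tilde W,\tilde\Theta\in\mathfrak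 u(N)$ are the solution of the two implicit equations (for $W_n$ and $\Theta_n$) close to $(W_n,\Theta_n)$, which exists for small $h$; $\tilde Q$ need not be unitary. For skew-Hermitian $\Theta=U\operatorname{diag}(\mathrm i\lambda_1,\dots,\mathrm i\lambda_N)U^\dagger$ ($U$ unitary, $\lambda_j\in\mathbb R$), $f(\Theta)$ means $U\operatorname{diag}(f(\lambda_1),\dots,f(\lambda_N))U^\dagger$. *)

theory Defs
  imports "HOL-Analysis.Analysis"
begin

type_synonym 'n cmat = "((complex, 'n) vec, 'n) vec"


subsection \<open>Matrices, the algebras u(N) and su(N), and functional calculus\<close>

definition dagger :: "('n::finite) cmat \<Rightarrow> 'n cmat"  ("_\<^sup>\<dagger>" [1000] 999)
  where "A\<^sup>\<dagger> = (\<chi> i j. cnj (A $ j $ i))"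

definition commutator :: "('n::finite) cmat \<Rightarrow> 'n cmat \<Rightarrow> 'n cmat"
  where "commutator A B = A ** B - B ** A"

definition unitary :: "('n::finite) cmat \<Rightarrow> bool"
  where "unitary U \<longleftrightarrow> U ** U\<^sup>\<dagger> = mat 1 \<and> U\<^sup>\<dagger> ** U = mat 1"

definition u_alg :: "(('n::finite) cmat) set"
  where "u_alg = {A. A\<^sup>\<dagger> = - A}"

definition su_alg :: "(('n::finite) cmat) set"
  where "su_alg = {A. A\<^sup>\<dagger> = - A \<and> trace A = 0}"

text \<open>The real part is taken only to obtain a real-valued pairing: \<open>trace (A\<^sup>\<dagger> ** B)\<close> is
  already real for skew-Hermitian \<open>A\<close> and \<open>B\<close>.\<close>

definition frob :: "('n::finite) cmat \<Rightarrow> 'n cmat \<Rightarrow> real"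
  where "frob A B = Re (trace (A\<^sup>\<dagger> ** B))"

definition diag_mat :: "('n::finite \<Rightarrow> complex) \<Rightarrow> 'n cmat"
  where "diag_mat d = (\<chi> i j. if i = j then d i else 0)"

text \<open>For skew-Hermitian \<open>\<Theta>\<close> the value does not depend on the diagonalisation.  The function is
  applied to \<open>\<lambda>\<close>, not to the eigenvalue \<open>\<i> \<lambda>\<close>.\<close>

definition fun_calc :: "(real \<Rightarrow> real) \<Rightarrow> ('n::finite) cmat \<Rightarrow> 'n cmat"
  where "fun_calc f \<Theta> = (THE B. \<exists>U l. unitary U
            \<and> \<Theta> = U ** diag_mat (\<lambda>j. \<i> * of_real (l j)) ** U\<^sup>\<dagger>
            \<and> B = U ** diag_mat (\<lambda>j. of_real (f (l j))) ** U\<^sup>\<dagger>)"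


subsection \<open>Smoothness\<close>

text \<open>Iterated directional derivatives, so that all orders stay in one type.  In finite dimension
  and for open \<open>S\<close> this is the usual notion of a \<open>k\<close> times continuously differentiable map.\<close>

primrec Ck_on :: "nat \<Rightarrow> 'a set \<Rightarrow> ('a::real_normed_vector \<Rightarrow> 'b::real_normed_vector) \<Rightarrow> bool"
  where
    "Ck_on 0 S f \<longleftrightarrow> continuous_on S f"
  | "Ck_on (Suc k) S f \<longleftrightarrow> (\<forall>x\<in>S. f differentiable (at x))
        \<and> (\<forall>v. Ck_on k S (\<lambda>x. frechet_derivative f (at x) v))"

text \<open>The sets \<open>S\<close> of interest are relatively open in a linear subspace; there, smoothness
  is the existence of a smooth extension to an ambient open neighbourhood.\<close>

definition smooth_on :: "'a set \<Rightarrow> ('a::real_normed_vector \<Rightarrow> 'b::real_normed_vector) \<Rightarrow> bool"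
  where "smooth_on S f \<longleftrightarrow>
    (\<exists>U g. open U \<and> S \<subseteq> U \<and> (\<forall>k. Ck_on k U g) \<and> (\<forall>x\<in>S. g x = f x))"


subsection \<open>The Hoppe--Yau Laplacian\<close>

definition hbar :: "nat \<Rightarrow> real"
  where "hbar N = 2 / sqrt (real N ^ 2 - 1)"

text \<open>An irreducible representation of dimension \<open>N\<close> is the one of spin \<open>(N - 1) / 2\<close>; the generators
  are determined up to unitary conjugation.\<close>

definition spin_generators :: "(3 \<Rightarrow> ('n::finite) cmat) \<Rightarrow> bool"
  where "spin_generators X \<longleftrightarrow>
      (\<forall>a. (X a)\<^sup>\<dagger> = X a)
    \<and> (1 / hbar CARD('n)) *\<^sub>R commutator (X 1) (X 2) = mat \<i> ** X 3
    \<and> (1 / hbar CARD('n)) *\<^sub>R commutator (X 2) (X 3) = mat \<i> ** X 1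
    \<and> (1 / hbar CARD('n)) *\<^sub>R commutator (X 3) (X 1) = mat \<i> ** X 2
    \<and> (\<Sum>a\<in>UNIV. X a ** X a) = mat 1
    \<and> (\<forall>V. vec.subspace V \<and> (\<forall>a. \<forall>v\<in>V. X a *v v \<in> V) \<longrightarrow> V = {0} \<or> V = UNIV)"

definition lap :: "(3 \<Rightarrow> ('n::finite) cmat) \<Rightarrow> 'n cmat \<Rightarrow> 'n cmat"
  where "lap X A = - (1 / (hbar CARD('n))\<^sup>2) *\<^sub>R (\<Sum>a\<in>UNIV. commutator (X a) (commutator (X a) A))"

text \<open>The inverse on su(N), extended by zero on the multiples of the identity: the trace part of
  the argument is removed first.\<close>

definition lap_inv :: "(3 \<Rightarrow> ('n::finite) cmat) \<Rightarrow> 'n cmat \<Rightarrow> 'n cmat"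
  where "lap_inv X A = the_inv_into su_alg (lap X) (A - mat (trace A / of_nat CARD('n)))"


subsection \<open>The Lie--Poisson structure\<close>

text \<open>Both the Lie algebra and its dual are represented by pairs from \<open>su_alg \<times> su_alg\<close>, with
  different component roles: \<open>(v, a)\<close> in the algebra has its dual-space part second, and
  \<open>(\<xi>, a)\<close> in the dual pairs its second component with the first component of the algebra.\<close>

definition ad_star :: "('n::finite) cmat \<Rightarrow> 'n cmat \<Rightarrow> 'n cmat"
  where "ad_star v b = commutator (v\<^sup>\<dagger>) b"

definition f_bracket :: "('n::finite) cmat \<times> 'n cmat \<Rightarrow> 'n cmat \<times> 'n cmat \<Rightarrow> 'n cmat \<times> 'n cmat"
  where "f_bracket = (\<lambda>(v, a) (w, b). (commutator v w, ad_star w a - ad_star v b))"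

definition f_dual :: "(('n::finite) cmat \<times> 'n cmat) set"
  where "f_dual = su_alg \<times> su_alg"

definition f_pair :: "('n::finite) cmat \<times> 'n cmat \<Rightarrow> 'n cmat \<times> 'n cmat \<Rightarrow> real"
  where "f_pair = (\<lambda>(\<xi>, a) (w, b). frob b \<xi> + frob a w)"

definition f_diff :: "(('n::finite) cmat \<times> 'n cmat \<Rightarrow> real) \<Rightarrow> 'n cmat \<times> 'n cmat \<Rightarrow> 'n cmat \<times> 'n cmat"
  where "f_diff F J = (THE d. d \<in> su_alg \<times> su_alg
            \<and> (\<exists>F'. (F has_derivative F') (at J within f_dual) \<and> (\<forall>K\<in>f_dual. F' K = f_pair K d)))"

text \<open>Of the two sign conventions this is the one for which the flow below is
  \<open>dF/dt = {F, H}\<close>; the notion of a Poisson map does not depend on the sign.\<close>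

definition lp_bracket ::
    "(('n::finite) cmat \<times> 'n cmat \<Rightarrow> real) \<Rightarrow> ('n cmat \<times> 'n cmat \<Rightarrow> real) \<Rightarrow> 'n cmat \<times> 'n cmat \<Rightarrow> real"
  where "lp_bracket F G J = f_pair J (f_bracket (f_diff F J) (f_diff G J))"

text \<open>Poisson maps defined on a relatively open subset \<open>D\<close> of the dual.\<close>

definition poisson_map_on ::
    "(('n::finite) cmat \<times> 'n cmat) set \<Rightarrow> ('n cmat \<times> 'n cmat \<Rightarrow> 'n cmat \<times> 'n cmat) \<Rightarrow> bool"
  where "poisson_map_on D \<phi> \<longleftrightarrow> \<phi> ` D \<subseteq> f_dual \<and> smooth_on D \<phi>
    \<and> (\<forall>F G. smooth_on f_dual F \<and> smooth_on f_dual G \<longrightarrow>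
        (\<forall>J\<in>D. lp_bracket (F \<circ> \<phi>) (G \<circ> \<phi>) J = lp_bracket F G (\<phi> J)))"


subsection \<open>The flow and its canonical lift\<close>

text \<open>States are pairs \<open>(W, \<Theta>)\<close>; those in \<open>su_alg \<times> su_alg\<close> correspond to elements of the dual.\<close>

definition to_dual :: "('n::finite) cmat \<times> 'n cmat \<Rightarrow> 'n cmat \<times> 'n cmat"
  where "to_dual = (\<lambda>(W, \<Theta>). (\<Theta>, W\<^sup>\<dagger>))"

definition of_dual :: "('n::finite) cmat \<times> 'n cmat \<Rightarrow> 'n cmat \<times> 'n cmat"
  where "of_dual = (\<lambda>(\<xi>, a). (a\<^sup>\<dagger>, \<xi>))"

definition energy :: "(3 \<Rightarrow> ('n::finite) cmat) \<Rightarrow> 'n cmat \<times> 'n cmat \<Rightarrow> real"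
  where "energy X = (\<lambda>(W, \<Theta>). Re (trace (W\<^sup>\<dagger> ** lap_inv X W) + trace (\<Theta>\<^sup>\<dagger> ** lap X \<Theta>)) / 2)"

definition flow_field :: "(3 \<Rightarrow> ('n::finite) cmat) \<Rightarrow> 'n cmat \<times> 'n cmat \<Rightarrow> 'n cmat \<times> 'n cmat"
  where "flow_field X = (\<lambda>(W, \<Theta>).
    (commutator W (lap_inv X W) + commutator \<Theta> (lap X \<Theta>), commutator \<Theta> (lap_inv X W)))"

definition state_of :: "('n::finite) cmat \<Rightarrow> 'n cmat \<times> 'n cmat \<Rightarrow> 'n cmat \<times> 'n cmat"
  where "state_of \<alpha> = (\<lambda>(Q, P). ((1 / 2) *\<^sub>R (Q ** P\<^sup>\<dagger> - P ** Q\<^sup>\<dagger>), Q ** \<alpha> ** Q\<^sup>\<dagger>))"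

text \<open>The first component of \<open>state_of \<alpha>\<close> does not depend on \<open>\<alpha>\<close>, hence neither does \<open>f_field\<close>.\<close>

definition f_field :: "(3 \<Rightarrow> ('n::finite) cmat) \<Rightarrow> 'n cmat \<Rightarrow> 'n cmat \<times> 'n cmat \<Rightarrow> 'n cmat"
  where "f_field X \<alpha> = (\<lambda>(Q, P). - (lap_inv X (fst (state_of \<alpha> (Q, P))) ** Q))"

definition g_field :: "(3 \<Rightarrow> ('n::finite) cmat) \<Rightarrow> 'n cmat \<Rightarrow> 'n cmat \<times> 'n cmat \<Rightarrow> 'n cmat"
  where "g_field X \<alpha> = (\<lambda>(Q, P).
    (lap_inv X (fst (state_of \<alpha> (Q, P))))\<^sup>\<dagger> ** P
      + 2 *\<^sub>R ((lap X (snd (state_of \<alpha> (Q, P))))\<^sup>\<dagger> ** Q ** \<alpha>\<^sup>\<dagger>))"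


subsection \<open>The two one-step methods\<close>

text \<open>For implicit equations \<open>R x y\<close> with \<open>y\<close> unknown, the solution at distance less than \<open>e\<close>
  from \<open>x\<close>; only meaningful where that solution exists and is unique.\<close>

definition solution_near :: "real \<Rightarrow> ('a::metric_space \<Rightarrow> 'a \<Rightarrow> bool) \<Rightarrow> 'a \<Rightarrow> 'a"
  where "solution_near e R x = (THE y. R x y \<and> dist y x < e)"

definition canonical_eqs ::
    "(3 \<Rightarrow> ('n::finite) cmat) \<Rightarrow> real \<Rightarrow> 'n cmat \<Rightarrow> 'n cmat \<times> 'n cmat \<Rightarrow> 'n cmat \<times> 'n cmat \<Rightarrow> bool"
  where "canonical_eqs X h \<alpha> = (\<lambda>(Q, P) (Qt, Pt).
      Q = Qt - (h / 2) *\<^sub>R f_field X \<alpha> (Qt, Pt)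
    \<and> P = Pt - (h / 2) *\<^sub>R g_field X \<alpha> (Qt, Pt))"

definition canonical_step ::
    "(3 \<Rightarrow> ('n::finite) cmat) \<Rightarrow> real \<Rightarrow> real \<Rightarrow> 'n cmat \<Rightarrow> 'n cmat \<times> 'n cmat \<Rightarrow> 'n cmat \<times> 'n cmat"
  where "canonical_step X e h \<alpha> x = (case solution_near e (canonical_eqs X h \<alpha>) x of (Qt, Pt) \<Rightarrow>
    (Qt + (h / 2) *\<^sub>R f_field X \<alpha> (Qt, Pt), Pt + (h / 2) *\<^sub>R g_field X \<alpha> (Qt, Pt)))"

definition reduced_eqs ::
    "(3 \<Rightarrow> ('n::finite) cmat) \<Rightarrow> real \<Rightarrow> 'n cmat \<times> 'n cmat \<Rightarrow> 'n cmat \<times> 'n cmat \<Rightarrow> bool"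
  where "reduced_eqs X h = (\<lambda>(W, \<Theta>) (Wt, \<Theta>t).
    let M1 = lap_inv X Wt; M2 = lap X \<Theta>t in
      Wt \<in> u_alg \<and> \<Theta>t \<in> u_alg
    \<and> \<Theta> = \<Theta>t - (h / 2) *\<^sub>R commutator \<Theta>t M1 - (h\<^sup>2 / 4) *\<^sub>R (M1 ** \<Theta>t ** M1)
    \<and> W = Wt - (h / 2) *\<^sub>R commutator Wt M1 - (h / 2) *\<^sub>R commutator \<Theta>t M2
          - (h\<^sup>2 / 4) *\<^sub>R (M1 ** Wt ** M1 + M2 ** \<Theta>t ** M1 + M1 ** \<Theta>t ** M2))"

definition reduced_step ::
    "(3 \<Rightarrow> ('n::finite) cmat) \<Rightarrow> real \<Rightarrow> real \<Rightarrow> 'n cmat \<times> 'n cmat \<Rightarrow> 'n cmat \<times> 'n cmat"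
  where "reduced_step X e h z = (case z of (W, \<Theta>) \<Rightarrow>
    (case solution_near e (reduced_eqs X h) z of (Wt, \<Theta>t) \<Rightarrow>
      let M1 = lap_inv X Wt; M2 = lap X \<Theta>t in
        (W + h *\<^sub>R commutator Wt M1 + h *\<^sub>R commutator \<Theta>t M2, \<Theta> + h *\<^sub>R commutator \<Theta>t M1)))"

text \<open>Consistency is the local error bound of order two, uniformly on \<open>D\<close>.\<close>

definition lie_poisson_integrator ::
    "(3 \<Rightarrow> ('n::finite) cmat) \<Rightarrow> ('n cmat \<times> 'n cmat) set \<Rightarrow> real
      \<Rightarrow> (real \<Rightarrow> 'n cmat \<times> 'n cmat \<Rightarrow> 'n cmat \<times> 'n cmat) \<Rightarrow> bool"
  where "lie_poisson_integrator X D h0 \<phi> \<longleftrightarrow>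
      (\<exists>C. \<forall>h\<in>{0<..<h0}. \<forall>z\<in>D. dist (\<phi> h z) (z + h *\<^sub>R flow_field X z) \<le> C * h\<^sup>2)
    \<and> (\<forall>h\<in>{0<..<h0}. poisson_map_on (to_dual ` D) (to_dual \<circ> \<phi> h \<circ> of_dual))"

end

theory Submission
  imports Defs
begin

text \<open>
  The method lives in a bigger associative algebra than the algebra of matrices.  Write a state
  \<open>(W, \<Theta>)\<close> as the matrix \<open>y = \<Theta> + \<epsilon> W\<close> over the dual numbers, \<open>\<epsilon>\<^sup>2 = 0\<close>, and let
  \<open>M y = \<Delta>\<^sup>-\<^sup>1 W + \<epsilon> \<Delta> \<Theta>\<close>.  This map is symmetric for the trace form
  \<open>\<langle>x, y\<rangle> = \<close> (real part of the \<open>\<epsilon>\<close>-coefficient of \<open>tr (x y)\<close>), the flow is the isospectral flow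
  \<open>dy/dt = [y, M y]\<close>, and with \<open>m = (h/2) M y\<close> the two coupled equations of the method become
  \[ y_n = (1 + m)\, y\, (1 - m), \qquad y_{n+1} = (1 - m)\, y\, (1 + m). \]
  Everything is read off from these two formulas.

  \<^emph>\<open>Poisson property.\<close>  The bracket of two functions is \<open>\<langle>y, [p, q]\<rangle>\<close>, where \<open>p, q\<close> are their
  gradients for the trace form.  If covectors \<open>q\<^sub>i\<close> at \<open>y\<^sub>n\<close> are the pull-backs of covectors \<open>p\<^sub>i\<close>
  at \<open>y\<^sub>n\<^sub>+\<^sub>1\<close>, then differentiating both formulas in the intermediate point \<open>y\<close> and using the
  symmetry of \<open>M\<close> once gives \<open>\<langle>y\<^sub>n, [q\<^sub>1, q\<^sub>2]\<rangle> = \<langle>y\<^sub>n\<^sub>+\<^sub>1, [p\<^sub>1, p\<^sub>2]\<rangle>\<close>: after expansion the mixed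
  terms cancel by cyclicity of the trace.  This is the algebraic identity \<open>end_start_poisson\<close>,
  valid in every associative algebra with a symmetric trace form; \<open>midpoint_poisson\<close>
  transfers it to the dual of \<open>\<ff>\<close>.  There is one subtlety: \<open>y\<close> need not be
  trace free, so pulled-back covectors must first be extended from \<open>su(N)\<close> to \<open>u(N)\<close>.  The
  extension is ambiguous only by central elements, which commutators do not see.

  \<^emph>\<open>Existence and smoothness.\<close>  The equation for \<open>y\<close> is \<open>y = y\<^sub>n + h G(h, y)\<close> with a polynomial
  \<open>G\<close>, so the contraction principle gives a unique solution near \<open>y\<^sub>n\<close>, uniformly on bounded sets
  and also inside every closed set that is preserved by the iteration (this is how the solution is
  seen to be skew-Hermitian).  The polynomial expressions in the solution map and in the inverse of
  the linearised equation form a class that is closed under directional derivatives; hence the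
  step is smooth of all orders.

  \<^emph>\<open>Descent.\<close>  One checks that \<open>state_of \<alpha>\<close> maps \<open>x - (h/2) v(x)\<close> to the starting point
  and \<open>x + (h/2) v(x)\<close> to the end point belonging to the intermediate state \<open>state_of \<alpha> x\<close>, where
  \<open>v\<close> is the canonical vector field; uniqueness of the intermediate state does the rest.

  \<^emph>\<open>Casimirs.\<close>  The matrix \<open>C = (1 - m\<^sub>1) (1 + m\<^sub>1)\<^sup>-\<^sup>1\<close> is the Cayley transform of a skew-Hermitian
  matrix, hence unitary, and \<open>\<Theta>\<^sub>n\<^sub>+\<^sub>1 = C \<Theta>\<^sub>n C\<^sup>\<dagger>\<close>, while \<open>W\<^sub>n - C\<^sup>\<dagger> W\<^sub>n\<^sub>+\<^sub>1 C\<close> is a commutator with \<open>\<Theta>\<^sub>n\<close>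
  and so has zero trace against every function of \<open>\<Theta>\<^sub>n\<close>.

  The spectral theorem for skew-Hermitian matrices enters twice: it makes the functional
  calculus well defined, and it yields Schur's lemma for the spin representation, that is, the
  invertibility of \<open>\<Delta>\<close> on \<open>su(N)\<close>.
\<close>

section \<open>Complex matrices\<close>

lemma bilinear_matrix_mult: "bounded_bilinear ((**) :: ('n::finite) cmat \<Rightarrow> 'n cmat \<Rightarrow> 'n cmat)"
  unfolding bilinear_conv_bounded_bilinear[symmetric] bilinear_def
  by (auto intro!: linearI simp: vec_eq_iff matrix_matrix_mult_def scaleR_sum_right
      sum.distrib distrib_left distrib_right)

interpretation mm: bounded_bilinear "(**) :: ('n::finite) cmat \<Rightarrow> 'n cmat \<Rightarrow> 'n cmat"
  by (rule bilinear_matrix_mult)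

lemmas mat_ring = mm.add_left mm.add_right mm.diff_left mm.diff_right mm.minus_left mm.minus_right
  mm.scaleR_left mm.scaleR_right matrix_mul_assoc

lemma dagger_nth [simp]: "A\<^sup>\<dagger> $ i $ j = cnj (A $ j $ i)"
  by (simp add: dagger_def)

lemma dagger_add [simp]: "(A + B)\<^sup>\<dagger> = A\<^sup>\<dagger> + B\<^sup>\<dagger>"
  and dagger_diff [simp]: "(A - B)\<^sup>\<dagger> = A\<^sup>\<dagger> - B\<^sup>\<dagger>"
  and dagger_minus [simp]: "(- A)\<^sup>\<dagger> = - A\<^sup>\<dagger>"
  and dagger_scaleR [simp]: "(r *\<^sub>R A)\<^sup>\<dagger> = r *\<^sub>R A\<^sup>\<dagger>"
  and dagger_zero [simp]: "(0::('n::finite) cmat)\<^sup>\<dagger> = 0"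
  and dagger_dagger [simp]: "(A\<^sup>\<dagger>)\<^sup>\<dagger> = A"
  by (simp_all add: vec_eq_iff)

lemma dagger_sum: "(\<Sum>a\<in>S. f a)\<^sup>\<dagger> = (\<Sum>a\<in>S. (f a)\<^sup>\<dagger>)"
  by (induction S rule: infinite_finite_induct) auto

lemma dagger_mult [simp]: "(A ** B)\<^sup>\<dagger> = B\<^sup>\<dagger> ** A\<^sup>\<dagger>"
  by (simp add: vec_eq_iff matrix_matrix_mult_def mult.commute)

lemma dagger_mat [simp]: "(mat c)\<^sup>\<dagger> = mat (cnj c)"
  by (auto simp add: vec_eq_iff mat_def)

lemma linear_dagger: "bounded_linear (dagger :: ('n::finite) cmat \<Rightarrow> _)"
  by (intro linear_conv_bounded_linear[THEN iffD1] linearI) auto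

lemma trace_add: "trace (A + B) = trace A + trace (B :: ('n::finite) cmat)"
  and trace_diff: "trace (A - B) = trace A - trace B"
  and trace_minus: "trace (- A) = - trace A"
  and trace_scaleR: "trace (r *\<^sub>R A) = of_real r * trace A"
  and trace_dagger: "trace (A\<^sup>\<dagger>) = cnj (trace A)"
  and trace_zero: "trace (0 :: 'n cmat) = 0"
  and trace_mat: "trace (mat c :: 'n cmat) = of_nat CARD('n) * c"
  unfolding trace_def
  by (simp_all add: sum.distrib sum_subtractf sum_negf sum_distrib_left
      scaleR_conv_of_real[where 'a = complex] mat_def)

lemma trace_cyc: "trace (A ** B) = trace (B ** (A :: ('n::finite) cmat))"
  by (rule trace_mul_sym)

lemma trace_commutator [simp]: "trace (commutator A (B :: ('n::finite) cmat)) = 0"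
  by (simp add: commutator_def trace_diff trace_cyc[of A])

lemma trace_sum: "trace (\<Sum>a\<in>S. f a) = (\<Sum>a\<in>S. trace (f a :: ('n::finite) cmat))"
  by (induction S rule: infinite_finite_induct) (auto simp: trace_add trace_zero)

lemma mat_mult_left: "mat c ** (A :: ('n::finite) cmat) = (\<chi> i j. c * A $ i $ j)"
  by (simp add: vec_eq_iff mat_def matrix_matrix_mult_def if_distrib if_distribR cong: if_cong)

lemma mat_mult_right: "(A :: ('n::finite) cmat) ** mat c = (\<chi> i j. c * A $ i $ j)"
  by (simp add: vec_eq_iff mat_def matrix_matrix_mult_def if_distrib if_distribR mult.commute cong: if_cong)

lemma mat_commute: "(A :: ('n::finite) cmat) ** mat c = mat c ** A"
  by (simp add: mat_mult_left mat_mult_right)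

lemma frob_eq_inner: "frob A B = A \<bullet> (B :: ('n::finite) cmat)"
proof -
  have "frob A B = (\<Sum>i\<in>UNIV. \<Sum>k\<in>UNIV. (A $ k $ i) \<bullet> (B $ k $ i))"
    by (simp add: frob_def trace_def matrix_matrix_mult_def inner_complex_def)
  also have "\<dots> = A \<bullet> B"
    by (subst sum.swap) (simp add: inner_vec_def)
  finally show ?thesis .
qed

lemma commutator_dagger: "(commutator A B)\<^sup>\<dagger> = commutator (B\<^sup>\<dagger>) (A\<^sup>\<dagger>)"
  by (simp add: commutator_def)

section \<open>The spectral theorem and the functional calculus\<close>

definition cdot :: "complex ^ 'n \<Rightarrow> complex ^ 'n::finite \<Rightarrow> complex"
  where "cdot x y = (\<Sum>i\<in>UNIV. cnj (x $ i) * y $ i)"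

lemma Re_cdot: "Re (cdot x y) = x \<bullet> y"
  by (simp add: cdot_def inner_vec_def inner_complex_def)

lemma cdot_add_right: "cdot x (y + z) = cdot x y + cdot x z"
  and cdot_diff_right: "cdot x (y - z) = cdot x y - cdot x z"
  and cdot_scale_right: "cdot x (c *s y) = c * cdot x y"
  and cdot_scale_left: "cdot (c *s x) y = cnj c * cdot x y"
  and cdot_commute: "cdot y x = cnj (cdot x y)"
  and cdot_zero_right: "cdot x 0 = 0"
  by (simp_all add: cdot_def sum.distrib sum_subtractf sum_distrib_left algebra_simps)

lemma cdot_sum_right: "cdot x (\<Sum>a\<in>S. f a) = (\<Sum>a\<in>S. cdot x (f a))"
  by (induction S rule: infinite_finite_induct) (auto simp: cdot_add_right cdot_zero_right)

lemma cdot_self: "cdot x x = of_real ((norm x)\<^sup>2)"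
proof -
  have "Im (cdot x x) = 0" using cdot_commute[of x x] by (metis Reals_cnj_iff complex_is_Real_iff)
  then show ?thesis by (simp add: complex_eq_iff Re_cdot power2_norm_eq_inner)
qed

lemma cdot_dagger: "cdot x (A *v y) = cdot (A\<^sup>\<dagger> *v x) y"
proof -
  have "cdot x (A *v y) = (\<Sum>i\<in>UNIV. \<Sum>j\<in>UNIV. cnj (x $ i) * (A $ i $ j * y $ j))"
    by (simp add: cdot_def matrix_vector_mult_def sum_distrib_left)
  also have "\<dots> = cdot (A\<^sup>\<dagger> *v x) y"
    by (subst sum.swap) (simp add: cdot_def matrix_vector_mult_def sum_distrib_left sum_distrib_right mult_ac)
  finally show ?thesis .
qed

lemma vec_subspace_imp_subspace:
  assumes "vec.subspace (V :: (complex ^ 'n::finite) set)" shows "subspace V"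
proof -
  have eq: "c *\<^sub>R x = of_real c *s x" for c and x :: "complex ^ 'n"
    by (simp add: vec_eq_iff scaleR_conv_of_real[where 'a = complex])
  show ?thesis using assms by (auto simp: subspace_def vec.subspace_def eq)
qed

text \<open>A maximiser \<open>x\<close> of the quadratic form \<open>\<langle>y, H y\<rangle>\<close> on the unit sphere of \<open>V\<close> is an eigenvector: with
  the maximum \<open>l\<close>, the form \<open>l \<parallel>y\<parallel>\<^sup>2 - \<langle>y, H y\<rangle>\<close> is nonnegative on \<open>V\<close> and vanishes at \<open>x\<close>.\<close>

lemma hermitian_eigenvector:
  fixes H :: "('n::finite) cmat"
  assumes H: "H\<^sup>\<dagger> = H" and V: "vec.subspace V" and inv: "\<And>v. v \<in> V \<Longrightarrow> H *v v \<in> V" and ne: "V \<noteq> {0}"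
  shows "\<exists>x\<in>V. \<exists>l::real. norm x = 1 \<and> H *v x = of_real l *s x"
proof -
  have sV: "subspace V" using V by (rule vec_subspace_imp_subspace)
  have eq: "c *\<^sub>R x = of_real c *s x" for c and x :: "complex ^ 'n"
    by (simp add: vec_eq_iff scaleR_conv_of_real[where 'a = complex])
  have lin: "linear ((*v) H)" by (rule linearI) (auto simp: matrix_vector_right_distrib eq vector_scalar_commute)
  have sym: "x \<bullet> (H *v y) = (H *v x) \<bullet> y" for x y
    using cdot_dagger[of x H y] H by (simp add: Re_cdot[symmetric])
  let ?q = "\<lambda>x. x \<bullet> (H *v x)"
  obtain v where v: "v \<in> V" "v \<noteq> 0" using ne V vec.subspace_0 by blast
  have "compact (sphere 0 1 \<inter> V)" by (intro compact_Int_closed compact_sphere closed_subspace sV)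
  moreover have "(1 / norm v) *\<^sub>R v \<in> sphere 0 1 \<inter> V"
    using v by (auto intro: subspace_scale[OF sV])
  moreover have "continuous_on (sphere 0 1 \<inter> V) ?q"
    by (intro continuous_on_inner continuous_on_id linear_continuous_on) (use lin in \<open>simp add: linear_conv_bounded_linear\<close>)
  ultimately have "\<exists>x\<in>sphere 0 1 \<inter> V. \<forall>y\<in>sphere 0 1 \<inter> V. ?q y \<le> ?q x"
    by (intro continuous_attains_sup) blast+
  then obtain x where x: "x \<in> sphere 0 1 \<inter> V" and mx: "\<And>y. y \<in> sphere 0 1 \<inter> V \<Longrightarrow> ?q y \<le> ?q x"
    by blast
  define l where "l = ?q x"
  have nonneg: "?q y \<le> l * (y \<bullet> y)" if "y \<in> V" for y
  proof (cases "y = 0")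
    case False
    have "?q ((1 / norm y) *\<^sub>R y) \<le> l"
      unfolding l_def using that False by (intro mx) (auto intro: subspace_scale[OF sV])
    then have "?q y / (norm y * norm y) \<le> l"
      by (simp add: linear_cmul[OF lin])
    then have "?q y \<le> l * (norm y * norm y)" using False by (simp add: divide_le_eq)
    then show ?thesis by (simp add: dot_square_norm power2_eq_square)
  qed (simp add: matrix_vector_mult_0_right)
  \<comment> \<open>half the gradient at \<open>x\<close> of the nonnegative form, which lies in \<open>V\<close>; moving from \<open>x\<close> a
    little against it would make the form negative\<close>
  define w where "w = l *\<^sub>R x - H *v x"
  have wV: "w \<in> V" unfolding w_def using x inv by (intro subspace_diff[OF sV] subspace_scale[OF sV]) auto
  define c where "c = l * (w \<bullet> w) - ?q w"
  have key: "0 \<le> 2 * t * (w \<bullet> w) + t\<^sup>2 * c" for t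
  proof -
    have "0 \<le> l * ((x + t *\<^sub>R w) \<bullet> (x + t *\<^sub>R w)) - ?q (x + t *\<^sub>R w)"
      using nonneg[of "x + t *\<^sub>R w"] x wV by (simp add: subspace_add[OF sV] subspace_scale[OF sV])
    also have "\<dots> = (l * (x \<bullet> x) - ?q x) + 2 * t * ((l *\<^sub>R x - H *v x) \<bullet> w) + t\<^sup>2 * c"
      using sym[of x w] inner_commute[of w x] inner_commute[of w "H *v x"]
      by (simp add: linear_add[OF lin] linear_cmul[OF lin] inner_simps c_def
          power2_eq_square algebra_simps)
    also have "l * (x \<bullet> x) - ?q x = 0"
      using x by (simp add: l_def norm_eq_1)
    finally show ?thesis by (simp add: w_def)
  qed
  have "w \<bullet> w = 0"
  proof (rule ccontr)
    assume "w \<bullet> w \<noteq> 0"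
    then have pos: "w \<bullet> w > 0" by (simp add: less_le)
    \<comment> \<open>small enough for the linear term to dominate the quadratic one\<close>
    define t where "t = - (w \<bullet> w) / (1 + \<bar>c\<bar>)"
    have tn: "t < 0" using pos by (simp add: t_def)
    have "t * (2 * (w \<bullet> w) + t * c) \<ge> 0" using key[of t] by (simp add: power2_eq_square algebra_simps)
    then have "2 * (w \<bullet> w) + t * c \<le> 0" using tn by (simp add: zero_le_mult_iff)
    moreover have "\<bar>t * c\<bar> \<le> w \<bullet> w"
    proof -
      have "\<bar>t * c\<bar> = (w \<bullet> w) * (\<bar>c\<bar> / (1 + \<bar>c\<bar>))" by (simp add: t_def abs_mult)
      also have "\<dots> \<le> (w \<bullet> w) * 1" using pos by (intro mult_left_mono) (auto simp: divide_simps)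
      finally show ?thesis by simp
    qed
    ultimately show False using pos by linarith
  qed
  then have "H *v x = of_real l *s x" by (simp add: w_def eq)
  then show ?thesis using x by (intro bexI[of _ x] exI[of _ l]) auto
qed

definition orthonormal :: "(complex ^ 'n::finite) set \<Rightarrow> bool"
  where "orthonormal S \<longleftrightarrow> (\<forall>s\<in>S. \<forall>t\<in>S. cdot s t = (if s = t then 1 else 0))"

text \<open>The orthogonal complement of a set of eigenvectors is invariant, and it is nonzero as long as
  there are fewer than \<open>N\<close> of them; so the set can be enlarged.\<close>

lemma hermitian_orthonormal_eigenvectors:
  fixes H :: "('n::finite) cmat"
  assumes H: "H\<^sup>\<dagger> = H" and "m \<le> CARD('n)"
  shows "\<exists>S. finite S \<and> card S = m \<and> orthonormal S \<and> (\<forall>s\<in>S. \<exists>l::real. H *v s = of_real l *s s)"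
  using assms(2)
proof (induction m)
  case (Suc m)
  then obtain S where S: "finite S" "card S = m" "orthonormal S" "\<forall>s\<in>S. \<exists>l::real. H *v s = of_real l *s s"
    by auto
  define V where "V = {v. \<forall>s\<in>S. cdot s v = 0}"
  have "vec.subspace V"
    by (auto simp: V_def vec.subspace_def cdot_add_right cdot_scale_right cdot_zero_right)
  moreover have "H *v v \<in> V" if v: "v \<in> V" for v
    unfolding V_def
  proof (intro CollectI ballI)
    fix s assume s: "s \<in> S"
    then obtain l :: real where "H *v s = of_real l *s s" using S by blast
    then show "cdot s (H *v v) = 0" using v s by (simp add: cdot_dagger H cdot_scale_left V_def)
  qed
  moreover have "V \<noteq> {0}"
  proof -
    have "vec.span S \<noteq> UNIV"
    proof
      assume "vec.span S = UNIV"
      then have "vec.dim (UNIV :: (complex ^ 'n) set) \<le> card S"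
        using S(1) by (metis vec.dim_le_card vec.span_UNIV order_refl top_greatest)
      then show False using S(2) Suc.prems by (simp add: vec.dim_UNIV card_cart_basis)
    qed
    then obtain y where y: "y \<notin> vec.span S" by auto
    \<comment> \<open>the Gram--Schmidt residual of a vector outside the span\<close>
    define v where "v = y - (\<Sum>s\<in>S. cdot s y *s s)"
    have "v \<noteq> 0"
    proof
      assume "v = 0"
      then have "y = (\<Sum>s\<in>S. cdot s y *s s)" by (simp add: v_def)
      also have "\<dots> \<in> vec.span S" by (intro vec.span_sum vec.span_scale vec.span_base)
      finally show False using y by simp
    qed
    moreover have "v \<in> V" unfolding V_def
    proof (intro CollectI ballI)
      fix t assume t: "t \<in> S"
      have "(\<Sum>s\<in>S. cdot s y * cdot t s) = (\<Sum>s\<in>S. if s = t then cdot t y else 0)"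
        using S(3) t by (intro sum.cong) (auto simp: orthonormal_def)
      then show "cdot t v = 0"
        using t S(1) by (simp add: v_def cdot_diff_right cdot_sum_right cdot_scale_right)
    qed
    ultimately show ?thesis by auto
  qed
  ultimately obtain x l where x: "x \<in> V" "norm x = 1" "H *v x = of_real (l::real) *s x"
    using hermitian_eigenvector[OF H, of V] by blast
  have xS: "x \<notin> S" using x by (auto simp: V_def cdot_self)
  have "orthonormal (insert x S)"
    using S(3) x xS unfolding orthonormal_def V_def
    by (auto simp: cdot_self) (metis cdot_commute complex_cnj_zero)
  then show ?case using S x xS by (intro exI[of _ "insert x S"]) auto
qed (auto simp: orthonormal_def)

lemma hermitian_diagonalisable:
  fixes H :: "('n::finite) cmat"
  assumes H: "H\<^sup>\<dagger> = H"
  shows "\<exists>U l. unitary U \<and> H = U ** diag_mat (\<lambda>j. of_real (l j :: real)) ** U\<^sup>\<dagger>"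
proof -
  obtain S where S: "finite S" "card S = CARD('n)" "orthonormal S" "\<forall>s\<in>S. \<exists>l::real. H *v s = of_real l *s s"
    using hermitian_orthonormal_eigenvectors[OF H order_refl] by blast
  obtain f where f: "bij_betw f (UNIV :: 'n set) S"
    using S(1,2) by (metis finite_same_card_bij finite)
  define l where "l j = (SOME l::real. H *v f j = of_real l *s f j)" for j
  have l: "H *v f j = of_real (l j) *s f j" for j
    unfolding l_def by (rule someI_ex) (use S(4) f in \<open>auto simp: bij_betw_def\<close>)
  define U :: "'n cmat" where "U = (\<chi> i j. f j $ i)"
  have "(U\<^sup>\<dagger> ** U) $ i $ j = (if i = j then 1 else 0)" for i j
  proof -
    have "(U\<^sup>\<dagger> ** U) $ i $ j = cdot (f i) (f j)"
      by (simp add: matrix_matrix_mult_def U_def cdot_def)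
    also have "\<dots> = (if i = j then 1 else 0)"
      using S(3) f by (auto simp: orthonormal_def bij_betw_def dest: injD)
    finally show ?thesis .
  qed
  then have UU: "U\<^sup>\<dagger> ** U = mat 1" by (simp add: vec_eq_iff mat_def)
  then have UU': "U ** U\<^sup>\<dagger> = mat 1" by (simp add: matrix_left_right_inverse)
  have "H ** U = U ** diag_mat (\<lambda>j. of_real (l j))"
  proof -
    have "(H ** U) $ i $ j = (U ** diag_mat (\<lambda>j. of_real (l j))) $ i $ j" for i j
    proof -
      have "(H ** U) $ i $ j = (H *v f j) $ i"
        by (simp add: matrix_matrix_mult_def matrix_vector_mult_def U_def)
      also have "\<dots> = of_real (l j) * f j $ i" by (simp add: l)
      also have "\<dots> = (U ** diag_mat (\<lambda>j. of_real (l j))) $ i $ j"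
        by (simp add: matrix_matrix_mult_def diag_mat_def U_def if_distrib mult.commute cong: if_cong)
      finally show ?thesis .
    qed
    then show ?thesis by (simp add: vec_eq_iff)
  qed
  then have "H = U ** diag_mat (\<lambda>j. of_real (l j)) ** U\<^sup>\<dagger>"
    by (metis UU' matrix_mul_assoc[of H U "U\<^sup>\<dagger>"] matrix_mul_rid)
  then show ?thesis using UU UU' by (auto simp: unitary_def)
qed

lemma mat_mult_diag: "mat c ** diag_mat d = diag_mat (\<lambda>j. c * d j)"
  by (simp add: mat_mult_left diag_mat_def vec_eq_iff)

lemma diag_mat_mult: "diag_mat a ** diag_mat b = diag_mat (\<lambda>j. a j * b j :: complex)"
proof -
  have "(\<Sum>k\<in>UNIV. (if i = k then a i else 0) * (if k = j then b k else 0)) = (if i = j then a i * b i else 0)" for i j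
    by (subst sum.cong[OF refl, of _ _ "\<lambda>k. if k = i then (if i = j then a i * b i else 0) else 0"]) auto
  then show ?thesis by (simp add: matrix_matrix_mult_def diag_mat_def vec_eq_iff)
qed

lemma skew_diagonalisable:
  fixes A :: "('n::finite) cmat"
  assumes A: "A\<^sup>\<dagger> = - A"
  shows "\<exists>U l. unitary U \<and> A = U ** diag_mat (\<lambda>j. \<i> * of_real (l j :: real)) ** U\<^sup>\<dagger>"
proof -
  have "(mat (- \<i>) ** A)\<^sup>\<dagger> = mat (- \<i>) ** A"
    by (simp add: A mm.minus_left mat_commute[of A]) (simp add: mat_mult_left vec_eq_iff)
  then obtain U l where U: "unitary U" "mat (- \<i>) ** A = U ** diag_mat (\<lambda>j. of_real (l j :: real)) ** U\<^sup>\<dagger>"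
    using hermitian_diagonalisable by blast
  have "A = mat \<i> ** (mat (- \<i>) ** A)" by (simp add: mat_mult_left vec_eq_iff)
  also have "\<dots> = U ** (mat \<i> ** diag_mat (\<lambda>j. of_real (l j))) ** U\<^sup>\<dagger>"
    by (simp add: U(2) matrix_mul_assoc mat_commute[of U])
  finally show ?thesis using U(1) by (auto simp: mat_mult_diag)
qed

text \<open>The unitary change \<open>G = V\<^sup>\<dagger> U\<close> between two diagonalisations intertwines the eigenvalues, so
  \<open>G\<^sub>i\<^sub>j \<noteq> 0\<close> forces the \<open>j\<close>-th eigenvalue on one side to equal the \<open>i\<close>-th on the other; hence \<open>G\<close>
  intertwines their images under \<open>f\<close> as well.\<close>

lemma fun_calc_unique:
  fixes U V :: "('n::finite) cmat"
  assumes "unitary U" "unitary V"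
    and eq: "U ** diag_mat (\<lambda>j. \<i> * of_real (l j)) ** U\<^sup>\<dagger> = V ** diag_mat (\<lambda>j. \<i> * of_real (k j)) ** V\<^sup>\<dagger>"
  shows "U ** diag_mat (\<lambda>j. of_real (f (l j :: real) :: real)) ** U\<^sup>\<dagger> = V ** diag_mat (\<lambda>j. of_real (f (k j))) ** V\<^sup>\<dagger>"
proof -
  define G where "G = V\<^sup>\<dagger> ** U"
  have u: "U\<^sup>\<dagger> ** U = mat 1" "V\<^sup>\<dagger> ** V = mat 1" "U ** U\<^sup>\<dagger> = mat 1" "V ** V\<^sup>\<dagger> = mat 1"
    using assms by (auto simp: unitary_def)
  have GG: "V ** G = U" by (simp add: G_def matrix_mul_assoc u)
  have dG: "(G ** diag_mat d) $ i $ j = G $ i $ j * d j" "(diag_mat d ** G) $ i $ j = d i * G $ i $ j" for d i j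
    by (simp_all add: matrix_matrix_mult_def diag_mat_def if_distrib if_distribR cong: if_cong)
  have "V\<^sup>\<dagger> ** (U ** diag_mat (\<lambda>j. \<i> * of_real (l j)) ** U\<^sup>\<dagger>) ** U
      = V\<^sup>\<dagger> ** (V ** diag_mat (\<lambda>j. \<i> * of_real (k j)) ** V\<^sup>\<dagger>) ** U"
    by (simp only: eq)
  moreover have "V\<^sup>\<dagger> ** (U ** D ** U\<^sup>\<dagger>) ** U = G ** D ** (U\<^sup>\<dagger> ** U)" for D
    by (simp only: G_def matrix_mul_assoc)
  moreover have "V\<^sup>\<dagger> ** (V ** D ** V\<^sup>\<dagger>) ** U = (V\<^sup>\<dagger> ** V) ** D ** G" for D
    by (simp only: G_def matrix_mul_assoc)
  ultimately have gd: "G ** diag_mat (\<lambda>j. \<i> * of_real (l j)) = diag_mat (\<lambda>j. \<i> * of_real (k j)) ** G"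
    by (simp add: u)
  have cases: "G $ i $ j = 0 \<or> l j = k i" for i j
  proof -
    have "G $ i $ j * (\<i> * of_real (l j)) = (\<i> * of_real (k i)) * G $ i $ j"
      using arg_cong[OF gd, of "\<lambda>A. A $ i $ j"] by (simp only: dG)
    then show ?thesis by auto
  qed
  have "(G ** diag_mat (\<lambda>j. of_real (f (l j)))) $ i $ j = (diag_mat (\<lambda>j. of_real (f (k j))) ** G) $ i $ j" for i j
    unfolding dG using cases[of i j] by auto
  then have "G ** diag_mat (\<lambda>j. of_real (f (l j))) = diag_mat (\<lambda>j. of_real (f (k j))) ** G"
    by (simp add: vec_eq_iff)
  then have "V ** (G ** diag_mat (\<lambda>j. of_real (f (l j)))) ** U\<^sup>\<dagger> = V ** (diag_mat (\<lambda>j. of_real (f (k j))) ** G) ** U\<^sup>\<dagger>"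
    by simp
  moreover have "V ** (D ** G) ** U\<^sup>\<dagger> = V ** D ** (V\<^sup>\<dagger> ** (U ** U\<^sup>\<dagger>))" for D
    by (simp only: G_def matrix_mul_assoc)
  ultimately show ?thesis by (simp add: matrix_mul_assoc GG u)
qed

lemma fun_calc_diag:
  fixes U :: "('n::finite) cmat"
  assumes "unitary U"
  shows "fun_calc f (U ** diag_mat (\<lambda>j. \<i> * of_real (l j)) ** U\<^sup>\<dagger>) = U ** diag_mat (\<lambda>j. of_real (f (l j))) ** U\<^sup>\<dagger>"
  unfolding fun_calc_def
proof (rule the_equality, goal_cases)
  case 1
  then show ?case using assms by blast
next
  case (2 B)
  then show ?case using fun_calc_unique[OF assms] by metis
qed

lemma fun_calc_conj:
  fixes A :: "('n::finite) cmat"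
  assumes A: "A\<^sup>\<dagger> = - A" and C: "unitary C"
  shows "fun_calc f (C ** A ** C\<^sup>\<dagger>) = C ** fun_calc f A ** C\<^sup>\<dagger>"
proof -
  obtain U l where U: "unitary U" "A = U ** diag_mat (\<lambda>j. \<i> * of_real (l j :: real)) ** U\<^sup>\<dagger>"
    using skew_diagonalisable[OF A] by blast
  have CU: "unitary (C ** U)" using U(1) C unfolding unitary_def
  proof (elim conjE, intro conjI)
    assume u: "U ** U\<^sup>\<dagger> = mat 1" "U\<^sup>\<dagger> ** U = mat 1" and c: "C ** C\<^sup>\<dagger> = mat 1" "C\<^sup>\<dagger> ** C = mat 1"
    have "C ** U ** (C ** U)\<^sup>\<dagger> = C ** (U ** U\<^sup>\<dagger>) ** C\<^sup>\<dagger>" by (simp add: matrix_mul_assoc)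
    then show "C ** U ** (C ** U)\<^sup>\<dagger> = mat 1" by (simp add: u c)
    have "(C ** U)\<^sup>\<dagger> ** (C ** U) = U\<^sup>\<dagger> ** (C\<^sup>\<dagger> ** C) ** U" by (simp add: matrix_mul_assoc)
    then show "(C ** U)\<^sup>\<dagger> ** (C ** U) = mat 1" by (simp add: u c)
  qed
  have "C ** A ** C\<^sup>\<dagger> = (C ** U) ** diag_mat (\<lambda>j. \<i> * of_real (l j :: real)) ** (C ** U)\<^sup>\<dagger>"
    by (simp add: U(2) matrix_mul_assoc)
  then show ?thesis
    using fun_calc_diag[OF CU, of f l] fun_calc_diag[OF U(1), of f l] U(2)
    by (simp add: matrix_mul_assoc)
qed

lemma fun_calc_commute:
  fixes A :: "('n::finite) cmat"
  assumes A: "A\<^sup>\<dagger> = - A"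
  shows "fun_calc f A ** A = A ** fun_calc f A"
proof -
  obtain U l where U: "unitary U" "A = U ** diag_mat (\<lambda>j. \<i> * of_real (l j :: real)) ** U\<^sup>\<dagger>"
    using skew_diagonalisable[OF A] by blast
  let ?D = "diag_mat (\<lambda>j. \<i> * of_real (l j :: real))" and ?E = "diag_mat (\<lambda>j. of_real (f (l j)))"
  have comm: "?E ** ?D = ?D ** ?E"
    by (simp add: diag_mat_mult mult.commute)
  have UU: "U\<^sup>\<dagger> ** U = mat 1" using U(1) by (simp add: unitary_def)
  have *: "(U ** P ** U\<^sup>\<dagger>) ** (U ** R ** U\<^sup>\<dagger>) = U ** (P ** R) ** U\<^sup>\<dagger>" for P R
  proof -
    have "(U ** P ** U\<^sup>\<dagger>) ** (U ** R ** U\<^sup>\<dagger>) = U ** P ** (U\<^sup>\<dagger> ** U) ** R ** U\<^sup>\<dagger>"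
      by (simp only: matrix_mul_assoc)
    then show ?thesis by (simp add: UU matrix_mul_assoc)
  qed
  have fc: "fun_calc f A = U ** ?E ** U\<^sup>\<dagger>" using fun_calc_diag[OF U(1)] U(2) by simp
  have "fun_calc f A ** A = U ** (?E ** ?D) ** U\<^sup>\<dagger>"
    by (rule trans[OF arg_cong2[OF fc U(2), of "(**)"] *])
  also have "\<dots> = U ** (?D ** ?E) ** U\<^sup>\<dagger>"
    by (rule arg_cong[OF comm, of "\<lambda>Z. U ** Z ** U\<^sup>\<dagger>"])
  also have "\<dots> = A ** fun_calc f A"
    by (rule trans[OF arg_cong2[OF U(2) fc, of "(**)"] *, symmetric])
  finally show ?thesis .
qed

section \<open>The Hoppe--Yau Laplacian and its inverse\<close>

lemma u_algI: "A\<^sup>\<dagger> = - A \<Longrightarrow> A \<in> u_alg" and u_algD: "A \<in> u_alg \<Longrightarrow> A\<^sup>\<dagger> = - A"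
  by (simp_all add: u_alg_def)

lemma su_alg_iff: "A \<in> su_alg \<longleftrightarrow> A \<in> u_alg \<and> trace A = 0"
  by (simp add: su_alg_def u_alg_def)

lemma subspace_u_alg: "subspace (u_alg :: ('n::finite) cmat set)"
  by (auto simp: subspace_def u_alg_def)

lemma subspace_su_alg: "subspace (su_alg :: ('n::finite) cmat set)"
  by (auto simp: subspace_def su_alg_def trace_add trace_scaleR trace_zero)

lemma trace_mat_mult: "trace (mat c ** A) = c * trace (A :: ('n::finite) cmat)"
  unfolding mat_mult_left trace_def by (simp add: sum_distrib_left)

text \<open>The inverse Laplacian only makes sense for skew-Hermitian arguments.  Composing it with the
  projection onto them gives a linear map of all matrices, so that the equations of the method
  can be analysed in the whole matrix space.\<close>

definition skew_part :: "('n::finite) cmat \<Rightarrow> 'n cmat"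
  where "skew_part A = (1 / 2) *\<^sub>R (A - A\<^sup>\<dagger>)"

lemma skew_part_u: "skew_part A \<in> u_alg"
  by (intro u_algI) (simp add: skew_part_def scaleR_diff_right)

lemma skew_part_id: "A \<in> u_alg \<Longrightarrow> skew_part A = A"
  by (simp add: skew_part_def u_alg_def flip: scaleR_2)

lemma linear_skew_part: "linear (skew_part :: ('n::finite) cmat \<Rightarrow> _)"
  by (rule linearI) (simp_all add: skew_part_def algebra_simps)

text \<open>Hermitian and skew-Hermitian matrices are orthogonal for the real part of the trace form.\<close>

lemma Re_trace_skew_part:
  assumes "B \<in> u_alg" shows "Re (trace (skew_part A ** B)) = Re (trace (A ** B))"
proof -
  have "trace (A\<^sup>\<dagger> ** B) = cnj (trace (B\<^sup>\<dagger> ** A))" by (simp flip: trace_dagger)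
  also have "B\<^sup>\<dagger> ** A = - (B ** A)" using assms by (simp add: u_alg_def mm.minus_left)
  finally have "trace (A\<^sup>\<dagger> ** B) = - cnj (trace (A ** B))"
    by (simp add: trace_minus trace_cyc[of B])
  then show ?thesis by (simp add: skew_part_def mm.scaleR_left mm.diff_left trace_scaleR trace_diff)
qed

lemma hbar_pos: "N \<ge> 2 \<Longrightarrow> hbar N > 0"
proof -
  assume "N \<ge> 2"
  then have "(real N)\<^sup>2 \<ge> 2\<^sup>2" by (intro power_mono) auto
  then show ?thesis by (simp add: hbar_def)
qed

lemma commutator_linear: "linear (commutator (A :: ('n::finite) cmat))"
  by (rule linearI) (simp_all add: commutator_def mat_ring algebra_simps)

lemma lap_linear: "linear (lap X :: ('n::finite) cmat \<Rightarrow> _)"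
  unfolding lap_def
  by (rule linearI) (simp_all add: linear_add[OF commutator_linear] linear_cmul[OF commutator_linear]
      sum.distrib scaleR_add_right mult.commute flip: scaleR_sum_right)

lemma trace_lap: "trace (lap X A) = 0"
  by (simp add: lap_def trace_minus trace_scaleR trace_sum)

text \<open>The trace form is invariant, so \<open>[X, _]\<close> is antisymmetric for it and its square is symmetric.\<close>

lemma trace_commutator_shift:
  "trace (A ** commutator X B) = - trace (commutator X A ** (B :: ('n::finite) cmat))"
  using trace_cyc[of "A ** B" X] by (simp add: commutator_def mat_ring trace_diff)

lemma lap_symmetric: "trace (A ** lap X B) = trace (lap X A ** (B :: ('n::finite) cmat))"
proof -
  have "trace (A ** commutator (X a) (commutator (X a) B)) = trace (commutator (X a) (commutator (X a) A) ** B)" for a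
    by (simp add: trace_commutator_shift)
  then show ?thesis
    by (simp add: lap_def mm.minus_left mm.minus_right mm.scaleR_left mm.scaleR_right trace_minus trace_scaleR
        mm.sum_left mm.sum_right trace_sum)
qed

locale spin_rep =
  fixes X :: "3 \<Rightarrow> ('n::finite) cmat"
  assumes N2: "CARD('n) \<ge> 2" and X: "spin_generators X"
begin

lemma X_hermitian: "(X a)\<^sup>\<dagger> = X a"
  using X by (simp add: spin_generators_def)

lemma lap_dagger: "(lap X A)\<^sup>\<dagger> = lap X (A\<^sup>\<dagger>)"
proof -
  have "commutator (commutator (A\<^sup>\<dagger>) (X a)) (X a) = commutator (X a) (commutator (X a) (A\<^sup>\<dagger>))" for a
    by (simp add: commutator_def mat_ring)
  then show ?thesis by (simp add: lap_def dagger_sum commutator_dagger X_hermitian)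
qed

lemma lap_u: "A \<in> u_alg \<Longrightarrow> lap X A \<in> su_alg"
  by (simp add: su_alg_iff trace_lap u_alg_def lap_dagger linear_neg[OF lap_linear])

text \<open>An eigenspace of \<open>A\<close> is invariant under everything that commutes with \<open>A\<close>, hence it is the
  whole space by irreducibility; a scalar matrix of trace zero vanishes.\<close>

lemma schur:
  assumes A: "A\<^sup>\<dagger> = - A" "trace A = 0" and comm: "\<And>a. commutator (X a) A = 0"
  shows "A = 0"
proof -
  obtain U l where U: "unitary U" "A = U ** diag_mat (\<lambda>j. \<i> * of_real (l j :: real)) ** U\<^sup>\<dagger>"
    using skew_diagonalisable[OF A(1)] by blast
  fix j :: 'n
  define c where "c = \<i> * of_real (l j)"
  define v where "v = U *v axis j 1"
  have UU: "U\<^sup>\<dagger> ** U = mat 1" using U(1) by (simp add: unitary_def)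
  have "U\<^sup>\<dagger> *v v = axis j 1" by (simp add: v_def matrix_vector_mul_assoc UU)
  then have vne: "v \<noteq> 0" by (metis axis_eq_0_iff matrix_vector_mult_0_right zero_neq_one)
  have "diag_mat (\<lambda>j. \<i> * of_real (l j)) *v axis j 1 = c *s axis j 1"
  proof (intro vec_eq_iff[THEN iffD2] allI)
    fix i
    have "(diag_mat (\<lambda>j. \<i> * of_real (l j)) *v axis j 1) $ i = (\<Sum>k\<in>UNIV. if k = j then (if i = j then c else 0) else 0)"
      unfolding matrix_vector_mult_def diag_mat_def axis_def vec_lambda_beta
      by (intro sum.cong) (auto simp: c_def)
    then show "(diag_mat (\<lambda>j. \<i> * of_real (l j)) *v axis j 1) $ i = (c *s axis j 1) $ i"
      by (simp add: axis_def)
  qed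
  then have "U *v (diag_mat (\<lambda>j. \<i> * of_real (l j)) *v axis j 1) = c *s v"
    by (simp add: v_def vec.scale)
  moreover have "A *v v = U *v (diag_mat (\<lambda>j. \<i> * of_real (l j)) *v (U\<^sup>\<dagger> *v v))"
    by (simp add: U(2) matrix_vector_mul_assoc matrix_mul_assoc)
  ultimately have "A *v v = c *s v" using \<open>U\<^sup>\<dagger> *v v = axis j 1\<close> by simp
  define V where "V = {w. A *v w = c *s w}"
  have subsp: "vec.subspace V"
    by (auto simp: vec.subspace_def V_def matrix_vector_right_distrib vec.scale vector_add_ldistrib
        vector_smult_assoc mult.commute)
  have inv: "X a *v w \<in> V" if "w \<in> V" for a w
  proof -
    have "A ** X a = X a ** A" using comm[of a] by (simp add: commutator_def)
    then have "A *v (X a *v w) = X a *v (A *v w)" by (simp add: matrix_vector_mul_assoc)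
    then show ?thesis using that by (simp add: V_def vec.scale)
  qed
  have "V = {0} \<or> V = UNIV" using X subsp inv unfolding spin_generators_def by blast
  moreover have "v \<in> V" using \<open>A *v v = c *s v\<close> by (simp add: V_def)
  ultimately have VU: "V = UNIV" using vne by auto
  have "A *v w = mat c *v w" for w
  proof -
    have "mat c *v w = c *s w"
    proof (intro vec_eq_iff[THEN iffD2] allI)
      fix i
      have "(mat c *v w) $ i = (\<Sum>j\<in>UNIV. if i = j then c * w $ j else 0)"
        unfolding matrix_vector_mult_def mat_def vec_lambda_beta by (intro sum.cong) auto
      then show "(mat c *v w) $ i = (c *s w) $ i" by simp
    qed
    then show ?thesis using VU by (auto simp: V_def)
  qed
  then have Ac: "A = mat c" by (simp add: matrix_eq)
  then have "c = 0" using A(2) by (simp add: trace_mat)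
  then show ?thesis using Ac by (simp add: mat_def vec_eq_iff)
qed

text \<open>Pairing with \<open>A\<close> turns \<open>\<Delta> A = 0\<close> into the vanishing of a sum of squared norms of the
  commutators \<open>[X\<^sub>a, A]\<close>.\<close>

lemma lap_eq_0:
  assumes A: "A \<in> su_alg" and "lap X A = 0" shows "A = 0"
proof -
  have Au: "A\<^sup>\<dagger> = - A" "trace A = 0" using A by (auto simp: su_alg_def)
  have "(\<Sum>a\<in>UNIV. commutator (X a) (commutator (X a) A)) = 0"
    using assms(2) hbar_pos[OF N2] by (simp add: lap_def)
  then have "trace (A ** (\<Sum>a\<in>UNIV. commutator (X a) (commutator (X a) A))) = 0"
    by (simp add: mm.zero_right trace_zero)
  then have "(\<Sum>a\<in>UNIV. trace (A ** commutator (X a) (commutator (X a) A))) = 0"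
    by (simp only: mm.sum_right trace_sum)
  then have "(\<Sum>a\<in>UNIV. Re (trace (A ** commutator (X a) (commutator (X a) A)))) = 0"
    by (simp only: Re_sum[symmetric] zero_complex.sel)
  moreover have "Re (trace (A ** commutator (X a) (commutator (X a) A))) = - (norm (commutator (X a) A))\<^sup>2" for a
  proof -
    have K: "(commutator (X a) A)\<^sup>\<dagger> = commutator (X a) A"
      by (simp add: commutator_dagger X_hermitian Au) (simp add: commutator_def mat_ring)
    have "Re (trace (commutator (X a) A ** commutator (X a) A)) = (norm (commutator (X a) A))\<^sup>2"
      using frob_eq_inner[of "commutator (X a) A" "commutator (X a) A"] by (simp only: frob_def K dot_square_norm)
    then show ?thesis by (simp add: trace_commutator_shift)
  qed
  ultimately have "(\<Sum>a\<in>UNIV. (norm (commutator (X a) A))\<^sup>2) = 0"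
    by (simp only: sum_negf neg_equal_0_iff_equal)
  then have "\<forall>a. (norm (commutator (X a) A))\<^sup>2 = 0"
    by (subst (asm) sum_nonneg_eq_0_iff) auto
  then show ?thesis by (intro schur[OF Au]) simp
qed

lemma lap_bij: "bij_betw (lap X) su_alg su_alg"
proof -
  have sub: "lap X ` su_alg \<subseteq> su_alg" using lap_u by (auto simp: su_alg_iff)
  have inj: "inj_on (lap X) su_alg"
    by (subst linear_injective_on_subspace_0[OF lap_linear subspace_su_alg]) (auto intro: lap_eq_0)
  have "span su_alg = (su_alg :: 'n cmat set)"
    using subspace_su_alg by (simp add: span_eq_iff)
  then have "dim (lap X ` su_alg) = dim (su_alg :: 'n cmat set)"
    using inj by (intro dim_image_eq lap_linear) (simp only:)
  then have "lap X ` su_alg = su_alg"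
    by (intro subspace_dim_equal sub linear_subspace_image lap_linear subspace_su_alg) simp
  then show ?thesis using inj by (simp add: bij_betw_def)
qed

definition linv :: "'n cmat \<Rightarrow> 'n cmat"
  where "linv A = lap_inv X (skew_part A)"

lemma lap_inv_props:
  assumes "A \<in> u_alg"
  shows "lap_inv X A \<in> su_alg" "lap X (lap_inv X A) = A - mat (trace A / of_nat CARD('n))"
proof -
  have "cnj (trace A) = - trace A" using assms by (simp add: u_alg_def trace_minus flip: trace_dagger)
  then have "A - mat (trace A / of_nat CARD('n)) \<in> su_alg"
    using assms by (simp add: su_alg_def u_alg_def trace_diff trace_mat) (simp add: mat_def vec_eq_iff)
  then show "lap_inv X A \<in> su_alg" "lap X (lap_inv X A) = A - mat (trace A / of_nat CARD('n))"
    using lap_bij unfolding lap_inv_def bij_betw_def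
    by (auto intro: the_inv_into_into f_the_inv_into_f)
qed

lemma lap_inv_eqI:
  assumes "A \<in> u_alg" "B \<in> su_alg" "lap X B = A - mat (trace A / of_nat CARD('n))"
  shows "lap_inv X A = B"
  using assms lap_inv_props[OF assms(1)] lap_bij by (metis bij_betw_def inj_onD)

lemma linv_eq: "A \<in> u_alg \<Longrightarrow> linv A = lap_inv X A"
  by (simp add: linv_def skew_part_id)

lemma linv_su: "linv A \<in> su_alg"
  unfolding linv_def by (intro lap_inv_props skew_part_u)

lemma linv_u: "linv A \<in> u_alg"
  using linv_su[of A] by (simp add: su_alg_iff)

lemma lap_linv: "lap X (linv A) = skew_part A - mat (trace (skew_part A) / of_nat CARD('n))"
  unfolding linv_def by (intro lap_inv_props skew_part_u)

lemma mat_add: "mat (a + b) = mat a + (mat b :: 'n cmat)"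
  by (auto simp: mat_def vec_eq_iff)

lemma mat_scaleR: "mat (of_real r * a) = r *\<^sub>R (mat a :: 'n cmat)"
  by (auto simp: mat_def vec_eq_iff scaleR_conv_of_real[where 'a = complex])

lemma linv_linear: "linear linv"
proof (rule linearI)
  note s = linear_add[OF linear_skew_part] linear_cmul[OF linear_skew_part]
  fix A B :: "'n cmat" and r :: real
  have "lap_inv X (skew_part (A + B)) = linv A + linv B"
    using linv_su[of A] linv_su[of B]
    by (intro lap_inv_eqI skew_part_u subspace_add[OF subspace_su_alg])
       (simp_all add: linear_add[OF lap_linear] lap_linv s trace_add add_divide_distrib mat_add)
  then show "linv (A + B) = linv A + linv B" by (simp add: linv_def)
  have "lap_inv X (skew_part (r *\<^sub>R A)) = r *\<^sub>R linv A"
  proof (intro lap_inv_eqI skew_part_u subspace_scale[OF subspace_su_alg] linv_su)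
    have "trace (r *\<^sub>R skew_part A) / of_nat CARD('n) = of_real r * (trace (skew_part A) / of_nat CARD('n))"
      by (simp add: trace_scaleR)
    then show "lap X (r *\<^sub>R linv A) = skew_part (r *\<^sub>R A) - mat (trace (skew_part (r *\<^sub>R A)) / of_nat CARD('n))"
      by (simp only: linear_cmul[OF lap_linear] lap_linv s scaleR_diff_right mat_scaleR)
  qed
  then show "linv (r *\<^sub>R A) = r *\<^sub>R linv A" by (simp add: linv_def)
qed

text \<open>Both sides equal the pairing of \<open>\<Delta> (linv A)\<close> with \<open>linv B\<close>: the trace part that \<open>\<Delta>\<close> does
  not see is paired with a trace-free matrix.\<close>

lemma linv_symmetric: "Re (trace (A ** linv B)) = Re (trace (linv A ** B))"
proof -
  have *: "Re (trace (C ** linv B)) = Re (trace (lap X (linv C) ** linv B))" for B C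
  proof -
    have "trace (mat c ** linv B) = 0" for c
      unfolding trace_mat_mult using linv_su[of B] by (simp add: su_alg_iff)
    then show ?thesis
      unfolding lap_linv mm.diff_left trace_diff using Re_trace_skew_part[OF linv_u[of B], of C] by simp
  qed
  show ?thesis
    using *[of A B] *[of B A] lap_symmetric[of "linv A" X "linv B"]
      trace_cyc[of "linv A" B] trace_cyc[of "lap X (linv B)" "linv A"]
    by simp
qed

end

section \<open>Solvability of implicit steps\<close>

text \<open>All vector fields below are polynomial.  This property holds for them by composition, and it
  is all that the contraction argument needs.\<close>

definition lipschitz_bdd :: "('a::real_normed_vector \<Rightarrow> 'b::real_normed_vector) \<Rightarrow> bool"
  where "lipschitz_bdd f \<longleftrightarrow>
    (\<forall>R. \<exists>L\<ge>0. \<forall>x y. norm x \<le> R \<longrightarrow> norm y \<le> R \<longrightarrow> norm (f x - f y) \<le> L * norm (x - y))"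

lemma lipschitz_bddE:
  assumes "lipschitz_bdd f"
  obtains L K where "L \<ge> 0" "K \<ge> 0" "\<And>x y. norm x \<le> R \<Longrightarrow> norm y \<le> R \<Longrightarrow> norm (f x - f y) \<le> L * norm (x - y)"
    "\<And>x. norm x \<le> R \<Longrightarrow> norm (f x) \<le> K"
proof -
  obtain L where L: "L \<ge> 0" "\<And>x y. norm x \<le> \<bar>R\<bar> \<Longrightarrow> norm y \<le> \<bar>R\<bar> \<Longrightarrow> norm (f x - f y) \<le> L * norm (x - y)"
    using assms unfolding lipschitz_bdd_def by blast
  show thesis
  proof (rule that[of L "norm (f 0) + L * \<bar>R\<bar>"])
    fix x :: 'a assume x: "norm x \<le> R"
    have "norm (f x) \<le> norm (f 0) + norm (f x - f 0)" by norm
    also have "norm (f x - f 0) \<le> L * norm x" using L(2)[of x 0] x by auto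
    also have "\<dots> \<le> L * \<bar>R\<bar>" using x L(1) by (intro mult_left_mono) auto
    finally show "norm (f x) \<le> norm (f 0) + L * \<bar>R\<bar>" by simp
  qed (use L in \<open>auto intro!: L(2)\<close>)
qed

lemma lipschitz_bdd_const: "lipschitz_bdd (\<lambda>x. c)"
  by (auto simp: lipschitz_bdd_def)

lemma lipschitz_bdd_linear:
  assumes "bounded_linear f" shows "lipschitz_bdd f"
proof -
  interpret bounded_linear f by fact
  obtain K where "\<And>x. norm (f x) \<le> norm x * K" "K \<ge> 0" using nonneg_bounded by blast
  then show ?thesis unfolding lipschitz_bdd_def
    by (intro allI exI[of _ K]) (auto simp: diff[symmetric] mult.commute)
qed

lemma lipschitz_bdd_add:
  assumes "lipschitz_bdd f" "lipschitz_bdd g" shows "lipschitz_bdd (\<lambda>x. f x + g x)"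
  unfolding lipschitz_bdd_def
proof
  fix R :: real
  obtain L where L: "L \<ge> 0" "\<And>x y. norm x \<le> R \<Longrightarrow> norm y \<le> R \<Longrightarrow> norm (f x - f y) \<le> L * norm (x - y)"
    using assms(1) unfolding lipschitz_bdd_def by blast
  obtain K where K: "K \<ge> 0" "\<And>x y. norm x \<le> R \<Longrightarrow> norm y \<le> R \<Longrightarrow> norm (g x - g y) \<le> K * norm (x - y)"
    using assms(2) unfolding lipschitz_bdd_def by blast
  have "norm (f x + g x - (f y + g y)) \<le> (L + K) * norm (x - y)" if "norm x \<le> R" "norm y \<le> R" for x y
  proof -
    have "norm (f x + g x - (f y + g y)) \<le> norm (f x - f y) + norm (g x - g y)" by norm
    then show ?thesis using L(2)[OF that] K(2)[OF that] by (simp add: distrib_right)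
  qed
  then show "\<exists>L\<ge>0. \<forall>x y. norm x \<le> R \<longrightarrow> norm y \<le> R \<longrightarrow> norm (f x + g x - (f y + g y)) \<le> L * norm (x - y)"
    using L(1) K(1) by (intro exI[of _ "L + K"]) auto
qed

lemma lipschitz_bdd_compose:
  assumes f: "lipschitz_bdd f" and g: "lipschitz_bdd g" shows "lipschitz_bdd (\<lambda>x. f (g x))"
  unfolding lipschitz_bdd_def
proof
  fix R :: real
  obtain L K where g': "L \<ge> 0" "K \<ge> 0" "\<And>x y. norm x \<le> R \<Longrightarrow> norm y \<le> R \<Longrightarrow> norm (g x - g y) \<le> L * norm (x - y)"
    "\<And>x. norm x \<le> R \<Longrightarrow> norm (g x) \<le> K"
    using lipschitz_bddE[OF g] by metis
  obtain M where M: "M \<ge> 0" "\<And>x y. norm x \<le> K \<Longrightarrow> norm y \<le> K \<Longrightarrow> norm (f x - f y) \<le> M * norm (x - y)"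
    using f unfolding lipschitz_bdd_def by blast
  have "norm (f (g x) - f (g y)) \<le> (M * L) * norm (x - y)" if "norm x \<le> R" "norm y \<le> R" for x y
  proof -
    have "norm (f (g x) - f (g y)) \<le> M * norm (g x - g y)" using that by (intro M g')
    also have "\<dots> \<le> M * (L * norm (x - y))" using that by (intro mult_left_mono M g')
    finally show ?thesis by (simp add: mult.assoc)
  qed
  then show "\<exists>L\<ge>0. \<forall>x y. norm x \<le> R \<longrightarrow> norm y \<le> R \<longrightarrow> norm (f (g x) - f (g y)) \<le> L * norm (x - y)"
    using M(1) g'(1) by (intro exI[of _ "M * L"]) auto
qed

lemma lipschitz_bdd_bilinear:
  assumes B: "bounded_bilinear B" and f: "lipschitz_bdd f" and g: "lipschitz_bdd g"
  shows "lipschitz_bdd (\<lambda>x. B (f x) (g x))"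
  unfolding lipschitz_bdd_def
proof
  interpret bounded_bilinear B by fact
  fix R :: real
  obtain L1 K1 where f': "L1 \<ge> 0" "K1 \<ge> 0" "\<And>x y. norm x \<le> R \<Longrightarrow> norm y \<le> R \<Longrightarrow> norm (f x - f y) \<le> L1 * norm (x - y)"
    "\<And>x. norm x \<le> R \<Longrightarrow> norm (f x) \<le> K1"
    using lipschitz_bddE[OF f] by metis
  obtain L2 K2 where g': "L2 \<ge> 0" "K2 \<ge> 0" "\<And>x y. norm x \<le> R \<Longrightarrow> norm y \<le> R \<Longrightarrow> norm (g x - g y) \<le> L2 * norm (x - y)"
    "\<And>x. norm x \<le> R \<Longrightarrow> norm (g x) \<le> K2"
    using lipschitz_bddE[OF g] by metis
  obtain K where K: "K \<ge> 0" "\<And>a b. norm (B a b) \<le> norm a * norm b * K" using nonneg_bounded by blast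
  have "norm (B (f x) (g x) - B (f y) (g y)) \<le> (K1 * L2 * K + L1 * K2 * K) * norm (x - y)"
    if xy: "norm x \<le> R" "norm y \<le> R" for x y
  proof -
    have "B (f x) (g x) - B (f y) (g y) = B (f x) (g x - g y) + B (f x - f y) (g y)"
      by (simp add: diff_left diff_right)
    also have "norm \<dots> \<le> norm (f x) * norm (g x - g y) * K + norm (f x - f y) * norm (g y) * K"
      by (rule norm_triangle_le[OF add_mono[OF K(2) K(2)]])
    also have "\<dots> \<le> K1 * (L2 * norm (x - y)) * K + (L1 * norm (x - y)) * K2 * K"
      using xy K(1) f'(1,2) g'(1,2) by (intro add_mono mult_right_mono mult_mono f' g') auto
    finally show ?thesis by (simp add: algebra_simps)
  qed
  then show "\<exists>L\<ge>0. \<forall>x y. norm x \<le> R \<longrightarrow> norm y \<le> R \<longrightarrow> norm (B (f x) (g x) - B (f y) (g y)) \<le> L * norm (x - y)"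
    using f' g' K by (intro exI[of _ "K1 * L2 * K + L1 * K2 * K"]) auto
qed

lemma lipschitz_bdd_diff:
  assumes "lipschitz_bdd f" "lipschitz_bdd g" shows "lipschitz_bdd (\<lambda>x. f x - g x)"
  using lipschitz_bdd_add[OF assms(1) lipschitz_bdd_compose[OF
      lipschitz_bdd_linear[OF bounded_linear_minus[OF bounded_linear_ident]] assms(2)]] by simp

lemma lipschitz_bdd_Pair:
  fixes f :: "'a::real_normed_vector \<Rightarrow> 'b::real_normed_vector" and g :: "'a \<Rightarrow> 'c::real_normed_vector"
  assumes "lipschitz_bdd f" "lipschitz_bdd g" shows "lipschitz_bdd (\<lambda>x. (f x, g x))"
proof -
  have "bounded_linear (\<lambda>a::'b. (a, 0::'c))" "bounded_linear (\<lambda>b::'c. (0::'b, b))"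
    by (simp_all add: bounded_linear_Pair bounded_linear_ident bounded_linear_zero)
  note lin = this[THEN lipschitz_bdd_linear]
  have "lipschitz_bdd (\<lambda>x. (f x, 0) + (0, g x))"
    by (rule lipschitz_bdd_add[OF
      lipschitz_bdd_compose[OF lin(1) assms(1)]
      lipschitz_bdd_compose[OF lin(2) assms(2)]])
  moreover have "(\<lambda>x. (f x, 0) + (0, g x)) = (\<lambda>x. (f x, g x))" by (rule ext) simp
  ultimately show ?thesis by (simp only:)
qed

text \<open>The closed set \<open>S\<close> localises the iteration: the whole space gives uniqueness among all points,
  a subspace preserved by the iteration gives membership of the solution in it.\<close>

lemma implicit_step:
  fixes g :: "'a::euclidean_space \<Rightarrow> 'a"
  assumes K: "\<And>y. dist y x \<le> r \<Longrightarrow> norm (g y) \<le> K"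
    and L: "\<And>y y'. dist y x \<le> r \<Longrightarrow> dist y' x \<le> r \<Longrightarrow> norm (g y - g y') \<le> L * norm (y - y')"
    and h: "h > 0" "h * L \<le> 1 / 2" "h * K < e" "0 < e" "e \<le> r"
    and S: "closed S" "x \<in> S" "\<And>y. y \<in> S \<Longrightarrow> x + h *\<^sub>R g y \<in> S"
  shows "\<exists>!y. y \<in> S \<and> y = x + h *\<^sub>R g y \<and> dist y x < e"
proof -
  have "norm (g x) \<le> K" using h by (intro K) simp
  then have "0 \<le> K" by (rule order_trans[OF norm_ge_zero])
  then have K0: "0 \<le> h * K" using h(1) by simp
  \<comment> \<open>a closed, hence complete, set that the iteration maps into itself; its radius is less than \<open>e\<close>\<close>
  let ?B = "S \<inter> cball x (h * K)" and ?f = "\<lambda>y. x + h *\<^sub>R g y"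
  have contr: "dist (?f y) (?f y') \<le> (1 / 2) * dist y y'" if "dist y x \<le> r" "dist y' x \<le> r" for y y'
  proof -
    have "dist (?f y) (?f y') = norm (h *\<^sub>R (g y - g y'))" by (simp add: dist_norm algebra_simps)
    also have "\<dots> \<le> h * (L * norm (y - y'))" using h(1) L[OF that] by simp
    also have "\<dots> = (h * L) * norm (y - y')" by simp
    also have "\<dots> \<le> (1 / 2) * norm (y - y')" using h(2) by (intro mult_right_mono) auto
    finally show ?thesis by (simp add: dist_norm)
  qed
  have "\<exists>!y. y \<in> ?B \<and> ?f y = y"
  proof (rule Banach_fix)
    show "complete ?B" using S(1) by (simp add: complete_eq_closed closed_Int)
    show "?B \<noteq> {}" using S(2) K0 by auto
    show "?f ` ?B \<subseteq> ?B"
    proof (intro image_subsetI IntI)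
      fix y assume y: "y \<in> ?B"
      then show "?f y \<in> S" using S(3) by auto
      have "norm (g y) \<le> K" using y h by (intro K) (auto simp: dist_commute)
      then show "?f y \<in> cball x (h * K)" using h(1) by (simp add: dist_norm)
    qed
    show "dist (?f y) (?f y') \<le> (1 / 2) * dist y y'" if "y \<in> ?B" "y' \<in> ?B" for y y'
      using that h by (intro contr) (auto simp: dist_commute)
  qed simp_all
  then obtain y where "y \<in> ?B" "?f y = y" by blast
  then have y: "y \<in> S" "dist y x \<le> h * K" "y = ?f y" by (auto simp: dist_commute)
  show ?thesis
  proof (rule ex1I[of _ y])
    show "y \<in> S \<and> y = ?f y \<and> dist y x < e" using y h by auto
    fix y' assume y': "y' \<in> S \<and> y' = ?f y' \<and> dist y' x < e"
    then have "dist y' y \<le> (1 / 2) * dist y' y"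
      using contr[of y' y] y h by auto
    then show "y' = y" by simp
  qed
qed

section \<open>Iterated directional derivatives\<close>

lemma frechet_derivative_cong_open:
  assumes "open U" "x \<in> U" "\<And>x. x \<in> U \<Longrightarrow> f x = g x"
  shows "frechet_derivative f (at x) = frechet_derivative g (at x)" "f differentiable (at x) \<longleftrightarrow> g differentiable (at x)"
proof -
  have "(f has_derivative D) (at x) \<longleftrightarrow> (g has_derivative D) (at x)" for D
    using assms has_derivative_transform_within_open by metis
  then show "frechet_derivative f (at x) = frechet_derivative g (at x)" "f differentiable (at x) \<longleftrightarrow> g differentiable (at x)"
    by (simp_all add: frechet_derivative_def differentiable_def)
qed

lemma Ck_on_cong:
  assumes "open U" "\<And>x. x \<in> U \<Longrightarrow> f x = g x"
  shows "Ck_on k U f \<longleftrightarrow> Ck_on k U g"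
  using assms(2)
proof (induction k arbitrary: f g)
  case 0
  then show ?case using continuous_on_cong by (auto cong: continuous_on_cong)
next
  case (Suc k)
  have "Ck_on k U (\<lambda>x. frechet_derivative f (at x) v) \<longleftrightarrow> Ck_on k U (\<lambda>x. frechet_derivative g (at x) v)" for v
    by (rule Suc.IH) (use frechet_derivative_cong_open(1)[OF assms(1) _ Suc.prems] in auto)
  moreover have "(\<forall>x\<in>U. f differentiable at x) \<longleftrightarrow> (\<forall>x\<in>U. g differentiable at x)"
    using frechet_derivative_cong_open(2)[OF assms(1) _ Suc.prems] by auto
  ultimately show ?case by simp
qed

text \<open>A class of maps that is closed under directional derivatives consists of smooth maps; this
  avoids any calculus of higher derivatives of compositions and inverses.\<close>

lemma Ck_on_closed_class:
  assumes U: "open U"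
    and closed: "\<And>f. f \<in> C \<Longrightarrow> \<exists>f'. (\<forall>z\<in>U. (f has_derivative f' z) (at z)) \<and> (\<forall>v. (\<lambda>z. f' z v) \<in> C)"
    and f: "f \<in> C"
  shows "Ck_on k U f"
  using f
proof (induction k arbitrary: f)
  case 0
  then obtain f' where "\<forall>z\<in>U. (f has_derivative f' z) (at z)" using closed by blast
  then show ?case
    by (auto intro!: continuous_at_imp_continuous_on dest!: has_derivative_continuous bspec)
next
  case (Suc k)
  then obtain f' where f': "\<forall>z\<in>U. (f has_derivative f' z) (at z)" "\<forall>v. (\<lambda>z. f' z v) \<in> C"
    using closed by blast
  have "Ck_on k U (\<lambda>x. frechet_derivative f (at x) v)" for v
  proof (subst Ck_on_cong[OF U])
    show "frechet_derivative f (at x) v = f' x v" if "x \<in> U" for x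
      using f' that by (metis frechet_derivative_at)
    show "Ck_on k U (\<lambda>x. f' x v)" using f' Suc.IH by blast
  qed
  then show ?case using f' by (auto simp: differentiable_def)
qed

lemma Ck_on_compose_linear_left:
  assumes U: "open U" and T: "bounded_linear T" and f: "Ck_on k U f"
  shows "Ck_on k U (\<lambda>x. T (f x))"
  using f
proof (induction k arbitrary: f)
  case 0
  then show ?case using bounded_linear.continuous_on[OF T] by auto
next
  case (Suc k)
  have D: "((\<lambda>x. T (f x)) has_derivative (\<lambda>v. T (frechet_derivative f (at x) v))) (at x)" if "x \<in> U" for x
    using Suc.prems that by (intro bounded_linear.has_derivative[OF T]) (simp add: frechet_derivative_works)
  have "Ck_on k U (\<lambda>x. frechet_derivative (\<lambda>x. T (f x)) (at x) v)" for v
  proof (subst Ck_on_cong[OF U])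
    show "frechet_derivative (\<lambda>x. T (f x)) (at x) v = T (frechet_derivative f (at x) v)" if "x \<in> U" for x
      using D[OF that] by (metis frechet_derivative_at)
    show "Ck_on k U (\<lambda>x. T (frechet_derivative f (at x) v))" using Suc by auto
  qed
  then show ?case using D by (auto simp: differentiable_def)
qed

lemma Ck_on_compose_linear_right:
  assumes U: "open U" and T: "bounded_linear T" and f: "Ck_on k U f"
  shows "Ck_on k (T -` U) (\<lambda>x. f (T x))"
  using f
proof (induction k arbitrary: f)
  case 0
  then show ?case
    by (auto intro!: continuous_on_compose2[OF _ linear_continuous_on[OF T]])
next
  case (Suc k)
  have oT: "open (T -` U)" using U T
    by (simp add: continuous_open_vimage linear_continuous_at)
  have D: "((\<lambda>x. f (T x)) has_derivative (\<lambda>v. frechet_derivative f (at (T x)) (T v))) (at x)" if "x \<in> T -` U" for x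
  proof -
    have "(f has_derivative frechet_derivative f (at (T x))) (at (T x))"
      using Suc.prems that by (simp add: frechet_derivative_works[symmetric])
    from diff_chain_at[OF bounded_linear_imp_has_derivative[OF T] this] show ?thesis by (simp add: o_def)
  qed
  have "Ck_on k (T -` U) (\<lambda>x. frechet_derivative (\<lambda>x. f (T x)) (at x) v)" for v
  proof (subst Ck_on_cong[OF oT])
    show "frechet_derivative (\<lambda>x. f (T x)) (at x) v = frechet_derivative f (at (T x)) (T v)" if "x \<in> T -` U" for x
      using D[OF that] by (metis frechet_derivative_at)
    show "Ck_on k (T -` U) (\<lambda>x. frechet_derivative f (at (T x)) (T v))" using Suc by auto
  qed
  then show ?case using D by (auto simp: differentiable_def)
qed

text \<open>A lower Lipschitz bound near a point is inherited by the derivative there; this makes the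
  linearised midpoint equation uniformly invertible.\<close>

lemma derivative_lower_bound:
  fixes f :: "'a::real_normed_vector \<Rightarrow> 'b::real_normed_vector"
  assumes f: "(f has_derivative f') (at x)" and r: "r > 0"
    and le: "\<And>y. dist y x < r \<Longrightarrow> c * norm (y - x) \<le> norm (f y - f x)"
  shows "c * norm v \<le> norm (f' v)"
proof (cases "v = 0")
  case False
  interpret f': bounded_linear f' by (rule has_derivative_bounded_linear[OF f])
  show ?thesis
  proof (rule field_le_epsilon)
    fix e :: real assume e: "e > 0"
    then obtain d where d: "d > 0" "\<And>y. norm (y - x) < d \<Longrightarrow> norm (f y - f x - f' (y - x)) \<le> (e / norm v) * norm (y - x)"
      using f False unfolding has_derivative_at_alt by (metis divide_pos_pos zero_less_norm_iff)
    define t where "t = min r d / (2 * norm v)"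
    have t: "t > 0" using r d False by (simp add: t_def)
    have tv: "t * norm v < r" "t * norm v < d" using r d False by (auto simp: t_def)
    have "c * (t * norm v) \<le> norm (f (x + t *\<^sub>R v) - f x)"
      using le[of "x + t *\<^sub>R v"] t tv by (simp add: dist_norm)
    also have "\<dots> \<le> norm (f (x + t *\<^sub>R v) - f x - f' (t *\<^sub>R v)) + norm (f' (t *\<^sub>R v))" by norm
    also have "\<dots> \<le> e * t + t * norm (f' v)"
      using d(2)[of "x + t *\<^sub>R v"] t tv False by (simp add: f'.scaleR)
    finally have "t * (c * norm v) \<le> t * (norm (f' v) + e)" by (simp add: algebra_simps)
    then show "c * norm v \<le> norm (f' v) + e" using t by simp
  qed
qed simp

section \<open>The isospectral midpoint map of an algebra with trace\<close>

text \<open>The formulas of the method, its consistency and its Poisson property use only an associative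
  product, a trace and a map \<open>M\<close> that is symmetric for the trace form.\<close>

locale trace_algebra =
  fixes mul :: "'a::euclidean_space \<Rightarrow> 'a \<Rightarrow> 'a" (infixl "\<star>" 70)
    and one :: 'a and tr :: "'a \<Rightarrow> real" and M :: "'a \<Rightarrow> 'a"
  assumes mul_bilinear: "bounded_bilinear (\<star>)"
    and mul_assoc: "x \<star> y \<star> z = x \<star> (y \<star> z)"
    and one_left [simp]: "one \<star> x = x" and one_right [simp]: "x \<star> one = x"
    and tr_linear: "linear tr" and tr_commute: "tr (x \<star> y) = tr (y \<star> x)"
    and M_linear: "linear M" and M_symmetric: "tr (x \<star> M y) = tr (M x \<star> y)"
begin

sublocale mul: bounded_bilinear "(\<star>)" by (rule mul_bilinear)

lemmas mul_ring = mul.add_left mul.add_right mul.diff_left mul.diff_right mul.minus_left mul.minus_right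
  mul.scaleR_left mul.scaleR_right mul_assoc

lemmas tr_simps = linear_add[OF tr_linear] linear_diff[OF tr_linear] linear_neg[OF tr_linear] linear_cmul[OF tr_linear]

definition mid :: "real \<Rightarrow> 'a \<Rightarrow> 'a" where "mid h y = (h / 2) *\<^sub>R M y"

lemma mid_linear: "linear (mid h)"
  by (rule linearI) (simp_all add: mid_def linear_add[OF M_linear] linear_cmul[OF M_linear] scaleR_add_right)

lemma mid_bounded_linear: "bounded_linear (mid h)"
  using mid_linear by (simp add: linear_conv_bounded_linear)

lemma mid_symmetric: "tr (x \<star> mid h y) = tr (mid h x \<star> y)"
  by (simp add: mid_def mul_ring tr_simps M_symmetric)

definition start_pt :: "real \<Rightarrow> 'a \<Rightarrow> 'a"
  where "start_pt h y = (one + mid h y) \<star> y \<star> (one - mid h y)"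

definition end_pt :: "real \<Rightarrow> 'a \<Rightarrow> 'a"
  where "end_pt h y = (one - mid h y) \<star> y \<star> (one + mid h y)"

text \<open>The derivatives of the two maps in the intermediate point; \<open>start_diff2 h y w v\<close> is the
  derivative of \<open>start_diff h y v\<close> in \<open>y\<close> along \<open>w\<close>.\<close>

definition start_diff :: "real \<Rightarrow> 'a \<Rightarrow> 'a \<Rightarrow> 'a"
  where "start_diff h y v = (one + mid h y) \<star> v \<star> (one - mid h y)
      + mid h v \<star> y \<star> (one - mid h y) - (one + mid h y) \<star> y \<star> mid h v"

definition end_diff :: "real \<Rightarrow> 'a \<Rightarrow> 'a \<Rightarrow> 'a" where "end_diff h = start_diff (- h)"

definition start_diff2 :: "real \<Rightarrow> 'a \<Rightarrow> 'a \<Rightarrow> 'a \<Rightarrow> 'a"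
  where "start_diff2 h y w v = (mid h w \<star> v \<star> (one - mid h y) - (one + mid h y) \<star> v \<star> mid h w)
     + (mid h v \<star> w \<star> (one - mid h y) - mid h v \<star> y \<star> mid h w)
     - (mid h w \<star> y \<star> mid h v + (one + mid h y) \<star> w \<star> mid h v)"

lemma mid_uminus: "mid (- h) y = - mid h y"
  by (simp add: mid_def)

text \<open>Reversing the sign of \<open>h\<close> exchanges starting point and end point: the method is symmetric.\<close>

lemma end_pt_eq: "end_pt h = start_pt (- h)"
  by (simp add: fun_eq_iff end_pt_def start_pt_def mid_uminus)

lemma end_start: "end_pt h y = start_pt h y + h *\<^sub>R (y \<star> M y - M y \<star> y)"
proof -
  have "h *\<^sub>R (y \<star> M y - M y \<star> y) = 2 *\<^sub>R (y \<star> mid h y - mid h y \<star> y)"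
    by (simp add: mid_def mul_ring scaleR_diff_right)
  then show ?thesis by (simp add: end_pt_def start_pt_def mul_ring scaleR_2)
qed

lemma end_start_diff: "end_diff h y v = start_diff h y v + h *\<^sub>R (v \<star> M y - M y \<star> v + (y \<star> M v - M v \<star> y))"
proof -
  have "h *\<^sub>R (v \<star> M y - M y \<star> v + (y \<star> M v - M v \<star> y))
     = 2 *\<^sub>R (v \<star> mid h y - mid h y \<star> v + (y \<star> mid h v - mid h v \<star> y))"
    by (simp add: mid_def mul_ring scaleR_add_right scaleR_diff_right)
  then show ?thesis by (simp add: end_diff_def start_diff_def mid_uminus mul_ring scaleR_2)
qed

lemma mid_has_derivative: "(mid h has_derivative mid h) F"
  by (rule bounded_linear_imp_has_derivative[OF mid_bounded_linear])

lemma start_pt_has_derivative: "(start_pt h has_derivative start_diff h y) (at y)"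
  unfolding start_pt_def[abs_def] start_diff_def[abs_def]
  by (rule has_derivative_eq_rhs) (rule mul.FDERIV mid_has_derivative has_derivative_add has_derivative_diff
      has_derivative_const has_derivative_ident | simp add: fun_eq_iff mul_ring)+

lemma end_pt_has_derivative: "(end_pt h has_derivative end_diff h y) (at y)"
  unfolding end_pt_eq end_diff_def by (rule start_pt_has_derivative)

lemma start_diff_has_derivative:
  "((\<lambda>p. start_diff h (fst p) (snd p)) has_derivative
     (\<lambda>q. start_diff2 h y (fst q) v + start_diff h y (snd q))) (at (y, v))"
proof -
  have m: "((\<lambda>p. mid h (f p)) has_derivative (\<lambda>q. mid h (f' q))) (at (y, v))" if "(f has_derivative f') (at (y, v))" for f f'
    by (rule bounded_linear.has_derivative[OF mid_bounded_linear that])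
  show ?thesis
    unfolding start_diff2_def start_diff_def
    by (rule has_derivative_eq_rhs) (rule mul.FDERIV m has_derivative_add has_derivative_diff has_derivative_fst has_derivative_snd
      has_derivative_const has_derivative_ident | simp add: fun_eq_iff mul_ring)+
qed

lemma start_diff_linear: "linear (start_diff h y)"
  by (rule has_derivative_linear[OF start_pt_has_derivative])

text \<open>Moving a covector \<open>q\<close> at the starting point to the intermediate point produces two terms: the
  conjugated covector \<open>(1 - m) q (1 + m)\<close>, and a covector that is paired with the variation of
  \<open>m\<close>.  The latter is \<open>mid_covector (1 + m) (1 - m) y q\<close>; at the end point \<open>1 + m\<close> and \<open>1 - m\<close>
  exchange their roles, and the second pairing changes sign.\<close>

definition mid_covector :: "'a \<Rightarrow> 'a \<Rightarrow> 'a \<Rightarrow> 'a \<Rightarrow> 'a"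
  where "mid_covector a b y q = y \<star> b \<star> q - q \<star> a \<star> y"

lemma start_adjoint:
  "tr (q \<star> start_diff h y v) =
    tr ((one - mid h y) \<star> q \<star> (one + mid h y) \<star> v) + tr (mid_covector (one + mid h y) (one - mid h y) y q \<star> mid h v)"
proof -
  define a where "a = one + mid h y"
  define b where "b = one - mid h y"
  have "tr (q \<star> (a \<star> v \<star> b)) = tr (b \<star> q \<star> a \<star> v)"
    using tr_commute[of "q \<star> a \<star> v" b] by (simp add: mul_assoc)
  moreover have "tr (q \<star> (mid h v \<star> y \<star> b)) = tr (y \<star> b \<star> q \<star> mid h v)"
    using tr_commute[of "q \<star> mid h v" "y \<star> b"] by (simp add: mul_assoc)
  ultimately show ?thesis
    by (simp add: start_diff_def mid_covector_def tr_simps mul.add_right mul.diff_right mul.diff_left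
        mul_assoc flip: a_def b_def)
qed

lemma end_adjoint:
  "tr (p \<star> end_diff h y v) =
    tr ((one + mid h y) \<star> p \<star> (one - mid h y) \<star> v) - tr (mid_covector (one - mid h y) (one + mid h y) y p \<star> mid h v)"
  using start_adjoint[of p "- h" y v] by (simp add: end_diff_def mid_uminus mul.minus_right tr_simps)

text \<open>Here \<open>a + b\<close> appears between \<open>q1\<close> and \<open>q2\<close>; for \<open>a = 1 + m\<close>, \<open>b = 1 - m\<close> it is a scalar, and
  the conjugations disappear.\<close>

lemma mid_covector_self:
  assumes "a + b = one + one"
  shows "tr (mid_covector a b y q1 \<star> (b \<star> q2 \<star> a)) - tr ((b \<star> q1 \<star> a) \<star> mid_covector a b y q2)
     = 2 * tr (a \<star> y \<star> b \<star> (q1 \<star> q2 - q2 \<star> q1))"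
proof -
  have 1: "tr (y \<star> b \<star> q1 \<star> b \<star> q2 \<star> a) = tr (a \<star> y \<star> b \<star> q1 \<star> b \<star> q2)"
    using tr_commute[of "y \<star> b \<star> q1 \<star> b \<star> q2" a] by (simp add: mul_assoc)
  have 2: "tr (q1 \<star> a \<star> y \<star> b \<star> q2 \<star> a) = tr (a \<star> y \<star> b \<star> q2 \<star> a \<star> q1)"
    using tr_commute[of q1 "a \<star> y \<star> b \<star> q2 \<star> a"] by (simp add: mul_assoc)
  have 3: "tr (b \<star> q1 \<star> a \<star> y \<star> b \<star> q2) = tr (a \<star> y \<star> b \<star> q2 \<star> b \<star> q1)"
    using tr_commute[of "b \<star> q1" "a \<star> y \<star> b \<star> q2"] by (simp add: mul_assoc)
  have 4: "tr (b \<star> q1 \<star> a \<star> q2 \<star> a \<star> y) = tr (a \<star> y \<star> b \<star> q1 \<star> a \<star> q2)"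
    using tr_commute[of "b \<star> q1 \<star> a \<star> q2" "a \<star> y"] by (simp add: mul_assoc)
  have "tr (mid_covector a b y q1 \<star> (b \<star> q2 \<star> a)) - tr ((b \<star> q1 \<star> a) \<star> mid_covector a b y q2)
     = tr (a \<star> y \<star> b \<star> q1 \<star> (a + b) \<star> q2) - tr (a \<star> y \<star> b \<star> q2 \<star> (a + b) \<star> q1)"
    using 1 2 3 4 by (simp add: mid_covector_def mul_ring tr_simps)
  then show ?thesis unfolding assms by (simp add: mul_ring tr_simps)
qed

lemma mid_covector_cross:
  "tr (mid_covector b a y p \<star> (b \<star> q \<star> a)) + tr ((a \<star> p \<star> b) \<star> mid_covector a b y q) = 0"
proof -
  have 1: "tr (y \<star> a \<star> p \<star> b \<star> q \<star> a) = tr (a \<star> p \<star> b \<star> q \<star> a \<star> y)"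
    using tr_commute[of y "a \<star> p \<star> b \<star> q \<star> a"] by (simp add: mul_assoc)
  have 2: "tr (p \<star> b \<star> y \<star> b \<star> q \<star> a) = tr (a \<star> p \<star> b \<star> y \<star> b \<star> q)"
    using tr_commute[of "p \<star> b \<star> y \<star> b \<star> q" a] by (simp add: mul_assoc)
  show ?thesis using 1 2 by (simp add: mid_covector_def mul_ring tr_simps)
qed

text \<open>Write \<open>r\<close>, \<open>s\<close> for the conjugated covectors and \<open>u\<close>, \<open>v\<close> for those paired with the variation of
  \<open>m\<close>.  The hypothesis says that \<open>r - s\<close> is minus the image of \<open>u + v\<close> under the symmetric map
  \<open>mid h\<close>, so \<open>\<langle>u\<^sub>1 + v\<^sub>1, r\<^sub>2 - s\<^sub>2\<rangle>\<close> is symmetric in the indices.  Expanding this symmetry yields the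
  two brackets, and mixed terms that cancel.  The set \<open>V\<close> of admissible variations
  allows the equation of covectors to be known on a subspace only.\<close>

theorem end_start_poisson:
  assumes eq: "\<And>v. v \<in> V \<Longrightarrow> tr (q1 \<star> start_diff h y v) = tr (p1 \<star> end_diff h y v)"
    "\<And>v. v \<in> V \<Longrightarrow> tr (q2 \<star> start_diff h y v) = tr (p2 \<star> end_diff h y v)"
    and V: "mid_covector (one + mid h y) (one - mid h y) y q1 + mid_covector (one - mid h y) (one + mid h y) y p1 \<in> V"
      "mid_covector (one + mid h y) (one - mid h y) y q2 + mid_covector (one - mid h y) (one + mid h y) y p2 \<in> V"
  shows "tr (start_pt h y \<star> (q1 \<star> q2 - q2 \<star> q1)) = tr (end_pt h y \<star> (p1 \<star> p2 - p2 \<star> p1))"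
proof -
  define a where "a = one + mid h y"
  define b where "b = one - mid h y"
  have ab: "a + b = one + one" "b + a = one + one" by (simp_all add: a_def b_def)
  define u1 u2 v1 v2 where "u1 = mid_covector a b y q1" "u2 = mid_covector a b y q2" "v1 = mid_covector b a y p1" "v2 = mid_covector b a y p2"
  note uv = u1_u2_v1_v2_def
  define r1 r2 s1 s2 where "r1 = b \<star> q1 \<star> a" "r2 = b \<star> q2 \<star> a" "s1 = a \<star> p1 \<star> b" "s2 = a \<star> p2 \<star> b"
  note rs = r1_r2_s1_s2_def
  have e: "tr ((r1 - s1) \<star> v) = - tr ((u1 + v1) \<star> mid h v)" "tr ((r2 - s2) \<star> v) = - tr ((u2 + v2) \<star> mid h v)" if "v \<in> V" for v
    using eq[OF that] by (simp_all add: start_adjoint end_adjoint rs uv a_def b_def mul.diff_left mul.add_left tr_simps)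
  have "tr ((u1 + v1) \<star> (r2 - s2)) = - tr ((u2 + v2) \<star> mid h (u1 + v1))"
    using e(2)[of "u1 + v1"] V tr_commute[of "u1 + v1" "r2 - s2"] by (simp add: uv a_def b_def)
  also have "\<dots> = - tr ((u1 + v1) \<star> mid h (u2 + v2))"
    using mid_symmetric[of "u2 + v2" h "u1 + v1"] tr_commute[of "mid h (u2 + v2)" "u1 + v1"] by simp
  also have "\<dots> = tr ((r1 - s1) \<star> (u2 + v2))"
    using e(1)[of "u2 + v2"] V by (simp add: uv a_def b_def)
  finally have key: "tr ((u1 + v1) \<star> (r2 - s2)) = tr ((r1 - s1) \<star> (u2 + v2))" .
  have self: "tr (u1 \<star> r2) - tr (r1 \<star> u2) = 2 * tr (a \<star> y \<star> b \<star> (q1 \<star> q2 - q2 \<star> q1))"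
    "tr (v1 \<star> s2) - tr (s1 \<star> v2) = 2 * tr (b \<star> y \<star> a \<star> (p1 \<star> p2 - p2 \<star> p1))"
    unfolding uv rs by (rule mid_covector_self ab)+
  have cross: "tr (v1 \<star> r2) + tr (s1 \<star> u2) = 0" "tr (u1 \<star> s2) + tr (r1 \<star> v2) = 0"
    unfolding uv rs by (rule mid_covector_cross)+
  have "2 * tr (a \<star> y \<star> b \<star> (q1 \<star> q2 - q2 \<star> q1)) = 2 * tr (b \<star> y \<star> a \<star> (p1 \<star> p2 - p2 \<star> p1))"
    using key self cross unfolding mul.add_left mul.add_right mul.diff_left mul.diff_right tr_simps by linarith
  then show ?thesis by (simp add: start_pt_def end_pt_def a_def b_def)
qed

end

section \<open>Smoothness of the implicit step\<close>

text \<open>\<open>S\<close> stands for the solution map and \<open>I z\<close> for the inverse of the linearised equation at \<open>S z\<close>.\<close>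

inductive_set (in trace_algebra) solution_polys :: "('a \<Rightarrow> 'a) \<Rightarrow> ('a \<Rightarrow> 'a \<Rightarrow> 'a) \<Rightarrow> ('a \<Rightarrow> 'a) set"
  for S :: "'a \<Rightarrow> 'a" and I :: "'a \<Rightarrow> 'a \<Rightarrow> 'a"
  where
    poly_const: "(\<lambda>z. c) \<in> solution_polys S I"
  | poly_solution: "S \<in> solution_polys S I"
  | poly_add: "f \<in> solution_polys S I \<Longrightarrow> g \<in> solution_polys S I \<Longrightarrow> (\<lambda>z. f z + g z) \<in> solution_polys S I"
  | poly_mul: "f \<in> solution_polys S I \<Longrightarrow> g \<in> solution_polys S I \<Longrightarrow> (\<lambda>z. f z \<star> g z) \<in> solution_polys S I"
  | poly_linear: "linear T \<Longrightarrow> f \<in> solution_polys S I \<Longrightarrow> (\<lambda>z. T (f z)) \<in> solution_polys S I"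
  | poly_inverse: "f \<in> solution_polys S I \<Longrightarrow> (\<lambda>z. I z (f z)) \<in> solution_polys S I"

text \<open>A continuous solution map at whose values the linearised equation is invertible, with the
  bound \<open>2\<close> for the inverse that a contraction constant \<open>1/2\<close> produces.\<close>

locale implicit_solution = trace_algebra +
  fixes h :: real and U :: "'a set" and S :: "'a \<Rightarrow> 'a"
  assumes U_open: "open U" and S_solves: "z \<in> U \<Longrightarrow> start_pt h (S z) = z"
    and S_continuous: "continuous_on U S"
    and lower: "z \<in> U \<Longrightarrow> norm v \<le> 2 * norm (start_diff h (S z) v)"
begin

definition Inv :: "'a \<Rightarrow> 'a \<Rightarrow> 'a" where "Inv z = inv (start_diff h (S z))"

lemma Inv_props:
  assumes z: "z \<in> U"
  shows "start_diff h (S z) (Inv z u) = u" "Inv z (start_diff h (S z) v) = v" "linear (Inv z)"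
    "norm (Inv z u) \<le> 2 * norm u"
proof -
  have inj: "inj (start_diff h (S z))"
    unfolding linear_injective_0[OF start_diff_linear] using lower[OF z] by (metis mult_zero_right norm_le_zero_iff norm_zero)
  have surj: "surj (start_diff h (S z))"
    by (rule linear_inj_imp_surj[OF start_diff_linear inj])
  show 1: "start_diff h (S z) (Inv z u) = u" for u unfolding Inv_def by (rule surj_f_inv_f[OF surj])
  show 2: "Inv z (start_diff h (S z) v) = v" for v unfolding Inv_def by (rule inv_f_f[OF inj])
  note l = linear_add[OF start_diff_linear] linear_cmul[OF start_diff_linear]
  show "linear (Inv z)"
    by (rule linearI) (metis 1 2 l(1), metis 1 2 l(2))
  show "norm (Inv z u) \<le> 2 * norm u" using lower[OF z, of "Inv z u"] by (simp add: 1)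
qed

lemma S_isCont: "z \<in> U \<Longrightarrow> isCont S z"
  using S_continuous U_open by (simp add: continuous_on_eq_continuous_at)

lemma S_has_derivative:
  assumes z: "z \<in> U" shows "(S has_derivative Inv z) (at z)"
proof (rule has_derivative_inverse_basic[where f = "start_pt h" and f' = "start_diff h (S z)" and T = U])
  show "(start_pt h has_derivative start_diff h (S z)) (at (S z))" by (rule start_pt_has_derivative)
  show "bounded_linear (Inv z)" using Inv_props(3)[OF z] by (simp add: linear_conv_bounded_linear)
  show "Inv z \<circ> start_diff h (S z) = id" using Inv_props(2)[OF z] by auto
qed (use z S_isCont U_open S_solves in auto)

text \<open>The pair \<open>(S z, Inv z u)\<close> is the inverse image of \<open>(z, u)\<close> under the tangent map
  \<open>(y, v) \<mapsto> (start_pt h y, start_diff h y v)\<close>, so a single application of the derivative rule for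
  inverse maps also differentiates \<open>Inv\<close>.\<close>

lemma Inv_has_derivative:
  assumes z: "z \<in> U"
  shows "((\<lambda>p. Inv (fst p) (snd p)) has_derivative
     (\<lambda>q. Inv z (snd q - start_diff2 h (S z) (Inv z (fst q)) (Inv z u)))) (at (z, u))"
proof -
  define \<Psi> where "\<Psi> p = (start_pt h (fst p), start_diff h (fst p) (snd p))" for p
  define \<Phi> where "\<Phi> p = (S (fst p), Inv (fst p) (snd p))" for p
  define w where "w = Inv z u"
  define D where "D q = (start_diff h (S z) (fst q), start_diff2 h (S z) (fst q) w + start_diff h (S z) (snd q))" for q
  define E where "E q = (Inv z (fst q), Inv z (snd q - start_diff2 h (S z) (Inv z (fst q)) w))" for q
  note I = Inv_props[OF z]
  have D: "(\<Psi> has_derivative D) (at (S z, w))"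
    unfolding \<Psi>_def[abs_def] D_def[abs_def]
  proof (rule has_derivative_Pair)
    have "((\<lambda>p. start_pt h (fst p)) has_derivative (\<lambda>q. start_diff h (S z) (fst q))) (at (S z, w))"
      using has_derivative_compose[OF has_derivative_fst[OF has_derivative_ident], of "start_pt h" "start_diff h (S z)" "(S z, w)" UNIV]
        start_pt_has_derivative[of h "S z"] by simp
    then show "((\<lambda>p. start_pt h (fst p)) has_derivative (\<lambda>q. start_diff h (S z) (fst q))) (at (S z, w))" .
  qed (rule start_diff_has_derivative)
  have ED: "E \<circ> D = id"
    by (auto simp: fun_eq_iff E_def D_def I(2))
  have cont: "isCont \<Phi> (z, u)"
    unfolding \<Phi>_def[abs_def]
  proof (rule isCont_Pair)
    show "isCont (\<lambda>p. S (fst p)) (z, u)" using S_isCont[OF z] by (intro isCont_o2[of _ fst S]) auto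
    have nb: "\<forall>\<^sub>F p in at (z, u). fst p \<in> U"
    proof -
      have "((\<lambda>p. fst p) \<longlongrightarrow> z) (at (z, u))" by (rule tendsto_eq_intros | simp)+
      then show ?thesis using U_open z by (rule topological_tendstoD)
    qed
    \<comment> \<open>the bound on the inverse reduces continuity of \<open>Inv\<close> to that of the linearised equation\<close>
    have lim: "((\<lambda>p. 2 * norm (snd p - start_diff h (S (fst p)) w)) \<longlongrightarrow> 2 * norm (u - start_diff h (S z) w)) (at (z, u))"
    proof -
      have "isCont (\<lambda>p. start_diff h (fst p) (snd p)) (S z, w)"
        by (rule has_derivative_continuous[OF start_diff_has_derivative])
      then have "isCont (\<lambda>p. start_diff h (fst (S (fst p), w)) (snd (S (fst p), w))) (z, u)"
        using \<open>isCont (\<lambda>p. S (fst p)) (z, u)\<close>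
        by (intro isCont_o2[where f = "\<lambda>p. (S (fst p), w)" and g = "\<lambda>p. start_diff h (fst p) (snd p)"] isCont_Pair) auto
      then have "((\<lambda>p. start_diff h (S (fst p)) w) \<longlongrightarrow> start_diff h (S z) w) (at (z, u))"
        by (simp add: isCont_def)
      then show ?thesis by (intro tendsto_intros tendsto_eq_intros) auto
    qed
    have zero: "2 * norm (u - start_diff h (S z) w) = 0" by (simp add: w_def I(1))
    have "((\<lambda>p. Inv (fst p) (snd p) - w) \<longlongrightarrow> 0) (at (z, u))"
    proof (rule Lim_null_comparison[OF _ lim[unfolded zero]])
      show "\<forall>\<^sub>F p in at (z, u). norm (Inv (fst p) (snd p) - w) \<le> 2 * norm (snd p - start_diff h (S (fst p)) w)"
        using nb
      proof (rule eventually_mono)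
        fix p :: "'a \<times> 'a" assume p: "fst p \<in> U"
        have "Inv (fst p) (snd p) - w = Inv (fst p) (snd p - start_diff h (S (fst p)) w)"
          by (simp add: linear_diff[OF Inv_props(3)[OF p]] Inv_props(2)[OF p])
        then show "norm (Inv (fst p) (snd p) - w) \<le> 2 * norm (snd p - start_diff h (S (fst p)) w)"
          using Inv_props(4)[OF p] by simp
      qed
    qed
    then show "isCont (\<lambda>p. Inv (fst p) (snd p)) (z, u)"
      unfolding isCont_def using LIM_zero_cancel by (fastforce simp: w_def)
  qed
  have linE: "linear E"
  proof -
    have "linear D" by (rule has_derivative_linear[OF D])
    have DE: "D (E q) = q" for q
      by (simp add: D_def E_def I(1))
    have EDq: "E (D q) = q" for q using ED by (metis comp_apply id_apply)
    show ?thesis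
      by (rule linearI) (metis DE EDq linear_add[OF \<open>linear D\<close>], metis DE EDq linear_cmul[OF \<open>linear D\<close>])
  qed
  have "(\<Phi> has_derivative E) (at (z, u))"
  proof (rule has_derivative_inverse_basic[where f = \<Psi> and f' = D and T = "U \<times> UNIV"])
    show "(\<Psi> has_derivative D) (at (\<Phi> (z, u)))" using D by (simp add: \<Phi>_def w_def)
    show "bounded_linear E" using linE by (simp add: linear_conv_bounded_linear)
    show "open (U \<times> (UNIV :: 'a set))" using U_open by (simp add: open_Times)
    show "\<Psi> (\<Phi> p) = p" if "p \<in> U \<times> UNIV" for p
      using that S_solves Inv_props(1) by (auto simp: \<Psi>_def \<Phi>_def)
  qed (use ED cont z in auto)
  from has_derivative_snd[OF this] show ?thesis by (simp add: \<Phi>_def E_def w_def)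
qed

abbreviation polys :: "('a \<Rightarrow> 'a) set" where "polys \<equiv> solution_polys S Inv"

lemma poly_diff:
  assumes "f \<in> polys" "g \<in> polys" shows "(\<lambda>z. f z - g z) \<in> polys"
proof -
  have "linear (uminus :: 'a \<Rightarrow> 'a)" by (rule linearI) auto
  from poly_add[OF assms(1) poly_linear[OF this assms(2)]] show ?thesis by simp
qed

lemma solution_polys_derivative:
  assumes "f \<in> polys"
  shows "\<exists>f'. (\<forall>z\<in>U. (f has_derivative f' z) (at z)) \<and> (\<forall>v. (\<lambda>z. f' z v) \<in> polys)"
  using assms
proof induction
  case (poly_const c)
  show ?case by (intro exI[of _ "\<lambda>z v. 0"]) (auto intro: solution_polys.poly_const)
next
  case poly_solution
  show ?case
    using S_has_derivative by (intro exI[of _ Inv]) (auto intro: solution_polys.intros)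
next
  case (poly_add f g)
  then obtain f' g' where "\<forall>z\<in>U. (f has_derivative f' z) (at z)" "\<forall>v. (\<lambda>z. f' z v) \<in> polys"
    "\<forall>z\<in>U. (g has_derivative g' z) (at z)" "\<forall>v. (\<lambda>z. g' z v) \<in> polys" by blast
  then show ?case
    by (intro exI[of _ "\<lambda>z v. f' z v + g' z v"]) (auto intro: solution_polys.poly_add has_derivative_add)
next
  case (poly_mul f g)
  then obtain f' g' where fg: "\<forall>z\<in>U. (f has_derivative f' z) (at z)" "\<forall>v. (\<lambda>z. f' z v) \<in> polys"
    "\<forall>z\<in>U. (g has_derivative g' z) (at z)" "\<forall>v. (\<lambda>z. g' z v) \<in> polys" by blast
  show ?case
  proof (intro exI[of _ "\<lambda>z v. f z \<star> g' z v + f' z v \<star> g z"] conjI ballI allI)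
    show "((\<lambda>z. f z \<star> g z) has_derivative (\<lambda>v. f z \<star> g' z v + f' z v \<star> g z)) (at z)" if "z \<in> U" for z
      using fg that by (intro mul.FDERIV) auto
    show "(\<lambda>z. f z \<star> g' z v + f' z v \<star> g z) \<in> polys" for v
      using fg poly_mul.hyps by (intro solution_polys.poly_add solution_polys.poly_mul) auto
  qed
next
  case (poly_linear T f)
  then obtain f' where f': "\<forall>z\<in>U. (f has_derivative f' z) (at z)" "\<forall>v. (\<lambda>z. f' z v) \<in> polys"
    by blast
  show ?case
  proof (intro exI[of _ "\<lambda>z v. T (f' z v)"] conjI ballI allI)
    have T: "bounded_linear T" using poly_linear.hyps(1) by (simp add: linear_conv_bounded_linear)
    show "((\<lambda>z. T (f z)) has_derivative (\<lambda>v. T (f' z v))) (at z)" if "z \<in> U" for z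
      using f'(1) that by (intro bounded_linear.has_derivative[OF T]) blast
    show "(\<lambda>z. T (f' z v)) \<in> polys" for v
      using f'(2) by (intro solution_polys.poly_linear[OF poly_linear.hyps(1)]) blast
  qed
next
  case (poly_inverse f)
  then obtain f' where f': "\<forall>z\<in>U. (f has_derivative f' z) (at z)" "\<forall>v. (\<lambda>z. f' z v) \<in> polys"
    by blast
  show ?case
  proof (intro exI[of _ "\<lambda>z v. Inv z (f' z v - start_diff2 h (S z) (Inv z v) (Inv z (f z)))"] conjI ballI allI)
    fix z assume z: "z \<in> U"
    have "((\<lambda>z. (z, f z)) has_derivative (\<lambda>v. (v, f' z v))) (at z)"
      using f' z by (intro has_derivative_Pair has_derivative_ident) auto
    from has_derivative_compose[OF this, of "\<lambda>p. Inv (fst p) (snd p)"] Inv_has_derivative[OF z, of "f z"]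
    show "((\<lambda>z. Inv z (f z)) has_derivative (\<lambda>v. Inv z (f' z v - start_diff2 h (S z) (Inv z v) (Inv z (f z))))) (at z)"
      by fastforce
  next
    fix v
    have one: "(\<lambda>z. one + mid h (S z)) \<in> polys" "(\<lambda>z. one - mid h (S z)) \<in> polys"
      by (intro solution_polys.poly_add poly_diff solution_polys.poly_const
          solution_polys.poly_linear[OF mid_linear] solution_polys.poly_solution)+
    have I: "(\<lambda>z. Inv z v) \<in> polys" "(\<lambda>z. Inv z (f z)) \<in> polys"
      using poly_inverse.hyps by (intro solution_polys.poly_inverse solution_polys.poly_const)+
    show "(\<lambda>z. Inv z (f' z v - start_diff2 h (S z) (Inv z v) (Inv z (f z)))) \<in> polys"
      unfolding start_diff2_def
      by (rule solution_polys.poly_inverse poly_diff f'(2)[rule_format] solution_polys.poly_add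
          one I solution_polys.poly_mul solution_polys.poly_linear[OF mid_linear] solution_polys.poly_solution)+
  qed
qed

lemma end_S_smooth: "Ck_on k U (\<lambda>z. end_pt h (S z))"
proof (rule Ck_on_closed_class[OF U_open solution_polys_derivative])
  show "(\<lambda>z. end_pt h (S z)) \<in> polys"
    unfolding end_pt_def
    by (intro solution_polys.poly_mul solution_polys.poly_add poly_diff solution_polys.poly_const
          solution_polys.poly_linear[OF mid_linear] solution_polys.poly_solution)
qed

lemma end_S_has_derivative:
  assumes z: "z \<in> U" shows "((\<lambda>z. end_pt h (S z)) has_derivative (\<lambda>v. end_diff h (S z) (Inv z v))) (at z)"
  using has_derivative_compose[OF S_has_derivative[OF z] end_pt_has_derivative] .

end

section \<open>Uniform step sizes on bounded sets\<close>

text \<open>For the step size \<open>h\<close> and all parameters and initial values in the ball of radius \<open>R\<close>: unique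
  solvability within distance \<open>e\<close>, together with the bound and the contraction estimate that
  hold on the ball of radius \<open>R + 1\<close>, where the solutions lie if \<open>e \<le> 1\<close>.\<close>

definition contracting_step ::
    "real \<Rightarrow> real \<Rightarrow> real \<Rightarrow> real \<Rightarrow> ('p::real_normed_vector \<Rightarrow> 'a::euclidean_space \<Rightarrow> 'a) \<Rightarrow> bool"
  where "contracting_step R K e h g \<longleftrightarrow> (\<forall>p. norm p \<le> R \<longrightarrow>
      (\<forall>x C. norm x \<le> R \<and> closed C \<and> x \<in> C \<and> (\<forall>y\<in>C. x + h *\<^sub>R g p y \<in> C) \<longrightarrow>
          (\<exists>!y. y \<in> C \<and> y = x + h *\<^sub>R g p y \<and> dist y x < e))
    \<and> (\<forall>y. norm y \<le> R + 1 \<longrightarrow> norm (g p y) \<le> K)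
    \<and> (\<forall>y y'. norm y \<le> R + 1 \<longrightarrow> norm y' \<le> R + 1 \<longrightarrow>
          norm (h *\<^sub>R (g p y - g p y')) \<le> (1 / 2) * norm (y - y')))"

lemma contracting_stepD:
  assumes "contracting_step R K e h g" "norm p \<le> R"
  shows "\<And>x C. norm x \<le> R \<Longrightarrow> closed C \<Longrightarrow> x \<in> C \<Longrightarrow> (\<And>y. y \<in> C \<Longrightarrow> x + h *\<^sub>R g p y \<in> C) \<Longrightarrow>
      \<exists>!y. y \<in> C \<and> y = x + h *\<^sub>R g p y \<and> dist y x < e"
    and "\<And>y. norm y \<le> R + 1 \<Longrightarrow> norm (g p y) \<le> K"
    and "\<And>y y'. norm y \<le> R + 1 \<Longrightarrow> norm y' \<le> R + 1 \<Longrightarrow>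
          norm (h *\<^sub>R (g p y - g p y')) \<le> (1 / 2) * norm (y - y')"
proof -
  note all = spec[OF assms(1)[unfolded contracting_step_def], THEN mp, OF assms(2)]
  show "\<exists>!y. y \<in> C \<and> y = x + h *\<^sub>R g p y \<and> dist y x < e"
    if "norm x \<le> R" "closed C" "x \<in> C" "\<And>y. y \<in> C \<Longrightarrow> x + h *\<^sub>R g p y \<in> C" for x C
    by (rule conjunct1[OF all, rule_format]) (use that in simp)
  show "norm (g p y) \<le> K" if "norm y \<le> R + 1" for y
    by (rule conjunct1[OF conjunct2[OF all], rule_format, OF that])
  show "norm (h *\<^sub>R (g p y - g p y')) \<le> (1 / 2) * norm (y - y')" if "norm y \<le> R + 1" "norm y' \<le> R + 1" for y y'
    by (rule conjunct2[OF conjunct2[OF all], rule_format, OF that])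
qed

lemma implicit_step_family:
  fixes G :: "real \<Rightarrow> 'p::real_normed_vector \<Rightarrow> 'a::euclidean_space \<Rightarrow> 'a"
  assumes G: "lipschitz_bdd (\<lambda>q. G (fst q) (fst (snd q)) (snd (snd q)))"
  shows "\<exists>K\<ge>0. \<forall>e\<in>{0<..1}. \<exists>h0>0. h0 \<le> 1 \<and> (\<forall>h\<in>{0<..<h0}. contracting_step R K e h (G h))"
proof -
  obtain L K where LK: "L \<ge> 0" "K \<ge> 0"
    "\<And>q q'. norm q \<le> 1 + (R + (R + 1)) \<Longrightarrow> norm q' \<le> 1 + (R + (R + 1)) \<Longrightarrow>
       norm (G (fst q) (fst (snd q)) (snd (snd q)) - G (fst q') (fst (snd q')) (snd (snd q'))) \<le> L * norm (q - q')"
    "\<And>q. norm q \<le> 1 + (R + (R + 1)) \<Longrightarrow> norm (G (fst q) (fst (snd q)) (snd (snd q))) \<le> K"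
    using lipschitz_bddE[OF G] by metis
  have nq: "norm (h, p, y) \<le> 1 + (R + (R + 1))" if "\<bar>h\<bar> \<le> 1" "norm p \<le> R" "norm y \<le> R + 1" for h :: real and p :: 'p and y :: 'a
    using norm_Pair_le[of h "(p, y)"] norm_Pair_le[of p y] that unfolding real_norm_def by linarith
  have bK: "norm (G h p y) \<le> K" if "\<bar>h\<bar> \<le> 1" "norm p \<le> R" "norm y \<le> R + 1" for h p y
    using LK(4)[OF nq[OF that]] by simp
  have bL: "norm (G h p y - G h p y') \<le> L * norm (y - y')"
    if "\<bar>h\<bar> \<le> 1" "norm p \<le> R" "norm y \<le> R + 1" "norm y' \<le> R + 1" for h p y y'
    using LK(3)[OF nq[OF that(1,2,3)] nq[OF that(1,2,4)]] by (simp add: norm_Pair)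
  show ?thesis
  proof (rule exI[of _ K], intro conjI LK(2) ballI)
    fix e :: real assume e: "e \<in> {0<..1}"
    \<comment> \<open>contraction constant at most \<open>1/2\<close>, displacement less than \<open>e\<close>; adding \<open>1\<close> avoids division by zero\<close>
    define h0 where "h0 = min (1 / (2 * (L + 1))) (e / (K + 1))"
    have pos: "L + 1 > 0" "K + 1 > 0" using LK by auto
    have h0: "h0 > 0" using pos e by (simp add: h0_def)
    have h01: "h0 \<le> 1" using LK(1) by (simp add: h0_def min_le_iff_disj divide_le_eq)
    have hL: "h * L \<le> 1 / 2" and hK: "h * K < e" if h: "h \<in> {0<..<h0}" for h
    proof -
      have "h * (2 * (L + 1)) < 1" using h pos by (simp add: h0_def less_divide_eq)
      then show "h * L \<le> 1 / 2" using h by (simp add: algebra_simps)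
      have "h * (K + 1) < e" using h pos by (simp add: h0_def less_divide_eq)
      then show "h * K < e" using h by (simp add: algebra_simps)
    qed
    show "\<exists>h0>0. h0 \<le> 1 \<and> (\<forall>h\<in>{0<..<h0}. contracting_step R K e h (G h))"
      unfolding contracting_step_def
    proof (intro exI[of _ h0] conjI h0 h01 ballI allI impI)
      fix h :: real and p :: 'p assume h: "h \<in> {0<..<h0}" and p: "norm p \<le> R"
      have h1: "\<bar>h\<bar> \<le> 1" using h h01 by auto
      show "norm (G h p y) \<le> K" if "norm y \<le> R + 1" for y using bK[OF h1 p that] .
      show "norm (h *\<^sub>R (G h p y - G h p y')) \<le> (1 / 2) * norm (y - y')" if "norm y \<le> R + 1" "norm y' \<le> R + 1" for y y'
      proof -
        have "norm (h *\<^sub>R (G h p y - G h p y')) \<le> h * (L * norm (y - y'))"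
          using bL[OF h1 p that] h by (simp add: mult_left_mono)
        also have "\<dots> = (h * L) * norm (y - y')" by simp
        also have "\<dots> \<le> (1 / 2) * norm (y - y')" using hL[OF h] by (intro mult_right_mono) auto
        finally show ?thesis .
      qed
      fix x C assume x: "norm x \<le> R \<and> closed C \<and> x \<in> C \<and> (\<forall>y\<in>C. x + h *\<^sub>R G h p y \<in> C)"
      have near: "norm y \<le> R + 1" if "dist y x \<le> 1" for y
      proof -
        have "norm y \<le> norm (y - x) + norm x" by norm
        then show ?thesis using that x by (simp add: dist_norm)
      qed
      show "\<exists>!y. y \<in> C \<and> y = x + h *\<^sub>R G h p y \<and> dist y x < e"
        by (rule implicit_step[where r = 1 and K = K and L = L])
           (use x h e hL[OF h] hK[OF h] bK[OF h1 p near] bL[OF h1 p near near] in auto)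
    qed
  qed
qed

context trace_algebra
begin

text \<open>The field \<open>G\<close> in \<open>start_pt h y = y - h G(h, y)\<close>.\<close>

definition step_field :: "real \<Rightarrow> 'a \<Rightarrow> 'a"
  where "step_field h y = (1 / 2) *\<^sub>R (y \<star> M y - M y \<star> y) + (h / 4) *\<^sub>R (M y \<star> y \<star> M y)"

definition flow :: "'a \<Rightarrow> 'a" where "flow y = y \<star> M y - M y \<star> y"

lemma start_pt_eq: "start_pt h y = y - h *\<^sub>R step_field h y"
  by (simp add: start_pt_def step_field_def mid_def mul_ring scaleR_diff_right scaleR_add_right algebra_simps)

lemma start_pt_iff: "start_pt h y = z \<longleftrightarrow> y = z + h *\<^sub>R step_field h y"
  by (auto simp: start_pt_eq algebra_simps)

lemma M_bounded_linear: "bounded_linear M"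
  using M_linear by (simp add: linear_conv_bounded_linear)

lemma flow_lipschitz: "lipschitz_bdd flow"
proof -
  note m = lipschitz_bdd_linear[OF M_bounded_linear]
  note i = lipschitz_bdd_linear[OF bounded_linear_ident]
  show ?thesis unfolding flow_def[abs_def]
    by (rule lipschitz_bdd_diff[OF lipschitz_bdd_bilinear[OF mul_bilinear i m]
      lipschitz_bdd_bilinear[OF mul_bilinear m i]])
qed

lemma step_field_lipschitz:
  "lipschitz_bdd (\<lambda>q::real \<times> real \<times> 'a. step_field (fst q) (snd (snd q)))"
proof -
  have y: "lipschitz_bdd (\<lambda>q::real \<times> real \<times> 'a. snd (snd q))"
    by (rule lipschitz_bdd_linear[OF bounded_linear_snd_comp[OF bounded_linear_snd]])
  have m: "lipschitz_bdd (\<lambda>q::real \<times> real \<times> 'a. M (snd (snd q)))"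
    by (rule lipschitz_bdd_compose[OF lipschitz_bdd_linear[OF M_bounded_linear] y])
  have t: "lipschitz_bdd (\<lambda>q::real \<times> real \<times> 'a. fst q / 4)"
    by (rule lipschitz_bdd_linear[OF bounded_linear_compose[OF bounded_linear_divide bounded_linear_fst]])
  note mul = lipschitz_bdd_bilinear[OF mul_bilinear]
  note scale = lipschitz_bdd_bilinear[OF bounded_bilinear_scaleR]
  show ?thesis unfolding step_field_def
    by (rule lipschitz_bdd_add[OF
        scale[OF lipschitz_bdd_const lipschitz_bdd_diff[OF mul[OF y m] mul[OF m y]]]
        scale[OF t mul[OF mul[OF m y] m]]])
qed

text \<open>The last clause says that the solution stays in every closed set preserved by the iteration.\<close>

definition midpoint_solver :: "real \<Rightarrow> real \<Rightarrow> real \<Rightarrow> real \<Rightarrow> ('a \<Rightarrow> 'a) \<Rightarrow> bool"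
  where "midpoint_solver R K e h S \<longleftrightarrow> implicit_solution (\<star>) one tr M h (ball 0 R) S \<and>
      (\<forall>z\<in>ball 0 R. dist (S z) z < e \<and> dist (S z) z \<le> K * h
         \<and> (\<forall>y. start_pt h y = z \<and> dist y z < e \<longrightarrow> y = S z)
         \<and> (\<forall>C. closed C \<and> z \<in> C \<and> (\<forall>y\<in>C. z + h *\<^sub>R step_field h y \<in> C) \<longrightarrow> S z \<in> C))"

lemma midpoint_solverD:
  assumes "midpoint_solver R K e h S"
  shows "implicit_solution (\<star>) one tr M h (ball 0 R) S"
    and "\<And>z. z \<in> ball 0 R \<Longrightarrow> dist (S z) z < e" "\<And>z. z \<in> ball 0 R \<Longrightarrow> dist (S z) z \<le> K * h"
    and "\<And>z y. z \<in> ball 0 R \<Longrightarrow> start_pt h y = z \<Longrightarrow> dist y z < e \<Longrightarrow> y = S z"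
    and "\<And>z C. z \<in> ball 0 R \<Longrightarrow> closed C \<Longrightarrow> z \<in> C \<Longrightarrow> (\<And>y. y \<in> C \<Longrightarrow> z + h *\<^sub>R step_field h y \<in> C) \<Longrightarrow> S z \<in> C"
proof -
  note all = assms[unfolded midpoint_solver_def]
  show "implicit_solution (\<star>) one tr M h (ball 0 R) S" by (rule conjunct1[OF all])
  fix z :: 'a assume z: "z \<in> ball 0 R"
  note z = bspec[OF conjunct2[OF all] z]
  show "dist (S z) z < e" "dist (S z) z \<le> K * h" using z by simp_all
  show "y = S z" if "start_pt h y = z" "dist y z < e" for y
    by (rule conjunct1[OF conjunct2[OF conjunct2[OF z]], rule_format]) (use that in simp)
  show "S z \<in> C" if "closed C" "z \<in> C" "\<And>y. y \<in> C \<Longrightarrow> z + h *\<^sub>R step_field h y \<in> C" for C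
    by (rule conjunct2[OF conjunct2[OF conjunct2[OF z]], rule_format]) (use that in simp)
qed

lemma midpoint_region:
  "\<exists>K\<ge>0. \<forall>e\<in>{0<..1}. \<exists>h0>0. h0 \<le> 1 \<and> (\<forall>h\<in>{0<..<h0}. \<exists>S. midpoint_solver R K e h S)"
proof -
  obtain K where K0: "K \<ge> 0" and K: "\<forall>e\<in>{0<..1}. \<exists>h0>0. h0 \<le> 1 \<and>
      (\<forall>h\<in>{0<..<h0}. contracting_step \<bar>R\<bar> K e h (\<lambda>_::real. step_field h))"
    using implicit_step_family[where G = "\<lambda>h _. step_field h", OF step_field_lipschitz, of "\<bar>R\<bar>"] by blast
  show ?thesis
  proof (rule exI[of _ K], intro conjI K0 ballI)
    fix e :: real assume e: "e \<in> {0<..1}"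
    with K obtain h0 where h0: "h0 > 0" "h0 \<le> 1"
      and solv: "\<And>h. h \<in> {0<..<h0} \<Longrightarrow> contracting_step \<bar>R\<bar> K e h (\<lambda>_::real. step_field h)"
      by blast
    show "\<exists>h0>0. h0 \<le> 1 \<and> (\<forall>h\<in>{0<..<h0}. \<exists>S. midpoint_solver R K e h S)"
    proof (intro exI[of _ h0] conjI h0 ballI)
      fix h assume h: "h \<in> {0<..<h0}"
      have n0: "norm (0::real) \<le> \<bar>R\<bar>" by simp
      note cs = contracting_stepD[OF solv[OF h] n0]
      have solvC: "\<exists>!y. y \<in> C \<and> start_pt h y = z \<and> dist y z < e"
        if "z \<in> ball 0 R" "closed C" "z \<in> C" "\<forall>y\<in>C. z + h *\<^sub>R step_field h y \<in> C" for z C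
      proof -
        have "norm z \<le> \<bar>R\<bar>" using that(1) by auto
        then show ?thesis using cs(1)[of z C] that unfolding start_pt_iff by blast
      qed
      have bK: "norm (step_field h y) \<le> K" if "norm y \<le> \<bar>R\<bar> + 1" for y
        using cs(2)[OF that] .
      have bL: "norm (y - y') \<le> 2 * norm (start_pt h y - start_pt h y')"
        if "norm y \<le> \<bar>R\<bar> + 1" "norm y' \<le> \<bar>R\<bar> + 1" for y y'
      proof -
        have "norm (h *\<^sub>R (step_field h y - step_field h y')) \<le> (1 / 2) * norm (y - y')"
          using cs(3)[OF that] .
        moreover have "start_pt h y - start_pt h y' = (y - y') - h *\<^sub>R (step_field h y - step_field h y')"
          by (simp add: start_pt_eq algebra_simps)
        ultimately show ?thesis
          using norm_triangle_ineq2[of "y - y'" "h *\<^sub>R (step_field h y - step_field h y')"] by simp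
      qed
      define S where "S z = (THE y. start_pt h y = z \<and> dist y z < e)" for z
      have ex: "\<exists>!y. start_pt h y = z \<and> dist y z < e" if "z \<in> ball 0 R" for z
        using solvC[OF that, of UNIV] by auto
      have S: "start_pt h (S z) = z" "dist (S z) z < e" if "z \<in> ball 0 R" for z
        using theI'[OF ex[OF that]] by (auto simp: S_def)
      have uniq: "y = S z" if "z \<in> ball 0 R" "start_pt h y = z" "dist y z < e" for y z
        using ex[OF that(1)] S[OF that(1)] that by blast
      have Sn: "norm (S z) < \<bar>R\<bar> + 1" if "z \<in> ball 0 R" for z
      proof -
        have "norm (S z) \<le> norm (S z - z) + norm z" by norm
        moreover have "norm (S z - z) < e" "norm z < R" "e \<le> 1"
          using S(2)[OF that] that e by (simp_all add: dist_norm)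
        ultimately show ?thesis using abs_ge_self[of R] by linarith
      qed
      show "\<exists>S. midpoint_solver R K e h S"
        unfolding midpoint_solver_def
      proof (intro exI[of _ S] conjI ballI allI impI)
        show "implicit_solution (\<star>) one tr M h (ball 0 R) S"
        proof unfold_locales
          show "continuous_on (ball 0 R) S"
          proof (rule continuous_on_iff[THEN iffD2], intro ballI allI impI)
            fix x :: 'a and d :: real assume x: "x \<in> ball 0 R" and d: "d > 0"
            have "dist (S x') (S x) < d" if "x' \<in> ball 0 R" "dist x' x < d / 2" for x'
              using bL[of "S x'" "S x"] Sn[OF that(1)] Sn[OF x] S(1)[OF that(1)] S(1)[OF x] that(2)
              by (simp add: dist_norm)
            then show "\<exists>da>0. \<forall>x'\<in>ball 0 R. dist x' x < da \<longrightarrow> dist (S x') (S x) < d"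
              using d by (intro exI[of _ "d / 2"]) auto
          qed
          fix z :: 'a and v assume z: "z \<in> ball 0 R"
          show "start_pt h (S z) = z" by (rule S[OF z])
          have "(1 / 2) * norm v \<le> norm (start_diff h (S z) v)"
          proof (rule derivative_lower_bound[OF start_pt_has_derivative, where r = "\<bar>R\<bar> + 1 - norm (S z)"])
            show "0 < \<bar>R\<bar> + 1 - norm (S z)" using Sn[OF z] by simp
            fix y assume "dist y (S z) < \<bar>R\<bar> + 1 - norm (S z)"
            then have "norm y \<le> \<bar>R\<bar> + 1" using norm_triangle_ineq2[of y "S z"] by (simp add: dist_norm)
            then show "1 / 2 * norm (y - S z) \<le> norm (start_pt h y - start_pt h (S z))"
              using bL[of y "S z"] Sn[OF z] by simp
          qed
          then show "norm v \<le> 2 * norm (start_diff h (S z) v)" by simp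
        qed simp
        fix z :: 'a assume z: "z \<in> ball 0 R"
        show "dist (S z) z < e" by (rule S[OF z])
        have "S z = z + h *\<^sub>R step_field h (S z)" using S(1)[OF z] by (simp only: start_pt_iff)
        then have "dist (S z) z = h * norm (step_field h (S z))"
          using h by (metis (no_types) add_diff_cancel_left' dist_norm norm_scaleR abs_of_pos greaterThanLessThan_iff)
        then show "dist (S z) z \<le> K * h"
          using bK[of "S z"] Sn[OF z] h by (simp add: mult.commute mult_left_mono)
        show "y = S z" if "start_pt h y = z \<and> dist y z < e" for y using uniq[OF z] that by blast
        show "S z \<in> C" if C: "closed C \<and> z \<in> C \<and> (\<forall>y\<in>C. z + h *\<^sub>R step_field h y \<in> C)" for C
        proof -
          obtain y where "y \<in> C" "start_pt h y = z" "dist y z < e" using solvC[OF z, of C] C by blast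
          then show ?thesis using uniq[OF z, of y] by simp
        qed
      qed
    qed
  qed
qed

end

section \<open>Matrices over the dual numbers\<close>

text \<open>The pair \<open>(W, \<Theta>)\<close> stands for \<open>\<Theta> + \<epsilon> W\<close>, so the second component is the scalar part; the trace
  form picks out the coefficient of \<open>\<epsilon>\<close>.\<close>

definition dual_mul :: "('n::finite) cmat \<times> 'n cmat \<Rightarrow> 'n cmat \<times> 'n cmat \<Rightarrow> 'n cmat \<times> 'n cmat"
  where "dual_mul x y = (fst x ** snd y + snd x ** fst y, snd x ** snd y)"

definition dual_one :: "('n::finite) cmat \<times> 'n cmat"
  where "dual_one = (0, mat 1)"

definition dual_tr :: "('n::finite) cmat \<times> 'n cmat \<Rightarrow> real"
  where "dual_tr x = Re (trace (fst x))"

definition star :: "('n::finite) cmat \<times> 'n cmat \<Rightarrow> 'n cmat \<times> 'n cmat"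
  where "star x = ((fst x)\<^sup>\<dagger>, (snd x)\<^sup>\<dagger>)"

lemma dual_mul_bilinear: "bounded_bilinear (dual_mul :: ('n::finite) cmat \<times> 'n cmat \<Rightarrow> _)"
  unfolding bilinear_conv_bounded_bilinear[symmetric] bilinear_def
  by (intro conjI allI linearI) (simp_all add: dual_mul_def mat_ring scaleR_add_right)

lemma star_simps [simp]:
  "star (x + y) = star x + star y" "star (x - y) = star x - star y" "star (- x) = - star x"
  "star (r *\<^sub>R x) = r *\<^sub>R star x" "star (dual_mul x y) = dual_mul (star y) (star x)"
  "star dual_one = dual_one"
  by (simp_all add: star_def dual_mul_def dual_one_def add.commute)

text \<open>The intermediate states live here; in contrast to \<open>W\<^sub>n\<close> and \<open>\<Theta>\<^sub>n\<close> they need not be trace free.\<close>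

definition uu :: "(('n::finite) cmat \<times> 'n cmat) set" where "uu = u_alg \<times> u_alg"

lemma uu_iff: "x \<in> uu \<longleftrightarrow> star x = - x"
  by (cases x) (auto simp: uu_def u_alg_def star_def)

lemma subspace_uu: "subspace uu"
  by (simp add: uu_def subspace_Times subspace_u_alg)

lemma closed_uu: "closed uu"
  by (rule closed_subspace[OF subspace_uu])

context spin_rep
begin

definition dual_M :: "'n cmat \<times> 'n cmat \<Rightarrow> 'n cmat \<times> 'n cmat"
  where "dual_M x = (lap X (snd x), linv (fst x))"

sublocale D: trace_algebra dual_mul dual_one dual_tr dual_M
proof (rule trace_algebra.intro)
  show "bounded_bilinear (dual_mul :: 'n cmat \<times> 'n cmat \<Rightarrow> _)" by (rule dual_mul_bilinear)
  fix x y z :: "'n cmat \<times> 'n cmat"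
  show "dual_mul (dual_mul x y) z = dual_mul x (dual_mul y z)"
    by (simp add: dual_mul_def mat_ring)
  show "dual_mul dual_one x = x" "dual_mul x dual_one = x"
    by (simp_all add: dual_mul_def dual_one_def mm.zero_left mm.zero_right)
  show "linear (dual_tr :: 'n cmat \<times> 'n cmat \<Rightarrow> real)"
    by (rule linearI) (simp_all add: dual_tr_def trace_add trace_scaleR)
  show "dual_tr (dual_mul x y) = dual_tr (dual_mul y x)"
    using trace_cyc[of "fst x" "snd y"] trace_cyc[of "snd x" "fst y"]
    by (simp add: dual_tr_def dual_mul_def trace_add)
  show "linear dual_M"
    by (rule linearI) (simp_all add: dual_M_def linear_add[OF lap_linear] linear_cmul[OF lap_linear]
        linear_add[OF linv_linear] linear_cmul[OF linv_linear])
  show "dual_tr (dual_mul x (dual_M y)) = dual_tr (dual_mul (dual_M x) y)"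
    using linv_symmetric[of "fst x" "fst y"] lap_symmetric[of "snd x" X "snd y"]
    by (simp add: dual_tr_def dual_mul_def dual_M_def trace_add)
qed

lemma star_dual_M: "x \<in> uu \<Longrightarrow> star (dual_M x) = - dual_M x"
  using linv_u[of "fst x"] lap_u[of "snd x"]
  by (cases x) (simp add: uu_def dual_M_def star_def su_alg_iff u_alg_def)

lemma star_mid: "x \<in> uu \<Longrightarrow> star (D.mid h x) = - D.mid h x"
  by (simp add: D.mid_def star_dual_M)

lemma flow_uu: "y \<in> uu \<Longrightarrow> D.flow y \<in> uu"
  unfolding D.flow_def uu_iff[of "dual_mul _ _ - _"]
  by (simp add: star_dual_M uu_iff[THEN iffD1] D.mul_ring)

lemma step_field_uu:
  assumes y: "y \<in> uu" shows "D.step_field h y \<in> uu"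
proof -
  have "star (D.step_field h y) = - D.step_field h y"
    using y unfolding D.step_field_def
    by (simp add: star_dual_M uu_iff[THEN iffD1] D.mul_ring algebra_simps)
  then show ?thesis by (simp add: uu_iff)
qed

lemma start_diff_uu:
  assumes y: "y \<in> uu" and v: "v \<in> uu" shows "D.start_diff h y v \<in> uu"
proof -
  have "star (D.start_diff h y v) = - D.start_diff h y v"
    using y v unfolding D.start_diff_def
    by (simp add: star_mid uu_iff[THEN iffD1] D.mul_ring algebra_simps)
  then show ?thesis by (simp add: uu_iff)
qed

lemma mid_covector_uu:
  assumes y: "y \<in> uu" and q: "q \<in> uu"
  shows "D.mid_covector (dual_one + D.mid h y) (dual_one - D.mid h y) y q \<in> uu"
    "D.mid_covector (dual_one - D.mid h y) (dual_one + D.mid h y) y q \<in> uu"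
proof -
  have "star (D.mid_covector (dual_one + D.mid h y) (dual_one - D.mid h y) y q) = - D.mid_covector (dual_one + D.mid h y) (dual_one - D.mid h y) y q"
    "star (D.mid_covector (dual_one - D.mid h y) (dual_one + D.mid h y) y q) = - D.mid_covector (dual_one - D.mid h y) (dual_one + D.mid h y) y q"
    using y q unfolding D.mid_covector_def
    by (simp_all add: star_mid uu_iff[THEN iffD1] D.mul_ring algebra_simps)
  then show "D.mid_covector (dual_one + D.mid h y) (dual_one - D.mid h y) y q \<in> uu"
    "D.mid_covector (dual_one - D.mid h y) (dual_one + D.mid h y) y q \<in> uu" by (simp_all add: uu_iff)
qed

lemma mid_pair: "D.mid h (W, T) = ((h / 2) *\<^sub>R lap X T, (h / 2) *\<^sub>R linv W)"
  by (simp add: D.mid_def dual_M_def)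

lemma flow_pair: "D.flow (W, T) = (commutator W (linv W) + commutator T (lap X T), commutator T (linv W))"
  by (simp add: D.flow_def dual_mul_def dual_M_def commutator_def)

lemma flow_field_eq: "z \<in> uu \<Longrightarrow> flow_field X z = D.flow z"
  by (cases z) (simp add: uu_def flow_field_def flow_pair linv_eq)

text \<open>The coefficients of \<open>1\<close> and \<open>\<epsilon>\<close> in \<open>(1 + m) y (1 - m)\<close> are the two implicit equations.\<close>

lemma reduced_eqs_iff: "reduced_eqs X h z y \<longleftrightarrow> y \<in> uu \<and> D.start_pt h y = z"
proof -
  obtain W T where z: "z = (W, T)" by (cases z)
  obtain Wt Tt where y: "y = (Wt, Tt)" by (cases y)
  show ?thesis
  proof (cases "y \<in> uu")
    case True
    then have l: "lap_inv X Wt = linv Wt" by (simp add: y uu_def linv_eq)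
    define m where "m = linv Wt"
    define k where "k = lap X Tt"
    have s: "D.start_pt h y = (Wt - (h / 2) *\<^sub>R commutator Wt m - (h / 2) *\<^sub>R commutator Tt k
          - (h\<^sup>2 / 4) *\<^sub>R (m ** Wt ** m + k ** Tt ** m + m ** Tt ** k),
        Tt - (h / 2) *\<^sub>R commutator Tt m - (h\<^sup>2 / 4) *\<^sub>R (m ** Tt ** m))"
      unfolding y D.start_pt_def mid_pair
      unfolding dual_one_def dual_mul_def m_def[symmetric] k_def[symmetric] commutator_def
      by (simp add: mat_ring mm.zero_left mm.zero_right power2_eq_square algebra_simps)
    show ?thesis unfolding reduced_eqs_def z using True s
      by (auto simp: y l Let_def uu_def m_def k_def)
  next
    case False
    then show ?thesis by (auto simp: reduced_eqs_def y z uu_def Let_def)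
  qed
qed

lemma reduced_step_eq:
  assumes "solution_near e (reduced_eqs X h) z = y" "y \<in> uu" "D.start_pt h y = z"
  shows "reduced_step X e h z = D.end_pt h y"
proof -
  obtain W T where z: "z = (W, T)" by (cases z)
  obtain Wt Tt where y: "y = (Wt, Tt)" by (cases y)
  have "reduced_step X e h z = z + h *\<^sub>R flow_field X y"
    using assms(1) by (simp add: reduced_step_def z y flow_field_def Let_def scaleR_add_right)
  also have "\<dots> = D.start_pt h y + h *\<^sub>R D.flow y" using assms by (simp add: flow_field_eq)
  also have "\<dots> = D.end_pt h y" by (simp add: D.end_start D.flow_def)
  finally show ?thesis .
qed

end

section \<open>Differentials and the Lie--Poisson bracket\<close>

lemma riesz_subspace:
  fixes f :: "'a::euclidean_space \<Rightarrow> real"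
  assumes S: "subspace S" and f: "linear f"
  shows "\<exists>d\<in>S. \<forall>x\<in>S. f x = d \<bullet> x"
proof -
  define w where "w = adjoint f 1"
  have w: "f x = w \<bullet> x" for x
    using adjoint_works[OF f, of x 1] by (simp add: w_def inner_commute)
  obtain d z where dz: "d \<in> span S" "\<And>x. x \<in> span S \<Longrightarrow> orthogonal z x" "w = d + z"
    using orthogonal_subspace_decomp_exists[of S w] by metis
  have "span S = S" by (rule span_eq_iff[THEN iffD2, OF S])
  then have "d \<in> S" "\<And>x. x \<in> S \<Longrightarrow> z \<bullet> x = 0"
    using dz(1,2) unfolding \<open>span S = S\<close> orthogonal_def by blast+
  then show ?thesis using w dz(3) by (intro bexI[of _ d]) (auto simp: inner_add_left)
qed

lemma has_derivative_line:
  fixes F :: "'a::real_normed_vector \<Rightarrow> 'b::real_normed_vector"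
  assumes F: "(F has_derivative F') (at x within S)" and line: "\<And>t::real. x + t *\<^sub>R k \<in> S"
  shows "((\<lambda>t. F (x + t *\<^sub>R k)) has_derivative (\<lambda>t. F' (t *\<^sub>R k))) (at 0)"
proof -
  have 1: "((\<lambda>t. x + t *\<^sub>R k) has_derivative (\<lambda>t. t *\<^sub>R k)) (at 0)"
    by (auto intro!: derivative_eq_intros)
  have "(F has_derivative F') (at (x + 0 *\<^sub>R k) within range (\<lambda>t. x + t *\<^sub>R k))"
    using has_derivative_subset[OF F, of "range (\<lambda>t. x + t *\<^sub>R k)"] line by auto
  from has_derivative_in_compose[OF 1 this] show ?thesis .
qed

text \<open>Directions inside the subspace can be tested along lines that stay in it.\<close>

lemma has_derivative_within_subspace_unique:
  fixes F :: "'a::real_normed_vector \<Rightarrow> 'b::real_normed_vector"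
  assumes "(F has_derivative F') (at x within S)" "(F has_derivative F'') (at x within S)"
    and S: "subspace S" and x: "x \<in> S" and k: "k \<in> S"
  shows "F' k = F'' k"
proof -
  have line: "x + t *\<^sub>R k \<in> S" for t by (intro subspace_add[OF S] subspace_scale[OF S] x k)
  have "(\<lambda>t. F' (t *\<^sub>R k)) = (\<lambda>t. F'' (t *\<^sub>R k))"
    by (rule has_derivative_unique[OF has_derivative_line[OF assms(1) line] has_derivative_line[OF assms(2) line]])
  from fun_cong[OF this, of 1] show ?thesis by simp
qed

lemma subspace_f_dual: "subspace f_dual"
  by (simp add: f_dual_def subspace_Times subspace_su_alg)

lemma f_pair_eq_inner: "f_pair K d = (snd d, fst d) \<bullet> K"
  by (cases K; cases d) (simp add: f_pair_def frob_eq_inner inner_commute)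

lemma f_diff_props:
  assumes J: "J \<in> f_dual" and F: "(F has_derivative F') (at J within f_dual)"
  shows "f_diff F J \<in> su_alg \<times> su_alg" "\<And>K. K \<in> f_dual \<Longrightarrow> F' K = f_pair K (f_diff F J)"
proof -
  let ?P = "\<lambda>d. d \<in> su_alg \<times> su_alg
            \<and> (\<exists>F'. (F has_derivative F') (at J within f_dual) \<and> (\<forall>K\<in>f_dual. F' K = f_pair K d))"
  obtain d where d: "d \<in> f_dual" "\<forall>K\<in>f_dual. F' K = d \<bullet> K"
    using riesz_subspace[OF subspace_f_dual has_derivative_linear[OF F]] by blast
  define e where "e = (snd d, fst d)"
  have e: "?P e" "\<forall>K\<in>f_dual. F' K = f_pair K e"
    using d F by (auto simp: e_def f_dual_def f_pair_eq_inner)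
  have uniq: "d' = e" if d': "?P d'" for d'
  proof -
    obtain F'' where F'': "(F has_derivative F'') (at J within f_dual)" "\<forall>K\<in>f_dual. F'' K = f_pair K d'"
      using d' by blast
    have su: "d' \<in> su_alg \<times> su_alg" "e \<in> su_alg \<times> su_alg" using d' e(1) by auto
    define k where "k = (snd d' - snd e, fst d' - fst e)"
    have k: "k \<in> f_dual"
      using su by (auto simp: k_def f_dual_def intro!: subspace_diff[OF subspace_su_alg])
    have "f_pair k d' = f_pair k e"
      using has_derivative_within_subspace_unique[OF F F''(1) subspace_f_dual J k] F''(2) e(2) k by auto
    then have "((snd d', fst d') - (snd e, fst e)) \<bullet> k = 0"
      by (simp only: inner_diff_left f_pair_eq_inner right_minus_eq)
    moreover have "(snd d', fst d') - (snd e, fst e) = k" by (simp add: k_def)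
    ultimately have "k \<bullet> k = 0" by (simp only:)
    then have "k = 0" by (simp only: inner_eq_zero_iff)
    then show ?thesis by (simp add: k_def prod_eq_iff)
  qed
  have "f_diff F J = e" unfolding f_diff_def by (rule the_equality[where P = "?P", OF e(1) uniq])
  then show "f_diff F J \<in> su_alg \<times> su_alg" "\<And>K. K \<in> f_dual \<Longrightarrow> F' K = f_pair K (f_diff F J)"
    using e by auto
qed

lemma smooth_on_has_derivative:
  assumes "smooth_on S f" "x \<in> S"
  shows "\<exists>f'. (f has_derivative f') (at x within S)"
proof -
  obtain U g where U: "open U" "S \<subseteq> U" "\<forall>k. Ck_on k U g" "\<forall>x\<in>S. g x = f x"
    using assms(1) unfolding smooth_on_def by blast
  have "Ck_on (Suc 0) U g" using U(3) by blast
  then have "g differentiable (at x)" using U(2) assms(2) by auto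
  then obtain g' where "(g has_derivative g') (at x)" by (auto simp: differentiable_def)
  then have "(g has_derivative g') (at x within S)" by (rule has_derivative_at_withinI)
  then show ?thesis using has_derivative_transform[OF assms(2), of f g g'] U(4) by auto
qed

lemma linear_to_dual: "bounded_linear to_dual" and linear_of_dual: "bounded_linear of_dual"
  by (simp_all add: linear_conv_bounded_linear[symmetric])
     (auto intro!: linearI simp: to_dual_def of_dual_def split: prod.split)

lemma of_to_dual [simp]: "of_dual (to_dual z) = z" and to_of_dual [simp]: "to_dual (of_dual J) = J"
  by (simp_all add: to_dual_def of_dual_def split: prod.split)

abbreviation su2 :: "(('n::finite) cmat \<times> 'n cmat) set" where "su2 \<equiv> su_alg \<times> su_alg"

lemma subspace_su2: "subspace su2"
  by (simp add: subspace_Times subspace_su_alg)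

lemma su_dagger: "A \<in> su_alg \<Longrightarrow> A\<^sup>\<dagger> \<in> su_alg"
  by (simp add: su_alg_def trace_minus)

lemma to_dual_f_dual: "z \<in> su2 \<Longrightarrow> to_dual z \<in> f_dual"
  by (auto simp: to_dual_def f_dual_def su_dagger)

lemma of_dual_su2: "J \<in> f_dual \<Longrightarrow> of_dual J \<in> su2"
  by (auto simp: of_dual_def f_dual_def su_dagger)

lemma su2_uu: "z \<in> su2 \<Longrightarrow> z \<in> uu"
  by (auto simp: uu_def su_alg_iff)

text \<open>The gradient for the trace form of dual numbers that corresponds to a differential in \<open>\<ff>\<close>; the
  sign comes from \<open>a\<^sup>\<dagger> = - a\<close>.\<close>

definition covec :: "('n::finite) cmat \<times> 'n cmat \<Rightarrow> 'n cmat \<times> 'n cmat"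
  where "covec d = (- snd d, fst d)"

lemma covec_su2: "d \<in> su2 \<Longrightarrow> covec d \<in> su2"
  by (auto simp: covec_def intro: subspace_neg[OF subspace_su_alg])

lemma f_pair_to_dual:
  assumes "d \<in> su2" shows "f_pair (to_dual v) d = dual_tr (dual_mul (covec d) v)"
proof -
  obtain w a where d: "d = (w, a)" by (cases d)
  obtain V T where v: "v = (V, T)" by (cases v)
  have "a\<^sup>\<dagger> = - a" using assms by (simp add: d su_alg_def)
  then show ?thesis
    using trace_cyc[of V w]
    by (simp add: f_pair_def to_dual_def d v frob_def dual_tr_def dual_mul_def covec_def trace_add trace_diff trace_minus
        mm.minus_left)
qed

abbreviation dual_comm :: "('n::finite) cmat \<times> 'n cmat \<Rightarrow> 'n cmat \<times> 'n cmat \<Rightarrow> 'n cmat \<times> 'n cmat"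
  where "dual_comm x y \<equiv> dual_mul x y - dual_mul y x"

lemma f_bracket_su2:
  assumes "d \<in> su2" "e \<in> su2"
  shows "f_bracket d e \<in> su2" "covec (f_bracket d e) = dual_comm (covec d) (covec e)"
proof -
  obtain v a where d: "d = (v, a)" by (cases d)
  obtain w b where e: "e = (w, b)" by (cases e)
  have s: "v\<^sup>\<dagger> = - v" "a\<^sup>\<dagger> = - a" "w\<^sup>\<dagger> = - w" "b\<^sup>\<dagger> = - b"
    using assms by (auto simp: d e su_alg_def)
  show "f_bracket d e \<in> su2"
    by (simp add: f_bracket_def d e ad_star_def s su_alg_def commutator_dagger trace_diff)
       (simp add: commutator_def mat_ring)
  show "covec (f_bracket d e) = dual_comm (covec d) (covec e)"
    by (simp add: f_bracket_def d e ad_star_def s covec_def dual_mul_def commutator_def mat_ring)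
qed

text \<open>Under \<open>covec\<close> the semidirect bracket of \<open>\<ff>\<close> becomes the commutator of dual-number matrices.\<close>

lemma lp_bracket_eq:
  assumes "f_diff F (to_dual z) \<in> su2" "f_diff G (to_dual z) \<in> su2"
  shows "lp_bracket F G (to_dual z)
    = dual_tr (dual_mul z (dual_comm (covec (f_diff F (to_dual z))) (covec (f_diff G (to_dual z)))))"
proof -
  let ?d = "f_diff F (to_dual z)" and ?e = "f_diff G (to_dual z)"
  have comm: "dual_tr (dual_mul x z) = dual_tr (dual_mul z x)" for x
    using trace_cyc[of "fst x" "snd z"] trace_cyc[of "snd x" "fst z"]
    by (simp add: dual_tr_def dual_mul_def trace_add)
  have "lp_bracket F G (to_dual z) = dual_tr (dual_mul (covec (f_bracket ?d ?e)) z)"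
    unfolding lp_bracket_def by (rule f_pair_to_dual[OF f_bracket_su2(1)[OF assms]])
  also have "\<dots> = dual_tr (dual_mul z (covec (f_bracket ?d ?e)))" by (rule comm)
  finally show ?thesis unfolding f_bracket_su2(2)[OF assms] .
qed

lemma Re_trace_square: "A \<in> u_alg \<Longrightarrow> Re (trace (A ** A)) = - (A \<bullet> A)"
  using frob_eq_inner[of A A] by (simp add: frob_def u_alg_def mm.minus_left trace_minus)

lemma dual_tr_nondegenerate:
  assumes x: "x \<in> su2" and 0: "\<And>v. v \<in> su2 \<Longrightarrow> dual_tr (dual_mul x v) = 0"
  shows "x = 0"
proof -
  have "dual_tr (dual_mul x (snd x, fst x)) = 0" using x by (intro 0) auto
  moreover have "fst x \<in> u_alg" "snd x \<in> u_alg" using x by (auto simp: su_alg_iff)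
  ultimately have "fst x \<bullet> fst x + snd x \<bullet> snd x = 0"
    by (simp add: dual_tr_def dual_mul_def trace_add Re_trace_square)
  then have "x \<bullet> x = 0" by (simp add: inner_prod_def)
  then show ?thesis by simp
qed

text \<open>The skew-Hermitian central elements; they complement the trace-free pairs in \<open>uu\<close>.\<close>

definition dual_centre :: "real \<Rightarrow> real \<Rightarrow> ('n::finite) cmat \<times> 'n cmat"
  where "dual_centre s t = (mat (\<i> * of_real s), mat (\<i> * of_real t))"

lemma dual_centre_commutes: "dual_mul (dual_centre s t) x = dual_mul x (dual_centre s t)"
  by (simp add: dual_mul_def dual_centre_def mat_commute add.commute)

lemma dual_centre_decomp: "(dual_centre s t :: ('n::finite) cmat \<times> 'n cmat) = s *\<^sub>R dual_centre 1 0 + t *\<^sub>R dual_centre 0 1"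
  by (auto simp: dual_centre_def vec_eq_iff mat_def scaleR_conv_of_real[where 'a = complex])

lemma dual_centre_uu: "dual_centre s t \<in> uu"
  by (auto simp: dual_centre_def uu_def u_alg_def vec_eq_iff mat_def)

lemma uu_decomp:
  assumes x: "(x :: ('n::finite) cmat \<times> 'n cmat) \<in> uu"
  obtains y s t where "y \<in> su2" "x = y + dual_centre s t"
proof -
  have 1: "\<exists>B s. B \<in> su_alg \<and> A = B + mat (\<i> * of_real s)" if A: "A \<in> u_alg" for A :: "'n cmat"
  proof -
    have "cnj (trace A) = - trace A" using A by (simp add: u_alg_def trace_minus flip: trace_dagger)
    then have re: "Re (trace A) = 0" by (simp add: complex_eq_iff)
    define s where "s = Im (trace A) / of_nat CARD('n)"
    have ts: "trace A = of_nat CARD('n) * (\<i> * of_real s)"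
      by (simp add: complex_eq_iff re s_def)
    have "(mat (\<i> * of_real s) :: 'n cmat) \<in> u_alg" by (auto simp: u_alg_def vec_eq_iff mat_def)
    then have "A - mat (\<i> * of_real s) \<in> su_alg"
      using A ts by (simp add: su_alg_iff trace_diff trace_mat subspace_diff[OF subspace_u_alg])
    then show ?thesis by (intro exI[of _ "A - mat (\<i> * of_real s)"] exI[of _ s]) simp
  qed
  obtain B s where B: "B \<in> su_alg" "fst x = B + mat (\<i> * of_real s)" using 1[of "fst x"] x by (auto simp: uu_def)
  obtain C t where C: "C \<in> su_alg" "snd x = C + mat (\<i> * of_real t)" using 1[of "snd x"] x by (auto simp: uu_def)
  show thesis
    by (rule that[of "(B, C)" s t]) (use B C in \<open>auto simp: dual_centre_def prod_eq_iff\<close>)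
qed

text \<open>A linear form that is represented by \<open>q\<close> on the trace-free pairs is represented on all of \<open>uu\<close>
  after adding a central element to \<open>q\<close>, because the centre is its own dual under the trace form.\<close>

lemma covector_extension:
  fixes q :: "('n::finite) cmat \<times> 'n cmat"
  assumes l: "linear l" and q: "q \<in> su2" and lq: "\<And>v. v \<in> su2 \<Longrightarrow> l v = dual_tr (dual_mul q v)"
  shows "\<exists>c d. \<forall>v\<in>uu. l v = dual_tr (dual_mul (q + dual_centre c d) v)"
proof -
  let ?N = "real CARD('n)"
  \<comment> \<open>crosswise, since the trace form pairs the first component with the second\<close>
  define c d where "c = - l (dual_centre 0 1) / ?N" "d = - l (dual_centre 1 0) / ?N"
  interpret m: bounded_bilinear "dual_mul :: 'n cmat \<times> 'n cmat \<Rightarrow> _" by (rule dual_mul_bilinear)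
  have tr_add: "dual_tr (x + y) = dual_tr x + dual_tr y" for x y :: "'n cmat \<times> 'n cmat"
    by (simp add: dual_tr_def trace_add)
  have z: "dual_tr (dual_mul (dual_centre s t) x) = 0" if "x \<in> su2" for x :: "'n cmat \<times> 'n cmat" and s t
    using that by (auto simp: dual_tr_def dual_mul_def dual_centre_def trace_add trace_mat_mult su_alg_def)
  have cc: "dual_tr (dual_mul (dual_centre c d :: 'n cmat \<times> 'n cmat) (dual_centre s t)) = - ?N * (c * t + d * s)" for s t
    by (simp add: dual_tr_def dual_mul_def dual_centre_def trace_add trace_mat_mult trace_mat algebra_simps)
  have "l v = dual_tr (dual_mul (q + dual_centre c d) v)" if v: "v \<in> uu" for v
  proof -
    obtain y s t where y: "y \<in> su2" "v = y + dual_centre s t" using uu_decomp[OF v] by blast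
    have "dual_tr (dual_mul (q + dual_centre c d) v) = dual_tr (dual_mul q y) - ?N * (c * t + d * s)"
      using z[OF q, of s t] z[OF y(1), of c d] dual_centre_commutes[of s t q]
      by (simp add: y(2) m.add_left m.add_right tr_add cc)
    also have "\<dots> = l y + (s * l (dual_centre 1 0) + t * l (dual_centre 0 1))"
      by (simp add: lq[OF y(1)] c_d_def field_simps)
    also have "\<dots> = l v"
      unfolding y(2) by (subst dual_centre_decomp[of s t]) (simp add: linear_add[OF l] linear_cmul[OF l])
    finally show ?thesis by simp
  qed
  then show ?thesis by blast
qed

lemma dual_comm_centre:
  "dual_comm (p + dual_centre a b) (q + dual_centre c d) = dual_comm p (q :: ('n::finite) cmat \<times> 'n cmat)"
proof -
  interpret m: bounded_bilinear "dual_mul :: 'n cmat \<times> 'n cmat \<Rightarrow> _" by (rule dual_mul_bilinear)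
  show ?thesis
    using dual_centre_commutes[of a b q] dual_centre_commutes[of c d p] dual_centre_commutes[of a b "dual_centre c d"]
    by (simp add: m.add_left m.add_right)
qed

section \<open>The two Hamiltonian systems\<close>

lemma Re_trace_skew_dagger:
  assumes "A\<^sup>\<dagger> = - A" shows "Re (trace (A ** Z\<^sup>\<dagger>)) = - Re (trace (A ** (Z :: ('n::finite) cmat)))"
proof -
  have "trace (A ** Z\<^sup>\<dagger>) = cnj (trace (Z ** A\<^sup>\<dagger>))" by (simp flip: trace_dagger)
  then show ?thesis by (simp add: assms mm.minus_right trace_minus trace_cyc[of Z A])
qed

lemma state_of_uu: "\<alpha> \<in> u_alg \<Longrightarrow> state_of \<alpha> x \<in> uu"
  by (cases x) (simp add: state_of_def uu_def u_alg_def matrix_mul_assoc mm.minus_left mm.minus_right scaleR_diff_right)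

lemma state_of_has_derivative:
  "(state_of \<alpha> has_derivative (\<lambda>v. ((1 / 2) *\<^sub>R (Q ** (snd v)\<^sup>\<dagger> + fst v ** P\<^sup>\<dagger> - (P ** (fst v)\<^sup>\<dagger> + snd v ** Q\<^sup>\<dagger>)),
      Q ** \<alpha> ** (fst v)\<^sup>\<dagger> + fst v ** \<alpha> ** Q\<^sup>\<dagger>))) (at (Q, P))"
proof -
  have d: "((\<lambda>x. (f x)\<^sup>\<dagger>) has_derivative (\<lambda>v. (f' v)\<^sup>\<dagger>)) F" if "(f has_derivative f') F" for f f' F
    by (rule bounded_linear.has_derivative[OF linear_dagger that])
  have s: "state_of \<alpha> = (\<lambda>x. ((1 / 2) *\<^sub>R (fst x ** (snd x)\<^sup>\<dagger> - snd x ** (fst x)\<^sup>\<dagger>), fst x ** \<alpha> ** (fst x)\<^sup>\<dagger>))"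
    by (auto simp: state_of_def fun_eq_iff)
  show ?thesis unfolding s
    by (rule has_derivative_eq_rhs) (rule has_derivative_Pair has_derivative_scaleR_right mm.FDERIV d
        has_derivative_diff has_derivative_fst has_derivative_snd
        has_derivative_const has_derivative_ident | simp add: fun_eq_iff mm.zero_right)+
qed

context spin_rep
begin

definition dual_energy :: "'n cmat \<times> 'n cmat \<Rightarrow> real"
  where "dual_energy z = - (1 / 2) * dual_tr (dual_mul z (dual_M z))"

text \<open>On skew-Hermitian pairs the energy is, up to sign, half the square of \<open>y\<close> measured with \<open>M\<close> in
  the trace form; its gradient is therefore \<open>- M y\<close>.\<close>

lemma energy_eq: "z \<in> uu \<Longrightarrow> energy X z = dual_energy z"
  by (cases z) (simp add: uu_def u_alg_def energy_def dual_energy_def dual_tr_def dual_mul_def dual_M_def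
      linv_eq u_algI trace_add mm.minus_left trace_minus field_simps)

lemma dual_energy_has_derivative:
  "(dual_energy has_derivative (\<lambda>v. - dual_tr (dual_mul (dual_M z) v))) (at z)"
proof -
  have t: "bounded_linear (dual_tr :: 'n cmat \<times> 'n cmat \<Rightarrow> real)"
    using D.tr_linear by (simp add: linear_conv_bounded_linear)
  have "((\<lambda>z. dual_mul z (dual_M z)) has_derivative (\<lambda>v. dual_mul z (dual_M v) + dual_mul v (dual_M z))) (at z)"
    by (rule D.mul.FDERIV[OF has_derivative_ident bounded_linear_imp_has_derivative[OF D.M_bounded_linear]])
  from has_derivative_mult_right[OF bounded_linear.has_derivative[OF t this], of "- (1 / 2)"]
  have "(dual_energy has_derivative (\<lambda>v. - (1 / 2) * dual_tr (dual_mul z (dual_M v) + dual_mul v (dual_M z)))) (at z)"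
    by (simp only: dual_energy_def[abs_def])
  moreover have "- (1 / 2) * dual_tr (dual_mul z (dual_M v) + dual_mul v (dual_M z)) = - dual_tr (dual_mul (dual_M z) v)" for v
    using D.M_symmetric[of z v] D.tr_commute[of v "dual_M z"] by (simp add: D.tr_simps)
  ultimately show ?thesis by simp
qed

text \<open>By the chain rule the differential is \<open>- \<langle>M y, dy\<rangle>\<close> with \<open>y = state_of \<alpha> x\<close>.  The variations of
  \<open>W\<close> and \<open>\<Theta>\<close> are of the form \<open>Z - Z\<^sup>\<dagger>\<close>, and since \<open>M\<^sub>1\<close> and \<open>M\<^sub>2\<close> are skew-Hermitian both
  summands contribute equally.\<close>

theorem canonical_hamiltonian:
  assumes \<alpha>: "\<alpha> \<in> su_alg"
  shows "((\<lambda>y. energy X (state_of \<alpha> y)) has_derivative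
        (\<lambda>(dQ, dP). frob (f_field X \<alpha> x) dP - frob (g_field X \<alpha> x) dQ)) (at x)"
proof -
  obtain Q P where x: "x = (Q, P)" by (cases x)
  obtain W T where WT: "state_of \<alpha> x = (W, T)" by (cases "state_of \<alpha> x")
  have au: "\<alpha> \<in> u_alg" "\<alpha>\<^sup>\<dagger> = - \<alpha>" using \<alpha> by (auto simp: su_alg_def u_alg_def)
  have uu: "state_of \<alpha> y \<in> uu" for y by (rule state_of_uu[OF au(1)])
  define M1 where "M1 = linv W"
  define M2 where "M2 = lap X T"
  have WTu: "W \<in> u_alg" "T \<in> u_alg" using uu[of x] WT by (auto simp: uu_def)
  have li: "lap_inv X W = M1" using WTu by (simp add: M1_def linv_eq)
  have sk: "M1\<^sup>\<dagger> = - M1" "M2\<^sup>\<dagger> = - M2"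
    using linv_u[of W] lap_u[OF WTu(2)] by (auto simp: M1_def M2_def u_alg_def su_alg_def)
  have "((\<lambda>y. dual_energy (state_of \<alpha> y)) has_derivative
     (\<lambda>v. - dual_tr (dual_mul (dual_M (state_of \<alpha> (Q, P))) ((1 / 2) *\<^sub>R (Q ** (snd v)\<^sup>\<dagger> + fst v ** P\<^sup>\<dagger> - (P ** (fst v)\<^sup>\<dagger> + snd v ** Q\<^sup>\<dagger>)),
      Q ** \<alpha> ** (fst v)\<^sup>\<dagger> + fst v ** \<alpha> ** Q\<^sup>\<dagger>)))) (at (Q, P))"
    by (rule has_derivative_compose[OF state_of_has_derivative dual_energy_has_derivative])
  moreover have "(\<lambda>y. dual_energy (state_of \<alpha> y)) = (\<lambda>y. energy X (state_of \<alpha> y))"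
    using energy_eq[OF uu] by auto
  moreover have "- dual_tr (dual_mul (dual_M (state_of \<alpha> (Q, P))) ((1 / 2) *\<^sub>R (Q ** dP\<^sup>\<dagger> + dQ ** P\<^sup>\<dagger> - (P ** dQ\<^sup>\<dagger> + dP ** Q\<^sup>\<dagger>)),
      Q ** \<alpha> ** dQ\<^sup>\<dagger> + dQ ** \<alpha> ** Q\<^sup>\<dagger>)) = frob (f_field X \<alpha> x) dP - frob (g_field X \<alpha> x) dQ" (is "?l = ?r") for dQ dP
  proof -
    have st: "state_of \<alpha> (Q, P) = (W, T)" using WT x by simp
    have 1: "Re (trace (M1 ** (Q ** dP\<^sup>\<dagger>))) = - Re (trace (M1 ** (dP ** Q\<^sup>\<dagger>)))"
      using Re_trace_skew_dagger[OF sk(1), of "dP ** Q\<^sup>\<dagger>"] by simp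
    have 2: "Re (trace (M1 ** (P ** dQ\<^sup>\<dagger>))) = - Re (trace (M1 ** (dQ ** P\<^sup>\<dagger>)))"
      using Re_trace_skew_dagger[OF sk(1), of "dQ ** P\<^sup>\<dagger>"] by simp
    have 3: "Re (trace (M2 ** (Q ** \<alpha> ** dQ\<^sup>\<dagger>))) = Re (trace (M2 ** (dQ ** \<alpha> ** Q\<^sup>\<dagger>)))"
      using Re_trace_skew_dagger[OF sk(2), of "dQ ** \<alpha> ** Q\<^sup>\<dagger>"]
      by (simp add: au matrix_mul_assoc mm.minus_left mm.minus_right trace_minus)
    have "?l = Re (trace (M1 ** (dP ** Q\<^sup>\<dagger>))) - Re (trace (M1 ** (dQ ** P\<^sup>\<dagger>))) - 2 * Re (trace (M2 ** (dQ ** \<alpha> ** Q\<^sup>\<dagger>)))"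
      using 1 2 3 by (simp add: st dual_M_def dual_tr_def dual_mul_def M1_def[symmetric] M2_def[symmetric]
          mm.add_right mm.diff_right mm.scaleR_right trace_add trace_diff trace_scaleR diff_divide_distrib)
    moreover have "?r = Re (trace (Q\<^sup>\<dagger> ** M1 ** dP)) - Re (trace (P\<^sup>\<dagger> ** M1 ** dQ)) - 2 * Re (trace (\<alpha> ** Q\<^sup>\<dagger> ** M2 ** dQ))"
      by (simp add: frob_def f_field_def g_field_def x st li M2_def[symmetric] sk au mm.minus_left mm.minus_right
          mm.add_left mm.scaleR_left trace_add trace_minus trace_scaleR matrix_mul_assoc)
    moreover have "trace (Q\<^sup>\<dagger> ** M1 ** dP) = trace (M1 ** (dP ** Q\<^sup>\<dagger>))"
      using trace_cyc[of "Q\<^sup>\<dagger>" "M1 ** dP"] by (simp add: matrix_mul_assoc)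
    moreover have "trace (P\<^sup>\<dagger> ** M1 ** dQ) = trace (M1 ** (dQ ** P\<^sup>\<dagger>))"
      using trace_cyc[of "P\<^sup>\<dagger>" "M1 ** dQ"] by (simp add: matrix_mul_assoc)
    moreover have "trace (\<alpha> ** Q\<^sup>\<dagger> ** M2 ** dQ) = trace (M2 ** (dQ ** \<alpha> ** Q\<^sup>\<dagger>))"
      using trace_cyc[of "\<alpha> ** Q\<^sup>\<dagger>" "M2 ** dQ"] by (simp add: matrix_mul_assoc)
    ultimately show ?thesis by simp
  qed
  ultimately show ?thesis by (simp add: x[symmetric] split_def)
qed

lemma flow_su2: "z \<in> uu \<Longrightarrow> D.flow z \<in> su2"
  using flow_uu[of z] by (cases z) (simp add: uu_def su_alg_iff flow_pair trace_add)

lemma dual_M_su2: "z \<in> uu \<Longrightarrow> dual_M z \<in> su2"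
  using lap_u linv_su by (cases z) (auto simp: uu_def dual_M_def)

lemma energy_diff:
  assumes z: "z \<in> su2"
  shows "f_diff (energy X \<circ> of_dual) (to_dual z) \<in> su2"
    "covec (f_diff (energy X \<circ> of_dual) (to_dual z)) = - dual_M z"
proof -
  have J: "to_dual z \<in> f_dual" by (rule to_dual_f_dual[OF z])
  have "(of_dual has_derivative of_dual) (at (to_dual z))"
    by (rule bounded_linear_imp_has_derivative[OF linear_of_dual])
  from has_derivative_compose[OF this, of dual_energy] dual_energy_has_derivative[of z]
  have "((\<lambda>J. dual_energy (of_dual J)) has_derivative (\<lambda>K. - dual_tr (dual_mul (dual_M z) (of_dual K)))) (at (to_dual z))"
    by simp
  then have "((\<lambda>J. dual_energy (of_dual J)) has_derivative (\<lambda>K. - dual_tr (dual_mul (dual_M z) (of_dual K)))) (at (to_dual z) within f_dual)"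
    by (rule has_derivative_at_withinI)
  then have D: "(energy X \<circ> of_dual has_derivative (\<lambda>K. - dual_tr (dual_mul (dual_M z) (of_dual K)))) (at (to_dual z) within f_dual)"
    using has_derivative_transform[OF J, of "energy X \<circ> of_dual" "\<lambda>J. dual_energy (of_dual J)"]
    by (simp add: energy_eq su2_uu of_dual_su2)
  show f: "f_diff (energy X \<circ> of_dual) (to_dual z) \<in> su2" by (rule f_diff_props(1)[OF J D])
  have eq: "dual_tr (dual_mul (covec (f_diff (energy X \<circ> of_dual) (to_dual z))) v) = - dual_tr (dual_mul (dual_M z) v)"
    if v: "v \<in> su2" for v
    using f_diff_props(2)[OF J D to_dual_f_dual[OF v]] f_pair_to_dual[OF f, of v] by simp
  have "covec (f_diff (energy X \<circ> of_dual) (to_dual z)) + dual_M z = 0"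
  proof (rule dual_tr_nondegenerate)
    show "covec (f_diff (energy X \<circ> of_dual) (to_dual z)) + dual_M z \<in> su2"
      by (intro subspace_add[OF subspace_su2] covec_su2 f dual_M_su2 su2_uu z)
  qed (simp add: D.mul.add_left D.tr_simps eq)
  then show "covec (f_diff (energy X \<circ> of_dual) (to_dual z)) = - dual_M z" by (simp add: eq_neg_iff_add_eq_0)
qed

theorem flow_is_lie_poisson:
  assumes z: "z \<in> su2"
  shows "flow_field X z \<in> su2"
    and "smooth_on f_dual F \<Longrightarrow> ((\<lambda>t. F (to_dual (z + t *\<^sub>R flow_field X z))) has_real_derivative
              lp_bracket F (energy X \<circ> of_dual) (to_dual z)) (at 0)"
proof -
  have ff: "flow_field X z = D.flow z" by (rule flow_field_eq[OF su2_uu[OF z]])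
  show su: "flow_field X z \<in> su2" unfolding ff by (rule flow_su2[OF su2_uu[OF z]])
  assume F: "smooth_on f_dual F"
  have J: "to_dual z \<in> f_dual" by (rule to_dual_f_dual[OF z])
  obtain F' where F': "(F has_derivative F') (at (to_dual z) within f_dual)"
    using smooth_on_has_derivative[OF F J] by blast
  interpret T: bounded_linear to_dual by (rule linear_to_dual)
  have K: "to_dual (D.flow z) \<in> f_dual" using su unfolding ff by (rule to_dual_f_dual)
  have "((\<lambda>t. F (to_dual z + t *\<^sub>R to_dual (D.flow z))) has_derivative (\<lambda>t. F' (t *\<^sub>R to_dual (D.flow z)))) (at 0)"
    by (rule has_derivative_line[OF F']) (intro subspace_add[OF subspace_f_dual] subspace_scale[OF subspace_f_dual] J K)
  moreover have "F' (t *\<^sub>R k) = F' k * t" for t k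
    using linear_cmul[OF has_derivative_linear[OF F']] by simp
  ultimately have d: "((\<lambda>t. F (to_dual (z + t *\<^sub>R flow_field X z))) has_real_derivative F' (to_dual (D.flow z))) (at 0)"
    by (simp add: has_field_derivative_def T.add T.scaleR ff)
  let ?p = "covec (f_diff F (to_dual z))"
  note f = f_diff_props[OF J F']
  have "F' (to_dual (D.flow z)) = dual_tr (dual_mul ?p (D.flow z))"
    using f(2)[OF K] f_pair_to_dual[OF f(1)] by simp
  also have "\<dots> = dual_tr (dual_mul z (dual_comm ?p (- dual_M z)))"
    using D.tr_commute[of "dual_mul z (dual_M z)" ?p] D.tr_commute[of "dual_mul ?p (dual_M z)" z]
    by (simp add: D.flow_def D.mul_ring D.tr_simps)
  also have "\<dots> = lp_bracket F (energy X \<circ> of_dual) (to_dual z)"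
    unfolding lp_bracket_eq[OF f(1) energy_diff(1)[OF z]] energy_diff(2)[OF z] ..
  finally show "((\<lambda>t. F (to_dual (z + t *\<^sub>R flow_field X z))) has_real_derivative
              lp_bracket F (energy X \<circ> of_dual) (to_dual z)) (at 0)" using d by simp
qed

end

context spin_rep
begin

section \<open>The Poisson property of the midpoint step\<close>

text \<open>With this symmetry the linearised equation at a skew-Hermitian point respects \<open>star\<close>, and its
  inverse preserves \<open>uu\<close>.\<close>

lemma star_dual_M_commutes: "star (dual_M v) = dual_M (star v)"
proof -
  have sp: "skew_part (A\<^sup>\<dagger>) = - skew_part A" for A :: "'n cmat"
    by (simp add: skew_part_def flip: scaleR_minus_right)
  have "linv (A\<^sup>\<dagger>) = - linv A" for A
    using linear_neg[OF linv_linear, of "skew_part A"] skew_part_id[OF skew_part_u[of A]]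
      skew_part_id[OF skew_part_u[of "A\<^sup>\<dagger>"]]
    by (metis linv_def sp linear_neg[OF linear_skew_part])
  moreover have "(linv A)\<^sup>\<dagger> = - linv A" for A using linv_u[of A] by (simp add: u_alg_def)
  ultimately show ?thesis by (simp add: star_def dual_M_def lap_dagger)
qed

lemma star_start_diff:
  assumes y: "y \<in> uu" shows "star (D.start_diff h y v) = D.start_diff h y (star v)"
proof -
  have m: "star (D.mid h v) = D.mid h (star v)" by (simp add: D.mid_def star_dual_M_commutes)
  show ?thesis
    using y unfolding D.start_diff_def
    by (simp add: star_mid uu_iff[THEN iffD1] m D.mul_ring algebra_simps)
qed

text \<open>With \<open>y = S z\<close>, the chain rule shows that the gradient at \<open>z\<close> of \<open>F\<close> composed with the step is
  the pull-back of the gradient of \<open>F\<close> under \<open>end_diff \<circ> (start_diff)\<^sup>-\<^sup>1\<close>, tested on trace-free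
  directions.  After extension to \<open>uu\<close> the hypothesis of the algebraic identity holds for all
  variations of \<open>y\<close>.\<close>

theorem midpoint_poisson:
  assumes sol: "implicit_solution dual_mul dual_one dual_tr dual_M h U S"
    and open_D: "openin (top_of_set su2) A" and AU: "A \<subseteq> U" and Su: "\<And>z. z \<in> A \<Longrightarrow> S z \<in> uu"
    and \<phi>: "\<And>z. z \<in> A \<Longrightarrow> \<phi> z = D.end_pt h (S z)"
    and F: "smooth_on f_dual F" and G: "smooth_on f_dual G" and z: "z \<in> A"
  shows "lp_bracket (F \<circ> (to_dual \<circ> \<phi> \<circ> of_dual)) (G \<circ> (to_dual \<circ> \<phi> \<circ> of_dual)) (to_dual z)
    = lp_bracket F G (to_dual (\<phi> z))"
proof -
  interpret I: implicit_solution dual_mul dual_one dual_tr dual_M h U S by (rule sol)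
  have Asu: "A \<subseteq> su2" using open_D openin_imp_subset by blast
  define \<psi> where "\<psi> = to_dual \<circ> \<phi> \<circ> of_dual"
  define y where "y = S z"
  have yu: "y \<in> uu" unfolding y_def by (rule Su[OF z])
  have zU: "z \<in> U" and zsu: "z \<in> su2" using z AU Asu by auto
  have start: "D.start_pt h y = z" unfolding y_def by (rule I.S_solves[OF zU])
  have \<phi>su: "\<phi> x \<in> su2" if "x \<in> A" for x
  proof -
    have "\<phi> x = x + h *\<^sub>R D.flow (S x)"
      using I.S_solves[of x] that AU by (auto simp: \<phi> D.end_start D.flow_def)
    then show ?thesis
      using that Asu flow_su2[OF Su[OF that]]
      by (auto intro!: subspace_add[OF subspace_su2] subspace_scale[OF subspace_su2] simp del: mem_Times_iff)
  qed
  have J: "to_dual z \<in> f_dual" by (rule to_dual_f_dual[OF zsu])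
  have J': "to_dual (\<phi> z) \<in> f_dual" by (rule to_dual_f_dual[OF \<phi>su[OF z]])
  define dphi where "dphi v = D.end_diff h y (I.Inv z v)" for v
  have dphi: "((\<lambda>z. D.end_pt h (S z)) has_derivative dphi) (at z)"
    unfolding dphi_def[abs_def] y_def by (rule I.end_S_has_derivative[OF zU])
  have dphi_lin: "linear dphi" by (rule has_derivative_linear[OF dphi])
  \<comment> \<open>variations of the intermediate point are skew-Hermitian, but possibly not trace free\<close>
  have Inv_uu: "I.Inv z v \<in> uu" if "v \<in> uu" for v
  proof -
    have "D.start_diff h y (star (I.Inv z v)) = - v"
      using star_start_diff[OF yu, of h "I.Inv z v"] that by (simp add: y_def I.Inv_props(1)[OF zU] uu_iff)
    then have "star (I.Inv z v) = I.Inv z (- v)" using I.Inv_props(2)[OF zU] unfolding y_def by metis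
    then show ?thesis by (simp add: uu_iff linear_neg[OF I.Inv_props(3)[OF zU]])
  qed
  \<comment> \<open>the step differs from the identity by a commutator, so its derivative preserves trace zero\<close>
  have dphi_su: "dphi v \<in> su2" if v: "v \<in> su2" for v
  proof -
    let ?w = "I.Inv z v"
    have w: "?w \<in> uu" by (rule Inv_uu[OF su2_uu[OF v]])
    have "dphi v = v + h *\<^sub>R (dual_mul ?w (dual_M y) - dual_mul (dual_M y) ?w + (dual_mul y (dual_M ?w) - dual_mul (dual_M ?w) y))"
      by (simp add: dphi_def D.end_start_diff y_def I.Inv_props(1)[OF zU])
    also have "dual_mul ?w (dual_M y) - dual_mul (dual_M y) ?w + (dual_mul y (dual_M ?w) - dual_mul (dual_M ?w) y)
       = D.flow (y + ?w) - D.flow y - D.flow ?w"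
      by (simp add: D.flow_def linear_add[OF D.M_linear] D.mul_ring)
    finally show ?thesis
      using v flow_su2[OF yu] flow_su2[OF w] flow_su2[OF subspace_add[OF subspace_uu yu w]]
      by (simp only: subspace_add[OF subspace_su2] subspace_diff[OF subspace_su2] subspace_scale[OF subspace_su2])
  qed
  obtain O' where O': "open O'" "A = su2 \<inter> O'" using open_D unfolding openin_open by blast
  define q where "q F = covec (f_diff (F \<circ> \<psi>) (to_dual z))" for F
  define p where "p F = covec (f_diff F (to_dual (\<phi> z)))" for F
  have cov: "f_diff (F \<circ> \<psi>) (to_dual z) \<in> su2 \<and> f_diff F (to_dual (\<phi> z)) \<in> su2 \<and>
     (\<forall>v\<in>su2. dual_tr (dual_mul (p F) (dphi v)) = dual_tr (dual_mul (q F) v))"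
    if F: "smooth_on f_dual F" for F
  proof -
    obtain F' where F': "(F has_derivative F') (at (to_dual (\<phi> z)) within f_dual)"
      using smooth_on_has_derivative[OF F J'] by blast
    define \<psi>' where "\<psi>' = (\<lambda>J. to_dual (D.end_pt h (S (of_dual J))))"
    have agree: "\<psi> K = \<psi>' K" "\<psi> K \<in> f_dual" if K: "K \<in> to_dual ` A" for K
    proof -
      obtain x where x: "x \<in> A" "K = to_dual x" using K by blast
      then have "\<psi> K = to_dual (\<phi> x)" by (simp add: \<psi>_def)
      then show "\<psi> K = \<psi>' K" "\<psi> K \<in> f_dual"
        using to_dual_f_dual[OF \<phi>su[OF x(1)]] x \<phi>[OF x(1)] by (simp_all add: \<psi>'_def)
    qed
    have "(of_dual has_derivative of_dual) (at (to_dual z))"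
      by (rule bounded_linear_imp_has_derivative[OF linear_of_dual])
    then have "((\<lambda>J. D.end_pt h (S (of_dual J))) has_derivative (\<lambda>K. dphi (of_dual K))) (at (to_dual z))"
      using has_derivative_compose[of of_dual of_dual "to_dual z" UNIV "\<lambda>z. D.end_pt h (S z)" dphi] dphi by simp
    then have "(\<psi>' has_derivative (\<lambda>K. to_dual (dphi (of_dual K)))) (at (to_dual z))"
      unfolding \<psi>'_def by (rule bounded_linear.has_derivative[OF linear_to_dual])
    then have 1: "(\<psi>' has_derivative (\<lambda>K. to_dual (dphi (of_dual K)))) (at (to_dual z) within to_dual ` A)"
      by (rule has_derivative_at_withinI)
    have "(F has_derivative F') (at (\<psi>' (to_dual z)) within \<psi>' ` to_dual ` A)"
    proof -
      have "\<psi>' ` to_dual ` A \<subseteq> f_dual"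
      proof (rule image_subsetI)
        fix K assume "K \<in> to_dual ` A"
        from agree[OF this] show "\<psi>' K \<in> f_dual" by simp
      qed
      moreover have "\<psi>' (to_dual z) = to_dual (\<phi> z)" by (simp add: \<psi>'_def \<phi>[OF z])
      ultimately show ?thesis using has_derivative_subset[OF F', of "\<psi>' ` to_dual ` A"] by simp
    qed
    from has_derivative_in_compose[OF 1 this]
    have "((\<lambda>J. F (\<psi>' J)) has_derivative (\<lambda>K. F' (to_dual (dphi (of_dual K))))) (at (to_dual z) within to_dual ` A)" .
    then have "(F \<circ> \<psi> has_derivative (\<lambda>K. F' (to_dual (dphi (of_dual K))))) (at (to_dual z) within to_dual ` A)"
      using has_derivative_transform[of "to_dual z" "to_dual ` A" "F \<circ> \<psi>" "\<lambda>J. F (\<psi>' J)"] z agree(1)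
      by (simp del: image_iff)
    moreover have "at (to_dual z) within to_dual ` A = at (to_dual z) within f_dual"
    proof (rule at_within_nhd)
      show "to_dual z \<in> of_dual -` O'" using z O' by simp
      show "open (of_dual -` O')"
        by (rule open_vimage[OF O'(1) linear_continuous_on[OF linear_of_dual]])
      show "to_dual ` A \<inter> of_dual -` O' - {to_dual z} = f_dual \<inter> of_dual -` O' - {to_dual z}"
      proof -
        have "K \<in> to_dual ` A \<longleftrightarrow> K \<in> f_dual" if "of_dual K \<in> O'" for K
        proof
          show "K \<in> f_dual" if "K \<in> to_dual ` A" using that Asu to_dual_f_dual by auto
          show "K \<in> to_dual ` A" if "K \<in> f_dual"
            using of_dual_su2[OF that] \<open>of_dual K \<in> O'\<close> O'(2) by (intro image_eqI[of _ _ "of_dual K"]) auto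
        qed
        then show ?thesis by blast
      qed
    qed
    ultimately have D: "(F \<circ> \<psi> has_derivative (\<lambda>K. F' (to_dual (dphi (of_dual K))))) (at (to_dual z) within f_dual)"
      by simp
    note f = f_diff_props[OF J D] and g = f_diff_props[OF J' F']
    show ?thesis
    proof (intro conjI f(1) g(1) ballI)
      fix v :: "'n cmat \<times> 'n cmat" assume v: "v \<in> su2"
      have "f_pair (to_dual (dphi v)) (f_diff F (to_dual (\<phi> z))) = f_pair (to_dual v) (f_diff (F \<circ> \<psi>) (to_dual z))"
        using f(2)[OF to_dual_f_dual[OF v]] g(2)[OF to_dual_f_dual[OF dphi_su[OF v]]] by simp
      then show "dual_tr (dual_mul (p F) (dphi v)) = dual_tr (dual_mul (q F) v)"
        by (simp only: p_def q_def f_pair_to_dual[OF f(1)] f_pair_to_dual[OF g(1)])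
    qed
  qed
  have ext: "\<exists>c d. \<forall>v\<in>uu. dual_tr (dual_mul (q F + dual_centre c d) (D.start_diff h y v))
      = dual_tr (dual_mul (p F) (D.end_diff h y v))"
    if F: "smooth_on f_dual F" for F
  proof -
    note c = cov[OF F]
    have lin: "linear (\<lambda>v. dual_tr (dual_mul (p F) (dphi v)))"
      by (rule linearI) (simp_all add: linear_add[OF dphi_lin] linear_cmul[OF dphi_lin] D.mul_ring D.tr_simps)
    have "\<And>v. v \<in> su2 \<Longrightarrow> dual_tr (dual_mul (p F) (dphi v)) = dual_tr (dual_mul (q F) v)"
      using c by blast
    from covector_extension[OF lin covec_su2[OF conjunct1[OF c], folded q_def] this]
    obtain c d where cd: "\<forall>v\<in>uu. dual_tr (dual_mul (p F) (dphi v))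
        = dual_tr (dual_mul (q F + dual_centre c d) v)" by blast
    have "dual_tr (dual_mul (q F + dual_centre c d) (D.start_diff h y v))
      = dual_tr (dual_mul (p F) (D.end_diff h y v))" if v: "v \<in> uu" for v
    proof -
      have "dphi (D.start_diff h y v) = D.end_diff h y v"
        using I.Inv_props(2)[OF zU] by (simp add: dphi_def y_def)
      then show ?thesis using cd[rule_format, OF start_diff_uu[OF yu v, of h]] by simp
    qed
    then show ?thesis by blast
  qed
  obtain c d where cd: "\<forall>v\<in>uu. dual_tr (dual_mul (q F + dual_centre c d) (D.start_diff h y v)) = dual_tr (dual_mul (p F) (D.end_diff h y v))"
    using ext[OF F] by blast
  obtain c' d' where cd': "\<forall>v\<in>uu. dual_tr (dual_mul (q G + dual_centre c' d') (D.start_diff h y v)) = dual_tr (dual_mul (p G) (D.end_diff h y v))"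
    using ext[OF G] by blast
  note cF = cov[OF F] and cG = cov[OF G]
  have q_uu: "q F + dual_centre c d \<in> uu" "q G + dual_centre c' d' \<in> uu" "p F \<in> uu" "p G \<in> uu"
    unfolding p_def q_def
    by (intro subspace_add[OF subspace_uu] su2_uu[OF covec_su2] dual_centre_uu conjunct1[OF cF] conjunct1[OF cG]
        conjunct1[OF conjunct2[OF cF]] conjunct1[OF conjunct2[OF cG]])+
  have "dual_tr (dual_mul (D.start_pt h y) (dual_comm (q F + dual_centre c d) (q G + dual_centre c' d')))
      = dual_tr (dual_mul (D.end_pt h y) (dual_comm (p F) (p G)))"
    by (rule D.end_start_poisson[where V = uu])
       (use cd cd' in \<open>auto intro!: subspace_add[OF subspace_uu] mid_covector_uu yu q_uu\<close>)
  then have "dual_tr (dual_mul z (dual_comm (q F) (q G))) = dual_tr (dual_mul (\<phi> z) (dual_comm (p F) (p G)))"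
    using start \<phi>[OF z] by (simp only: dual_comm_centre y_def)
  then show ?thesis
    unfolding \<psi>_def[symmetric]
      lp_bracket_eq[OF conjunct1[OF conjunct2[OF cF]] conjunct1[OF conjunct2[OF cG]]]
      lp_bracket_eq[OF conjunct1[OF cF] conjunct1[OF cG]] p_def q_def .
qed

end

section \<open>Casimirs\<close>

text \<open>A kernel vector \<open>x\<close> of \<open>1 + m\<close> would satisfy \<open>m x = - x\<close>, but the real part of \<open>\<langle>x, m x\<rangle>\<close>
  vanishes for skew-Hermitian \<open>m\<close>.\<close>

lemma skew_cayley_invertible:
  fixes m :: "('n::finite) cmat"
  assumes m: "m\<^sup>\<dagger> = - m"
  shows "\<exists>R. R ** (mat 1 + m) = mat 1 \<and> (mat 1 + m) ** R = mat 1"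
proof -
  have "x = 0" if x: "(mat 1 + m) *v x = 0" for x
  proof -
    have "x + m *v x = 0" using x by (simp add: matrix_vector_mult_add_rdistrib)
    then have mx: "m *v x = - x" by (simp add: eq_neg_iff_add_eq_0 add.commute)
    have "cdot x (m *v x) = cdot (- (m *v x)) x"
      using cdot_dagger[of x m x] unfolding m by (simp add: matrix_vector_mult_def cdot_def sum_negf vec_eq_iff)
    then have "- (norm x)\<^sup>2 = (norm x)\<^sup>2"
      unfolding mx by (metis Re_cdot dot_square_norm inner_minus_right minus_minus)
    then show ?thesis by simp
  qed
  then obtain R where "R ** (mat 1 + m) = mat 1"
    using matrix_left_invertible_ker[of "mat 1 + m"] by blast
  then show ?thesis using matrix_left_right_inverse by blast
qed

text \<open>With \<open>A = 1 + m\<close> and \<open>B = 1 - m = A\<^sup>\<dagger>\<close>, which commute, \<open>C = B A\<^sup>-\<^sup>1\<close> is unitary and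
  conjugates \<open>A T B\<close> to \<open>B T A\<close>.  The second identity is the first one to first order in \<open>\<epsilon>\<close>: the
  difference \<open>V - C\<^sup>\<dagger> V' C\<close> is twice a commutator of \<open>\<Theta> = A T B\<close> with \<open>Y = B\<^sup>-\<^sup>1 k A\<^sup>-\<^sup>1\<close>.\<close>

lemma isospectral_casimirs:
  fixes T W m k :: "('n::finite) cmat"
  assumes m: "m\<^sup>\<dagger> = - m" and T: "T\<^sup>\<dagger> = - T"
  defines "A \<equiv> mat 1 + m" and "B \<equiv> mat 1 - m"
  shows "trace (fun_calc f (A ** T ** B)) = trace (fun_calc f (B ** T ** A))"
    and "trace (((k ** T + A ** W) ** B - A ** T ** k) ** fun_calc g (A ** T ** B))
      = trace (((B ** W - k ** T) ** A + B ** T ** k) ** fun_calc g (B ** T ** A))"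
proof -
  obtain R where R: "R ** A = mat 1" "A ** R = mat 1"
    using skew_cayley_invertible[OF m] by (auto simp: A_def)
  define S where "S = R\<^sup>\<dagger>"
  have AB: "A\<^sup>\<dagger> = B" "B\<^sup>\<dagger> = A" by (simp_all add: A_def B_def m)
  have S: "B ** S = mat 1" "S ** B = mat 1"
    using arg_cong[OF R(1), of dagger] arg_cong[OF R(2), of dagger] by (simp_all add: AB S_def)
  have comm: "B ** A = A ** B" by (simp add: A_def B_def mat_ring)
  have SA: "S ** A = A ** S"
  proof -
    have "S ** (A ** B) ** S = A ** S" unfolding comm[symmetric] by (simp add: matrix_mul_assoc S)
    moreover have "S ** (A ** B) ** S = S ** A ** (B ** S)" by (simp only: matrix_mul_assoc)
    ultimately show ?thesis by (simp add: S)
  qed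
  have BR: "R ** B = B ** R"
  proof -
    have "R ** (B ** A) ** R = B ** R" unfolding comm by (simp add: matrix_mul_assoc R)
    moreover have "R ** (B ** A) ** R = R ** B ** (A ** R)" by (simp only: matrix_mul_assoc)
    ultimately show ?thesis by (simp add: R)
  qed
  define C where "C = B ** R"
  have Cd: "C\<^sup>\<dagger> = A ** S" by (simp add: C_def AB S_def[symmetric] SA)
  have canc: "Z ** A ** R = Z" "Z ** R ** A = Z" "Z ** B ** S = Z" "Z ** S ** B = Z" for Z
    by (simp_all add: R S flip: matrix_mul_assoc)
  have CC: "C ** C\<^sup>\<dagger> = mat 1" unfolding Cd unfolding C_def by (simp add: matrix_mul_assoc canc S)
  then have C: "unitary C" by (simp add: unitary_def matrix_left_right_inverse)
  define \<Theta> where "\<Theta> = A ** T ** B"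
  have \<Theta>: "\<Theta>\<^sup>\<dagger> = - \<Theta>" by (simp add: \<Theta>_def AB T mat_ring)
  have conj: "B ** T ** A = C ** \<Theta> ** C\<^sup>\<dagger>"
    unfolding Cd SA[symmetric] unfolding C_def \<Theta>_def by (simp add: matrix_mul_assoc canc)
  have fc: "fun_calc u (B ** T ** A) = C ** fun_calc u \<Theta> ** C\<^sup>\<dagger>" for u
    unfolding conj by (rule fun_calc_conj[OF \<Theta> C])
  have C2: "C\<^sup>\<dagger> ** C = mat 1" using C by (simp add: unitary_def)
  show "trace (fun_calc f (A ** T ** B)) = trace (fun_calc f (B ** T ** A))"
  proof -
    have "trace (C ** fun_calc f \<Theta> ** C\<^sup>\<dagger>) = trace (C\<^sup>\<dagger> ** C ** fun_calc f \<Theta>)"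
      using trace_cyc[of "C ** fun_calc f \<Theta>" "C\<^sup>\<dagger>"] by (simp add: matrix_mul_assoc)
    then show ?thesis by (simp add: fc C2 \<Theta>_def[symmetric])
  qed
  define V where "V = (k ** T + A ** W) ** B - A ** T ** k"
  define V' where "V' = (B ** W - k ** T) ** A + B ** T ** k"
  define Y where "Y = S ** k ** R"
  define E where "E = fun_calc g \<Theta>"
  \<comment> \<open>this combines the pairs of terms in \<open>V - C\<^sup>\<dagger> V' C\<close> that differ by a factor \<open>S A\<close> or \<open>B R\<close>\<close>
  have AB2: "A + B = 2 *\<^sub>R mat 1" by (simp add: A_def B_def scaleR_2)
  have eV': "C\<^sup>\<dagger> ** V' ** C = A ** W ** B - S ** A ** k ** T ** B + A ** T ** k ** B ** R"
  proof -
    have 1: "A ** S ** B ** Z = A ** Z" for Z by (simp add: canc)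
    have 2: "Z ** A ** B ** R = Z ** B" for Z
      using canc(1)[of "Z ** B"] comm by (metis matrix_mul_assoc)
    show ?thesis unfolding Cd unfolding C_def V'_def
      by (simp add: mat_ring 1 2 SA)
  qed
  have "V - C\<^sup>\<dagger> ** V' ** C = S ** (A + B) ** k ** T ** B - A ** T ** k ** (A + B) ** R"
    unfolding eV' V_def by (simp add: mat_ring S canc)
  also have "\<dots> = 2 *\<^sub>R (S ** k ** T ** B - A ** T ** k ** R)"
    unfolding AB2 by (simp add: mat_ring scaleR_diff_right)
  also have "S ** k ** T ** B = Y ** \<Theta>" by (simp add: Y_def \<Theta>_def matrix_mul_assoc canc)
  also have "A ** T ** k ** R = \<Theta> ** Y" by (simp add: Y_def \<Theta>_def matrix_mul_assoc canc)
  finally have VV: "V = C\<^sup>\<dagger> ** V' ** C + 2 *\<^sub>R (Y ** \<Theta> - \<Theta> ** Y)" by (simp add: algebra_simps)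
  have E: "E ** \<Theta> = \<Theta> ** E" unfolding E_def by (rule fun_calc_commute[OF \<Theta>])
  have "trace (\<Theta> ** Y ** E) = trace (Y ** \<Theta> ** E)"
    using trace_cyc[of \<Theta> "Y ** E"] by (simp add: E flip: matrix_mul_assoc)
  then have "trace (V ** E) = trace (C\<^sup>\<dagger> ** V' ** C ** E)"
    unfolding VV by (simp add: mm.add_left mm.scaleR_left mm.diff_left trace_add trace_scaleR trace_diff)
  also have "\<dots> = trace (V' ** (C ** E ** C\<^sup>\<dagger>))"
    using trace_cyc[of "C\<^sup>\<dagger>" "V' ** C ** E"] by (simp add: matrix_mul_assoc)
  finally show "trace (((k ** T + A ** W) ** B - A ** T ** k) ** fun_calc g (A ** T ** B))
      = trace (((B ** W - k ** T) ** A + B ** T ** k) ** fun_calc g (B ** T ** A))"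
    by (simp only: fc E_def V_def V'_def \<Theta>_def)
qed

context spin_rep
begin

lemma start_pt_pair:
  "D.start_pt h (W, T) = ((((h / 2) *\<^sub>R lap X T) ** T + (mat 1 + (h / 2) *\<^sub>R linv W) ** W) ** (mat 1 - (h / 2) *\<^sub>R linv W)
      - (mat 1 + (h / 2) *\<^sub>R linv W) ** T ** ((h / 2) *\<^sub>R lap X T),
    (mat 1 + (h / 2) *\<^sub>R linv W) ** T ** (mat 1 - (h / 2) *\<^sub>R linv W))"
  unfolding D.start_pt_def mid_pair
  unfolding dual_one_def dual_mul_def by (simp add: mm.minus_right)

lemma end_pt_pair:
  "D.end_pt h (W, T) = (((mat 1 - (h / 2) *\<^sub>R linv W) ** W - ((h / 2) *\<^sub>R lap X T) ** T) ** (mat 1 + (h / 2) *\<^sub>R linv W)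
      + (mat 1 - (h / 2) *\<^sub>R linv W) ** T ** ((h / 2) *\<^sub>R lap X T),
    (mat 1 - (h / 2) *\<^sub>R linv W) ** T ** (mat 1 + (h / 2) *\<^sub>R linv W))"
  by (simp add: D.end_pt_eq start_pt_pair mm.minus_left mm.minus_right)

theorem midpoint_casimirs:
  assumes y: "y \<in> uu"
  shows "trace (fun_calc f (snd (D.start_pt h y))) = trace (fun_calc f (snd (D.end_pt h y)))"
    and "trace (fst (D.start_pt h y) ** fun_calc g (snd (D.start_pt h y)))
       = trace (fst (D.end_pt h y) ** fun_calc g (snd (D.end_pt h y)))"
proof -
  obtain W T where WT: "y = (W, T)" by (cases y)
  have T: "T\<^sup>\<dagger> = - T" using y by (simp add: WT uu_def u_alg_def)
  have m: "((h / 2) *\<^sub>R linv W)\<^sup>\<dagger> = - ((h / 2) *\<^sub>R linv W)" using linv_u[of W] by (simp add: u_alg_def)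
  show "trace (fun_calc f (snd (D.start_pt h y))) = trace (fun_calc f (snd (D.end_pt h y)))"
    unfolding WT start_pt_pair end_pt_pair snd_conv by (rule isospectral_casimirs(1)[OF m T])
  show "trace (fst (D.start_pt h y) ** fun_calc g (snd (D.start_pt h y)))
       = trace (fst (D.end_pt h y) ** fun_calc g (snd (D.end_pt h y)))"
    unfolding WT start_pt_pair end_pt_pair snd_conv fst_conv by (rule isospectral_casimirs(2)[OF m T])
qed

text \<open>The canonical vector field, with the globally defined inverse Laplacian.\<close>

definition canonical_field :: "'n cmat \<Rightarrow> 'n cmat \<times> 'n cmat \<Rightarrow> 'n cmat \<times> 'n cmat"
  where "canonical_field \<alpha> x = (- (linv (fst (state_of \<alpha> x)) ** fst x),
     (linv (fst (state_of \<alpha> x)))\<^sup>\<dagger> ** snd x + 2 *\<^sub>R ((lap X (snd (state_of \<alpha> x)))\<^sup>\<dagger> ** fst x ** \<alpha>\<^sup>\<dagger>))"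

lemma canonical_field_eq:
  "\<alpha> \<in> u_alg \<Longrightarrow> (f_field X \<alpha> x, g_field X \<alpha> x) = canonical_field \<alpha> x"
  using state_of_uu[of \<alpha> x]
  by (cases x; cases "state_of \<alpha> x") (simp add: f_field_def g_field_def canonical_field_def uu_def linv_eq)

text \<open>This is the descent: the explicit half step backwards in \<open>(Q, P)\<close> multiplies \<open>Q\<close> by \<open>1 + m\<^sub>1\<close>, and
  conjugation by this factor is what the starting point of the reduced method consists of.\<close>

lemma state_of_start:
  assumes \<alpha>: "\<alpha> \<in> u_alg"
  shows "state_of \<alpha> (x - (h / 2) *\<^sub>R canonical_field \<alpha> x) = D.start_pt h (state_of \<alpha> x)"
proof -
  obtain Q P where x: "x = (Q, P)" by (cases x)
  obtain W T where WT: "state_of \<alpha> x = (W, T)" by (cases "state_of \<alpha> x")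
  have W: "W = (1 / 2) *\<^sub>R (Q ** P\<^sup>\<dagger> - P ** Q\<^sup>\<dagger>)" and T: "T = Q ** \<alpha> ** Q\<^sup>\<dagger>"
    using WT by (auto simp: x state_of_def)
  have a: "\<alpha>\<^sup>\<dagger> = - \<alpha>" using \<alpha> by (simp add: u_alg_def)
  have WTu: "W \<in> u_alg" "T \<in> u_alg" using state_of_uu[OF \<alpha>, of x] WT by (auto simp: uu_def)
  define m where "m = (h / 2) *\<^sub>R linv W"
  define k where "k = (h / 2) *\<^sub>R lap X T"
  have m: "m\<^sup>\<dagger> = - m" using linv_u[of W] by (simp add: m_def u_alg_def)
  have k: "k\<^sup>\<dagger> = - k" using lap_u[OF WTu(2)] by (simp add: k_def su_alg_def)
  have "x - (h / 2) *\<^sub>R canonical_field \<alpha> x = (Q + m ** Q, P - (m\<^sup>\<dagger> ** P + 2 *\<^sub>R (k\<^sup>\<dagger> ** Q ** \<alpha>\<^sup>\<dagger>)))"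
    by (simp add: canonical_field_def WT) (simp add: x m_def k_def mat_ring scaleR_add_right)
  also have "\<dots> = (Q + m ** Q, P + m ** P - 2 *\<^sub>R (k ** Q ** \<alpha>))"
    by (simp add: m k a mat_ring)
  finally have 1: "x - (h / 2) *\<^sub>R canonical_field \<alpha> x = (Q + m ** Q, P + m ** P - 2 *\<^sub>R (k ** Q ** \<alpha>))" .
  have T1: "(Q + m ** Q) ** \<alpha> ** (Q + m ** Q)\<^sup>\<dagger> = (mat 1 + m) ** T ** (mat 1 - m)"
    by (simp add: T m mat_ring)
  define Z where "Z = (Q + m ** Q) ** (P + m ** P - 2 *\<^sub>R (k ** Q ** \<alpha>))\<^sup>\<dagger>"
  have Z: "Z = (mat 1 + m) ** (Q ** P\<^sup>\<dagger>) ** (mat 1 - m) - 2 *\<^sub>R ((mat 1 + m) ** T ** k)"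
    by (simp add: Z_def T m k a mat_ring scaleR_add_right scaleR_diff_right)
  have Zd: "(P + m ** P - 2 *\<^sub>R (k ** Q ** \<alpha>)) ** (Q + m ** Q)\<^sup>\<dagger> = Z\<^sup>\<dagger>"
    by (simp add: Z_def)
  have Zd': "Z\<^sup>\<dagger> = (mat 1 + m) ** (P ** Q\<^sup>\<dagger>) ** (mat 1 - m) - 2 *\<^sub>R (k ** T ** (mat 1 - m))"
    unfolding Z using WTu(2) by (simp add: m k u_alg_def mat_ring scaleR_add_right scaleR_diff_right)
  have W1: "(1 / 2) *\<^sub>R (Z - Z\<^sup>\<dagger>) = (k ** T + (mat 1 + m) ** W) ** (mat 1 - m) - (mat 1 + m) ** T ** k"
  proof -
    have "Z - Z\<^sup>\<dagger> = 2 *\<^sub>R ((mat 1 + m) ** W ** (mat 1 - m) + k ** T ** (mat 1 - m) - (mat 1 + m) ** T ** k)"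
      unfolding Zd' unfolding Z W by (simp add: mat_ring scaleR_add_right scaleR_diff_right)
    then show ?thesis by (simp add: mm.add_left)
  qed
  have "state_of \<alpha> (Q + m ** Q, P + m ** P - 2 *\<^sub>R (k ** Q ** \<alpha>))
      = ((1 / 2) *\<^sub>R (Z - Z\<^sup>\<dagger>), (Q + m ** Q) ** \<alpha> ** (Q + m ** Q)\<^sup>\<dagger>)"
    unfolding state_of_def prod.case Z_def[symmetric] Zd ..
  then show ?thesis
    unfolding 1 WT start_pt_pair m_def[symmetric] k_def[symmetric] W1 T1 .
qed

lemma state_of_end:
  assumes \<alpha>: "\<alpha> \<in> u_alg"
  shows "state_of \<alpha> (x + (h / 2) *\<^sub>R canonical_field \<alpha> x) = D.end_pt h (state_of \<alpha> x)"
proof -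
  have "x + (h / 2) *\<^sub>R canonical_field \<alpha> x = x - (- h / 2) *\<^sub>R canonical_field \<alpha> x" by simp
  then show ?thesis unfolding D.end_pt_eq using state_of_start[OF \<alpha>, of x "- h"] by (simp only:)
qed

end

section \<open>Descent and the integrator\<close>

lemma state_of_lipschitz:
  assumes a: "lipschitz_bdd a" and Q: "lipschitz_bdd Q" and P: "lipschitz_bdd P"
  shows "lipschitz_bdd (\<lambda>q. state_of (a q) (Q q, P q))"
proof -
  note mul = lipschitz_bdd_bilinear[OF bilinear_matrix_mult]
  note dag = lipschitz_bdd_compose[OF lipschitz_bdd_linear[OF linear_dagger]]
  show ?thesis unfolding state_of_def prod.case
    by (rule lipschitz_bdd_Pair[OF lipschitz_bdd_bilinear[OF bounded_bilinear_scaleR lipschitz_bdd_const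
      lipschitz_bdd_diff[OF mul[OF Q dag[OF P]] mul[OF P dag[OF Q]]]] mul[OF mul[OF Q a] dag[OF Q]]])
qed

context spin_rep
begin

lemma canonical_field_lipschitz:
  assumes a: "lipschitz_bdd a" and Q: "lipschitz_bdd Q" and P: "lipschitz_bdd P"
  shows "lipschitz_bdd (\<lambda>q. (1 / 2) *\<^sub>R canonical_field (a q) (Q q, P q))"
proof -
  note mul = lipschitz_bdd_bilinear[OF bilinear_matrix_mult]
  note lin = lipschitz_bdd_compose[OF lipschitz_bdd_linear]
  note dag = lin[OF linear_dagger]
  note st = state_of_lipschitz[OF a Q P]
  have bl: "bounded_linear linv" "bounded_linear (lap X)"
    using linv_linear lap_linear by (simp_all add: linear_conv_bounded_linear)
  note L = lin[OF bl(1) lin[OF bounded_linear_fst st]]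
  note K = lin[OF bl(2) lin[OF bounded_linear_snd st]]
  note sc = lipschitz_bdd_bilinear[OF bounded_bilinear_scaleR lipschitz_bdd_const]
  show ?thesis unfolding canonical_field_def fst_conv snd_conv
    by (rule sc[OF lipschitz_bdd_Pair[OF lin[OF bounded_linear_minus[OF bounded_linear_ident] mul[OF L Q]]
      lipschitz_bdd_add[OF mul[OF dag[OF L] P] sc[OF mul[OF mul[OF dag[OF K] Q] dag[OF a]]]]]])
qed

lemma canonical_eqs_iff:
  assumes "\<alpha> \<in> u_alg"
  shows "canonical_eqs X h \<alpha> x xt \<longleftrightarrow> xt = x + h *\<^sub>R ((1 / 2) *\<^sub>R canonical_field \<alpha> xt)"
proof -
  obtain Q P where x: "x = (Q, P)" by (cases x)
  obtain Qt Pt where xt: "xt = (Qt, Pt)" by (cases xt)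
  show ?thesis
    unfolding canonical_field_eq[OF assms, symmetric] canonical_eqs_def x xt by (auto simp: algebra_simps)
qed

lemma canonical_step_eq:
  assumes \<alpha>: "\<alpha> \<in> u_alg" and s: "solution_near d (canonical_eqs X h \<alpha>) x = xt"
  shows "canonical_step X d h \<alpha> x = xt + (h / 2) *\<^sub>R canonical_field \<alpha> xt"
proof -
  obtain Qt Pt where xt: "xt = (Qt, Pt)" by (cases xt)
  show ?thesis
    unfolding canonical_step_def s canonical_field_eq[OF \<alpha>, symmetric] xt by simp
qed

text \<open>The state of the canonical intermediate point solves the reduced equations, and for small \<open>h\<close> it
  is close enough to the state of the initial point to be the solution selected there.\<close>

theorem canonical_descends:
  assumes e: "e > 0" and h0: "h0 > 0" and B: "bounded B" "\<And>x \<alpha>. (x, \<alpha>) \<in> B \<Longrightarrow> \<alpha> \<in> su_alg \<and> state_of \<alpha> x \<in> D"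
    and red: "\<And>h z. h \<in> {0<..<h0} \<Longrightarrow> z \<in> D \<Longrightarrow> \<exists>!zt. reduced_eqs X h z zt \<and> dist zt z < e"
  shows "\<exists>d0>0. \<forall>d\<in>{0<..d0}. \<exists>h1>0. \<forall>h\<in>{0<..<h1}. \<forall>(x, \<alpha>)\<in>B.
                (\<exists>!xt. canonical_eqs X h \<alpha> x xt \<and> dist xt x < d)
              \<and> state_of \<alpha> (canonical_step X d h \<alpha> x) = reduced_step X e h (state_of \<alpha> x)"
proof -
  obtain R where R: "\<And>p. p \<in> B \<Longrightarrow> norm p \<le> R" using B(1) by (auto simp: bounded_iff)
  have lin: "lipschitz_bdd (\<lambda>q. f q)" if "bounded_linear f" for f :: "'b::real_normed_vector \<Rightarrow> 'c::real_normed_vector"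
    using that by (rule lipschitz_bdd_linear)
  have "lipschitz_bdd (\<lambda>q::real \<times> 'n cmat \<times> 'n cmat \<times> 'n cmat. (1 / 2) *\<^sub>R canonical_field (fst (snd q)) (snd (snd q)))"
    using canonical_field_lipschitz[OF
        lin[OF bounded_linear_compose[OF bounded_linear_fst bounded_linear_snd]]
        lin[OF bounded_linear_compose[OF bounded_linear_fst bounded_linear_compose[OF bounded_linear_snd bounded_linear_snd]]]
        lin[OF bounded_linear_compose[OF bounded_linear_snd bounded_linear_compose[OF bounded_linear_snd bounded_linear_snd]]]]
    by simp
  from implicit_step_family[where G = "\<lambda>h \<alpha> x. (1 / 2) *\<^sub>R canonical_field \<alpha> x", OF this, of R]
  obtain K where K0: "K \<ge> 0" and K: "\<forall>d\<in>{0<..1}. \<exists>h0>0. h0 \<le> 1 \<and>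
      (\<forall>h\<in>{0<..<h0}. contracting_step R K d h (\<lambda>\<alpha> x. (1 / 2) *\<^sub>R canonical_field \<alpha> x))"
    by blast
  define st where "st q = state_of (fst q) (snd q)" for q :: "'n cmat \<times> 'n cmat \<times> 'n cmat"
  have st_lip: "lipschitz_bdd st" unfolding st_def[abs_def]
    using state_of_lipschitz[OF lin[OF bounded_linear_fst]
        lin[OF bounded_linear_compose[OF bounded_linear_fst bounded_linear_snd]]
        lin[OF bounded_linear_compose[OF bounded_linear_snd bounded_linear_snd]]] by simp
  obtain L K' where L0: "L \<ge> 0" and "K' \<ge> 0"
    and L: "\<And>q q'. norm q \<le> R + (R + 1) \<Longrightarrow> norm q' \<le> R + (R + 1) \<Longrightarrow> norm (st q - st q') \<le> L * norm (q - q')"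
    and "\<And>q. norm q \<le> R + (R + 1) \<Longrightarrow> norm (st q) \<le> K'"
    by (rule lipschitz_bddE[OF st_lip, where R = "R + (R + 1)"], rule that)
  show ?thesis
  proof (rule exI[of _ 1], intro conjI ballI)
    fix d :: real assume d: "d \<in> {0<..1}"
    from bspec[OF K d] obtain hc where hc: "hc > 0 \<and> hc \<le> 1 \<and>
      (\<forall>h\<in>{0<..<hc}. contracting_step R K d h (\<lambda>\<alpha> x. (1 / 2) *\<^sub>R canonical_field \<alpha> x))"
      by (rule exE)
    note solv = bspec[OF conjunct2[OF conjunct2[OF hc]]]
    \<comment> \<open>the last bound controls the distance of the intermediate states, which is at most \<open>h L K\<close>\<close>
    define h1 where "h1 = min (min h0 hc) (e / (L * K + 1))"
    have LK: "L * K + 1 > 0" using L0 K0 by (simp add: add_nonneg_pos)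
    have h1: "h1 > 0" using h0 hc e LK by (simp add: h1_def)
    show "\<exists>h1>0. \<forall>h\<in>{0<..<h1}. \<forall>(x, \<alpha>)\<in>B.
                (\<exists>!xt. canonical_eqs X h \<alpha> x xt \<and> dist xt x < d)
              \<and> state_of \<alpha> (canonical_step X d h \<alpha> x) = reduced_step X e h (state_of \<alpha> x)"
    proof (rule exI[of _ h1], intro conjI h1 ballI, clarify)
      fix h x1 x2 \<alpha> assume h: "h \<in> {0<..<h1}" and xB: "((x1, x2), \<alpha>) \<in> B"
      define x where "x = (x1, x2)"
      have hh: "h \<in> {0<..<h0}" "h \<in> {0<..<hc}" "h > 0" using h by (auto simp: h1_def)
      have \<alpha>: "\<alpha> \<in> su_alg" "\<alpha> \<in> u_alg" and zD: "state_of \<alpha> x \<in> D"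
        using B(2)[OF xB] by (auto simp: x_def su_alg_iff)
      have nx: "norm x \<le> R" "norm \<alpha> \<le> R"
        using R[OF xB] norm_fst_le[of x \<alpha>] norm_snd_le[of \<alpha> x] by (auto simp: x_def)
      note cs = contracting_stepD[OF solv[OF hh(2)] nx(2)]
      have ex: "\<exists>!xt. canonical_eqs X h \<alpha> x xt \<and> dist xt x < d"
        using cs(1)[of x UNIV] nx(1)
        unfolding canonical_eqs_iff[OF \<alpha>(2)] by simp
      define xt where "xt = solution_near d (canonical_eqs X h \<alpha>) x"
      have "canonical_eqs X h \<alpha> x xt \<and> dist xt x < d"
        unfolding xt_def solution_near_def by (rule theI'[OF ex])
      then have xt: "xt = x + h *\<^sub>R ((1 / 2) *\<^sub>R canonical_field \<alpha> xt)" "dist xt x < d"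
        unfolding canonical_eqs_iff[OF \<alpha>(2)] by auto
      have nxt: "norm xt \<le> R + 1"
      proof -
        have "norm xt \<le> norm (xt - x) + norm x" by norm
        moreover have "norm (xt - x) < d" using xt(2) by (simp add: dist_norm)
        ultimately show ?thesis using d nx by simp
      qed
      have "norm (xt - x) = h * norm ((1 / 2) *\<^sub>R canonical_field \<alpha> xt)"
        using arg_cong[OF xt(1), of "\<lambda>y. norm (y - x)"] hh(3) by simp
      moreover have "\<dots> \<le> h * K" using cs(2)[OF nxt] hh(3) by (intro mult_left_mono) simp_all
      ultimately have xK: "norm (xt - x) \<le> h * K" by (simp only:)
      have st: "D.start_pt h (state_of \<alpha> xt) = state_of \<alpha> x"
      proof -
        have "xt - (h / 2) *\<^sub>R canonical_field \<alpha> xt = x"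
          using xt(1) by (metis add_diff_cancel_right' scaleR_scaleR times_divide_eq_right mult.right_neutral)
        then show ?thesis using state_of_start[OF \<alpha>(2), of xt h] by simp
      qed
      have near: "dist (state_of \<alpha> xt) (state_of \<alpha> x) < e"
      proof -
        have "norm (\<alpha>, xt) \<le> R + (R + 1)" "norm (\<alpha>, x) \<le> R + (R + 1)"
          using norm_Pair_le[of \<alpha> xt] norm_Pair_le[of \<alpha> x] nx nxt by linarith+
        from L[OF this] have "norm (state_of \<alpha> xt - state_of \<alpha> x) \<le> L * norm (xt - x)"
          by (simp add: norm_Pair st_def)
        also have "\<dots> \<le> L * (h * K)" using xK L0 by (rule mult_left_mono)
        also have "\<dots> \<le> h * (L * K + 1)" using hh(3) by (simp add: algebra_simps)
        also have "\<dots> < e" using h LK by (simp add: h1_def less_divide_eq)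
        finally show ?thesis by (simp add: dist_norm)
      qed
      have uu: "state_of \<alpha> xt \<in> uu" by (rule state_of_uu[OF \<alpha>(2)])
      have "solution_near e (reduced_eqs X h) (state_of \<alpha> x) = state_of \<alpha> xt"
        unfolding solution_near_def
        using the1_equality[OF red[OF hh(1) zD], of "state_of \<alpha> xt"] st near uu by (simp add: reduced_eqs_iff)
      from reduced_step_eq[OF this uu st]
      have "reduced_step X e h (state_of \<alpha> x) = D.end_pt h (state_of \<alpha> xt)" .
      also have "\<dots> = state_of \<alpha> (canonical_step X d h \<alpha> x)"
        unfolding canonical_step_eq[OF \<alpha>(2) xt_def[symmetric]] by (rule state_of_end[OF \<alpha>(2), symmetric])
      finally show "(\<exists>!xt. canonical_eqs X h \<alpha> (x1, x2) xt \<and> dist xt (x1, x2) < d)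
              \<and> state_of \<alpha> (canonical_step X d h \<alpha> (x1, x2)) = reduced_step X e h (state_of \<alpha> (x1, x2))"
        using ex by (simp add: x_def)
    qed
  qed simp
qed

text \<open>On a ball containing \<open>D\<close> the solution map exists for all small \<open>h\<close> and lies within \<open>K h\<close> of the
  identity, so the step \<open>z + h [y, M y]\<close> differs from the explicit Euler step by \<open>O(h\<^sup>2)\<close>.\<close>

theorem reduced_integrator:
  assumes D: "bounded D" "openin (top_of_set su2) D"
  shows "\<exists>e0>0. \<forall>e\<in>{0<..e0}. \<exists>h0>0.
          (\<forall>h\<in>{0<..<h0}. \<forall>z\<in>D. \<exists>!zt. reduced_eqs X h z zt \<and> dist zt z < e)
        \<and> lie_poisson_integrator X D h0 (reduced_step X e)
        \<and> (\<forall>h\<in>{0<..<h0}. \<forall>z\<in>D. \<exists>y\<in>uu. D.start_pt h y = z \<and> D.end_pt h y = reduced_step X e h z)"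
    (is "\<exists>e0>0. \<forall>e\<in>{0<..e0}. \<exists>h0>0. ?concl e h0")
proof -
  obtain R where R: "D \<subseteq> ball 0 R" using bounded_subset_ballD[OF D(1), of 0] by blast
  have Dsu: "D \<subseteq> su2" using D(2) openin_imp_subset by blast
  obtain K where K0: "K \<ge> 0"
    and K: "\<forall>e\<in>{0<..1}. \<exists>h0>0. h0 \<le> 1 \<and> (\<forall>h\<in>{0<..<h0}. \<exists>S. D.midpoint_solver R K e h S)"
    using D.midpoint_region[of R] by blast
  obtain L K' where L0: "L \<ge> 0" and "K' \<ge> 0"
    and L: "\<And>x y. norm x \<le> R + 1 \<Longrightarrow> norm y \<le> R + 1 \<Longrightarrow> norm (D.flow x - D.flow y) \<le> L * norm (x - y)"
    and "\<And>x. norm x \<le> R + 1 \<Longrightarrow> norm (D.flow x) \<le> K'"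
    by (rule lipschitz_bddE[OF D.flow_lipschitz, where R = "R + 1"], rule that)
  show ?thesis
  proof (rule exI[of _ 1], intro conjI ballI)
    fix e :: real assume e: "e \<in> {0<..1}"
    from bspec[OF K this] obtain h0
      where h0': "h0 > 0 \<and> h0 \<le> 1 \<and> (\<forall>h\<in>{0<..<h0}. \<exists>S. D.midpoint_solver R K e h S)"
      by (rule exE)
    then have h0: "h0 > 0" "h0 \<le> 1" by simp_all
    note ex = bspec[OF conjunct2[OF conjunct2[OF h0']]]
    have sol: "\<exists>S. implicit_solution dual_mul dual_one dual_tr dual_M h (ball 0 R) S \<and>
      (\<forall>z\<in>D. S z \<in> uu \<and> D.start_pt h (S z) = z \<and> dist (S z) z < e \<and> dist (S z) z \<le> K * h
         \<and> (\<exists>!zt. reduced_eqs X h z zt \<and> dist zt z < e)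
         \<and> reduced_step X e h z = D.end_pt h (S z))" if h: "h \<in> {0<..<h0}" for h
    proof -
      obtain S where "D.midpoint_solver R K e h S" using ex[OF h] by blast
      note S = D.midpoint_solverD(1)[OF this] and s = D.midpoint_solverD(2-)[OF this]
      show ?thesis
      proof (intro exI[of _ S] conjI S ballI)
        fix z assume z: "z \<in> D"
        have zR: "z \<in> ball 0 R" and zu: "z \<in> uu" using z R Dsu su2_uu by blast+
        show Su: "S z \<in> uu"
          by (rule s(4)[OF zR closed_uu zu]) (intro subspace_add[OF subspace_uu zu] subspace_scale[OF subspace_uu] step_field_uu)
        show st: "D.start_pt h (S z) = z" by (rule implicit_solution.S_solves[OF S zR])
        show near: "dist (S z) z < e" by (rule s(1)[OF zR])
        show "dist (S z) z \<le> K * h" by (rule s(2)[OF zR])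
        show e1: "\<exists>!zt. reduced_eqs X h z zt \<and> dist zt z < e"
        proof (rule ex1I[of _ "S z"])
          show "reduced_eqs X h z (S z) \<and> dist (S z) z < e" using Su st near by (simp add: reduced_eqs_iff)
          show "y = S z" if "reduced_eqs X h z y \<and> dist y z < e" for y
            by (rule s(3)[OF zR]) (use that in \<open>simp_all add: reduced_eqs_iff\<close>)
        qed
        have "solution_near e (reduced_eqs X h) z = S z"
          unfolding solution_near_def using near Su st by (intro the1_equality[OF e1]) (simp add: reduced_eqs_iff)
        then show "reduced_step X e h z = D.end_pt h (S z)" by (rule reduced_step_eq[OF _ Su st])
      qed
    qed
    show "\<exists>h0>0. ?concl e h0"
    proof (rule exI[of _ h0], intro conjI h0 ballI)
      fix h z assume h: "h \<in> {0<..<h0}" and z: "z \<in> D"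
      show "\<exists>!zt. reduced_eqs X h z zt \<and> dist zt z < e" using sol[OF h] z by blast
      show "\<exists>y\<in>uu. D.start_pt h y = z \<and> D.end_pt h y = reduced_step X e h z" using sol[OF h] z by fastforce
    next
      show "lie_poisson_integrator X D h0 (reduced_step X e)"
        unfolding lie_poisson_integrator_def
      proof (intro conjI ballI)
        have "dist (reduced_step X e h z) (z + h *\<^sub>R flow_field X z) \<le> (L * K) * h\<^sup>2" if h: "h \<in> {0<..<h0}" and z: "z \<in> D" for h z
        proof -
          obtain y where y: "y \<in> uu" "D.start_pt h y = z" "dist y z < e" "dist y z \<le> K * h" "reduced_step X e h z = D.end_pt h y"
            using sol[OF h] z by blast
          have nz: "norm z < R" using z R by auto
          have "norm y \<le> norm (y - z) + norm z" by norm
          moreover have "norm (y - z) < e" using y(3) by (simp add: dist_norm)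
          ultimately have ny: "norm y \<le> R + 1" using nz e by simp
          have "reduced_step X e h z = z + h *\<^sub>R D.flow y" using y by (simp add: D.end_start D.flow_def)
          moreover have "flow_field X z = D.flow z" using z Dsu su2_uu by (intro flow_field_eq) blast
          ultimately have "dist (reduced_step X e h z) (z + h *\<^sub>R flow_field X z) = h * norm (D.flow y - D.flow z)"
            using h by (simp add: dist_norm flip: scaleR_diff_right)
          also have "\<dots> \<le> h * (L * norm (y - z))" using L[OF ny, of z] nz h by (intro mult_left_mono) auto
          also have "\<dots> \<le> h * (L * (K * h))" using y(4) h L0 by (intro mult_left_mono) (auto simp: dist_norm)
          finally show ?thesis by (simp add: power2_eq_square mult_ac)
        qed
        then show "\<exists>C. \<forall>h\<in>{0<..<h0}. \<forall>z\<in>D. dist (reduced_step X e h z) (z + h *\<^sub>R flow_field X z) \<le> C * h\<^sup>2"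
          by blast
        fix h assume h: "h \<in> {0<..<h0}"
        obtain S where S: "implicit_solution dual_mul dual_one dual_tr dual_M h (ball 0 R) S" and
          Sz: "\<And>z. z \<in> D \<Longrightarrow> S z \<in> uu \<and> D.start_pt h (S z) = z \<and> reduced_step X e h z = D.end_pt h (S z)"
          using sol[OF h] by blast
        show "poisson_map_on (to_dual ` D) (to_dual \<circ> reduced_step X e h \<circ> of_dual)"
          unfolding poisson_map_on_def
        proof (intro conjI allI impI ballI)
          show "(to_dual \<circ> reduced_step X e h \<circ> of_dual) ` to_dual ` D \<subseteq> f_dual"
          proof (intro image_subsetI, elim imageE)
            fix J z assume J: "J = to_dual z" and z: "z \<in> D"
            have Su: "S z \<in> uu" and "z \<in> su2" using Sz[OF z] z Dsu by blast+
            have "reduced_step X e h z = z + h *\<^sub>R D.flow (S z)"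
              using Sz[OF z] by (simp add: D.end_start D.flow_def)
            also have "\<dots> \<in> su2"
              by (rule subspace_add[OF subspace_su2 \<open>z \<in> su2\<close> subspace_scale[OF subspace_su2 flow_su2[OF Su]]])
            finally have "to_dual (reduced_step X e h z) \<in> f_dual" by (rule to_dual_f_dual)
            then show "(to_dual \<circ> reduced_step X e h \<circ> of_dual) J \<in> f_dual" by (simp add: J)
          qed
          show "smooth_on (to_dual ` D) (to_dual \<circ> reduced_step X e h \<circ> of_dual)"
            unfolding smooth_on_def
          proof (intro exI conjI allI ballI)
            show "open (of_dual -` ball 0 R)"
              by (rule open_vimage[OF open_ball linear_continuous_on[OF linear_of_dual]])
            show "to_dual ` D \<subseteq> of_dual -` ball 0 R" using R by auto
            show "Ck_on k (of_dual -` ball 0 R) (\<lambda>J. to_dual (D.end_pt h (S (of_dual J))))" for k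
              by (rule Ck_on_compose_linear_right[OF open_ball linear_of_dual, of k 0 R "\<lambda>z. to_dual (D.end_pt h (S z))"])
                 (rule Ck_on_compose_linear_left[OF open_ball linear_to_dual implicit_solution.end_S_smooth[OF S]])
            show "to_dual (D.end_pt h (S (of_dual J))) = (to_dual \<circ> reduced_step X e h \<circ> of_dual) J" if "J \<in> to_dual ` D" for J
              using that Sz by auto
          qed
          fix F G :: "'n cmat \<times> 'n cmat \<Rightarrow> real" and J
          assume FG: "smooth_on f_dual F \<and> smooth_on f_dual G" and J: "J \<in> to_dual ` D"
          obtain z where z: "z \<in> D" "J = to_dual z" using J by blast
          show "lp_bracket (F \<circ> (to_dual \<circ> reduced_step X e h \<circ> of_dual)) (G \<circ> (to_dual \<circ> reduced_step X e h \<circ> of_dual)) J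
             = lp_bracket F G ((to_dual \<circ> reduced_step X e h \<circ> of_dual) J)"
            using midpoint_poisson[OF S D(2) R _ _ conjunct1[OF FG] conjunct2[OF FG] z(1), of "reduced_step X e h"] Sz z(2)
            by simp
        qed
      qed
    qed
  qed simp
qed

end

theorem theorem6:
  fixes X :: "3 \<Rightarrow> complex ^ 'n ^ 'n"
  assumes "CARD('n) \<ge> 2" and "spin_generators X"
  shows
    "\<comment> \<open>the system for \<open>(Q, P)\<close> is canonically Hamiltonian\<close>
     (\<forall>\<alpha>\<in>su_alg. \<forall>x. ((\<lambda>y. energy X (state_of \<alpha> y)) has_derivative
        (\<lambda>(dQ, dP). frob (f_field X \<alpha> x) dP - frob (g_field X \<alpha> x) dQ)) (at x))
   \<and> \<comment> \<open>the flow is the Lie--Poisson flow of the energy\<close>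
     (\<forall>z\<in>su_alg \<times> su_alg. flow_field X z \<in> su_alg \<times> su_alg
        \<and> (\<forall>F. smooth_on f_dual F \<longrightarrow>
            ((\<lambda>t. F (to_dual (z + t *\<^sub>R flow_field X z))) has_real_derivative
              lp_bracket F (energy X \<circ> of_dual) (to_dual z)) (at 0)))
   \<and> \<comment> \<open>the integrator, for small step sizes on any bounded region of states\<close>
     (\<forall>D. bounded D \<and> openin (top_of_set (su_alg \<times> su_alg)) D \<longrightarrow>
      (\<exists>e0>0. \<forall>e\<in>{0<..e0}. \<exists>h0>0.
          (\<forall>h\<in>{0<..<h0}. \<forall>z\<in>D. \<exists>!zt. reduced_eqs X h z zt \<and> dist zt z < e)
        \<and> lie_poisson_integrator X D h0 (reduced_step X e)
        \<and> (\<forall>B. bounded B \<and> (\<forall>(x, \<alpha>)\<in>B. \<alpha> \<in> su_alg \<and> state_of \<alpha> x \<in> D) \<longrightarrow>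
            (\<exists>d0>0. \<forall>d\<in>{0<..d0}. \<exists>h1>0. \<forall>h\<in>{0<..<h1}. \<forall>(x, \<alpha>)\<in>B.
                (\<exists>!xt. canonical_eqs X h \<alpha> x xt \<and> dist xt x < d)
              \<and> state_of \<alpha> (canonical_step X d h \<alpha> x) = reduced_step X e h (state_of \<alpha> x)))
        \<and> (\<forall>h\<in>{0<..<h0}. \<forall>(W, \<Theta>)\<in>D. \<forall>f g. smooth_on UNIV f \<and> smooth_on UNIV g \<longrightarrow>
            (case reduced_step X e h (W, \<Theta>) of (W', \<Theta>') \<Rightarrow>
                trace (fun_calc f \<Theta>) = trace (fun_calc f \<Theta>')
              \<and> trace (W ** fun_calc g \<Theta>) = trace (W' ** fun_calc g \<Theta>')))))"
proof -
  interpret spin_rep X by (rule spin_rep.intro[OF assms])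
  have integrator: "\<exists>e0>0. \<forall>e\<in>{0<..e0}. \<exists>h0>0.
          (\<forall>h\<in>{0<..<h0}. \<forall>z\<in>D. \<exists>!zt. reduced_eqs X h z zt \<and> dist zt z < e)
        \<and> lie_poisson_integrator X D h0 (reduced_step X e)
        \<and> (\<forall>B. bounded B \<and> (\<forall>(x, \<alpha>)\<in>B. \<alpha> \<in> su_alg \<and> state_of \<alpha> x \<in> D) \<longrightarrow>
            (\<exists>d0>0. \<forall>d\<in>{0<..d0}. \<exists>h1>0. \<forall>h\<in>{0<..<h1}. \<forall>(x, \<alpha>)\<in>B.
                (\<exists>!xt. canonical_eqs X h \<alpha> x xt \<and> dist xt x < d)
              \<and> state_of \<alpha> (canonical_step X d h \<alpha> x) = reduced_step X e h (state_of \<alpha> x)))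
        \<and> (\<forall>h\<in>{0<..<h0}. \<forall>(W, \<Theta>)\<in>D. \<forall>f g. smooth_on UNIV f \<and> smooth_on UNIV g \<longrightarrow>
            (case reduced_step X e h (W, \<Theta>) of (W', \<Theta>') \<Rightarrow>
                trace (fun_calc f \<Theta>) = trace (fun_calc f \<Theta>')
              \<and> trace (W ** fun_calc g \<Theta>) = trace (W' ** fun_calc g \<Theta>')))"
      (is "\<exists>e0>0. \<forall>e\<in>{0<..e0}. \<exists>h0>0. ?unique e h0 \<and> ?lp e h0 \<and> ?descent e h0 \<and> ?casimirs e h0")
    if D: "bounded D" "openin (top_of_set (su_alg \<times> su_alg)) D" for D
  proof -
    obtain e0 where e0: "e0 > 0" and main: "\<forall>e\<in>{0<..e0}. \<exists>h0>0. ?unique e h0 \<and> ?lp e h0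
        \<and> (\<forall>h\<in>{0<..<h0}. \<forall>z\<in>D. \<exists>y\<in>uu. D.start_pt h y = z \<and> D.end_pt h y = reduced_step X e h z)"
      using reduced_integrator[OF D] by (elim exE conjE) (rule that)
    show ?thesis
    proof (rule exI[of _ e0], intro conjI e0 ballI)
      fix e assume e: "e \<in> {0<..e0}"
      from bspec[OF main e] obtain h0 where h0: "h0 > 0"
        and unique: "?unique e h0" and lp: "?lp e h0"
        and step: "\<forall>h\<in>{0<..<h0}. \<forall>z\<in>D. \<exists>y\<in>uu. D.start_pt h y = z \<and> D.end_pt h y = reduced_step X e h z"
        by (elim exE conjE) (rule that)
      have casimirs: "case reduced_step X e h (W, \<Theta>) of (W', \<Theta>') \<Rightarrow>
                trace (fun_calc f \<Theta>) = trace (fun_calc f \<Theta>')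
              \<and> trace (W ** fun_calc g \<Theta>) = trace (W' ** fun_calc g \<Theta>')"
        if h: "h \<in> {0<..<h0}" and z: "(W, \<Theta>) \<in> D" for h W \<Theta> f g
      proof -
        obtain y where y: "y \<in> uu" "D.start_pt h y = (W, \<Theta>)" "D.end_pt h y = reduced_step X e h (W, \<Theta>)"
          using bspec[OF bspec[OF step h] z] by blast
        show ?thesis
          using midpoint_casimirs(1)[OF y(1), of f h] midpoint_casimirs(2)[OF y(1), of h g]
          unfolding y(2,3) split_def fst_conv snd_conv by simp
      qed
      show "\<exists>h0>0. ?unique e h0 \<and> ?lp e h0 \<and> ?descent e h0 \<and> ?casimirs e h0"
      proof (rule exI[of _ h0], intro conjI h0 unique lp)
        show "?descent e h0"
        proof (rule allI, rule impI, rule canonical_descends)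
          show "0 < e" "0 < h0" using e h0 by simp_all
          fix B :: "(('n cmat \<times> 'n cmat) \<times> 'n cmat) set"
          assume B: "bounded B \<and> (\<forall>(x, \<alpha>)\<in>B. \<alpha> \<in> su_alg \<and> state_of \<alpha> x \<in> D)"
          then show "bounded B" by simp
          show "\<alpha> \<in> su_alg \<and> state_of \<alpha> x \<in> D" if "(x, \<alpha>) \<in> B" for x \<alpha>
            using bspec[OF conjunct2[OF B] that] by simp
          show "\<exists>!zt. reduced_eqs X h z zt \<and> dist zt z < e" if "h \<in> {0<..<h0}" "z \<in> D" for h z
            using bspec[OF bspec[OF unique that(1)] that(2)] .
        qed
        show "?casimirs e h0"
          by (intro ballI, rule case_prodI2, intro allI impI) (rule casimirs; simp)
      qed
    qed
  qed
  show ?thesis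
    by (intro conjI ballI allI impI canonical_hamiltonian flow_is_lie_poisson integrator)
      (assumption | erule conjunct1 conjunct2)+
qed

end
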